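(* Let $A=KQ/I$ be a gentle algebra over $K$ with $\mathrm{char}(K)\neq 2$, and assume that for any maximal path $\rho$ in $A$ there is no arrow $\alpha\in Q_1$ satisfying $s(\alpha)=s(\rho)$, $t(\alpha)=t(\rho)$ and $\alpha\ne\rho$. Let $$0\to A\xrightarrow{\ \eta'\ }V\xrightarrow{\ \pi\ }E\to 0$$ be a short exact sequence of $A$-$A$-bimodules such that (v1) $V$ is a semisimple $K$-algebra, (v2) $\eta'$ is a morphism of $K$-algebras, and (v3) $E$ is an almost standard dual of $A$. Then there exists an isomorphism of $K$-algebras $\varphi:V\xrightarrow{\cong}V(A)$ with $\varphi\circ\eta'=\eta_A$.
   Context: $K$ is an algebraically closed field. A quiver $Q=(Q_0,Q_1,s,t)$ is finite. Paths are composed from left to right: $\alpha_1\cdots\alpha_l$ (arrows $\alpha_i$, $l\ge1$) is a path of length $l$ if $t(\alpha_i)=s(\alpha_{i+1})$; $e_a$ is the path of length $0$ at the vertex $a$. A bound quiver $(Q,I)$ is locally gentle if $I$ is an ideal of $KQ$ generated by a set of paths of length $2$, every vertex has in-degree $d_{\rm in}\le 2$ and out-degree $d_{\rm out}\le 2$, and for every arrow $\alpha$ there is at most one arrow $\beta$ with $t(\beta)=s(\alpha)$, $\beta\alpha\in I$; at most one with $t(\beta)=s(\alpha)$, $\beta\alpha\notin I$; at most one with $s(\beta)=t(\alpha)$, $\alpha\beta\in I$; at most one with $s(\beta)=t(\alpha)$, $\alpha\beta\notin I$. $A=KQ/I$ is gentle if $(Q,I)$ is locally gentle and $\dim_KA<\infty$.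 Standing assumptions: $Q$ is connected and $Q_1\neq\emptyset$. A path in $A$ is a path of $Q$ not in $I$ (length-$0$ paths allowed). $\mathfrak M_A$ is the set of maximal paths: paths $\rho$ of positive length in $A$ such that neither $\alpha\rho$ nor $\rho\alpha$ is a path in $A$ for any arrow $\alpha$. $\mathfrak T_A\subseteq Q_0$ is the set of vertices $a$ with $d_{\rm in}(a)\le1$, $d_{\rm out}(a)\le1$ and $\beta\gamma\notin I$ for all arrows $\beta,\gamma$ with $t(\beta)=s(\gamma)=a$. The algebra $V(A)$ and $\eta_A$: for $\rho=\alpha_1\cdots\alpha_l\in\mathfrak M_A$ with $s(\alpha_u)=a_{u-1}$, $t(\alpha_u)=a_u$, let $\mathcal M_\rho=M_{l+1}(K)$ with matrix units $\rho_{u,v}$ ($0\le u,v\le l$), and let $\eta_A^\rho:A\to\mathcal M_\rho$ be the $K$-algebra map with $\eta_A^\rho(e_a)=\sum_{u:\,a_u=a}\rho_{u,u}$ and, for a path $\theta$ of positive length in $A$, $\eta_A^\rho(\theta)=\rho_{u-1,v}$ if $\theta=\alpha_u\cdots\alpha_v$ for some $1\le u\le v\le l$ and $0$ otherwise. For $a\in\mathfrak T_A$ let $K\mathfrak e_a$ be the one-dimensional algebra with identity $\mathfrak e_a$ and $\eta_A^a:A\to K\mathfrak e_a$ the algebra map with $e_a\mapsto\mathfrak e_a$ and all other paths $\mapsto 0$. Put $V(A)=\prod_{\rho\in\mathfrak M_A}\mathcal M_\rho\times\prod_{a\in\mathfrak T_A}K\mathfrak e_a$, and let $\eta_A:A\to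 V(A)$ be the algebra map with these components. Almost standard dual: let $DA=\mathrm{Hom}_K(A,K)$ with its usual $A$-$A$-bimodule structure ($(\theta f)(x)=f(x\theta)$, $(f\theta)(x)=f(\theta x)$) and $\{\xi^\bullet\}$ the basis dual to the basis of paths $\xi$ in $A$. An $A$-$A$-bimodule $E$ is an almost standard dual of $A$ if it has a $K$-basis $\{\xi^\dagger\mid \xi\text{ a path in }A\}$ such that: (1) $\xi^\dagger\in e_{t(\xi)}Ee_{s(\xi)}$ for every path $\xi$; (2) for every path $\theta$ of positive length and every path $\xi$ in $A$: (a) $\theta\xi^\dagger=0$ iff $\theta\xi^\bullet=0$ in $DA$; (b) if $\ell(\theta)<\ell(\xi)$, then for a path $\omega$ in $A$, $\theta\xi^\dagger=\omega^\dagger$ iff $\theta\xi^\bullet=\omega^\bullet$; (c) if $\ell(\theta)=\ell(\xi)$, then $\theta\xi^\dagger=Ce_a^\dagger$ for some $C\in K\setminus\{0\}$ iff $\theta\xi^\bullet=e_a^\bullet$; and the analogous statements (a),(b),(c) hold for the right products $\xi^\dagger\theta$ and $\xi^\bullet\theta$. (The scalars $C$ may depend on $\xi$ and on the side.) Here $\ell$ denotes length. The $A$-$A$-bimodule structure on $V$ is the one given by $\eta'$ and multiplication in $V$. *)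

theory Defs
  imports
    "HOL-Algebra.QuotRing"
    "HOL-Algebra.Module"
    "HOL-Computational_Algebra.Computational_Algebra"
    "Graph_Theory.Digraph_Component"
    "Jordan_Normal_Form.Matrix"
begin

section \<open>Algebras over a field\<close>

text \<open>
  Algebras which depend on a bound quiver are records of type \<^typ>\<open>('k, 'x) module\<close>, with the
  scalars in a type of class \<^class>\<open>field\<close>. An arbitrary algebra lives on a type of class
  \<^class>\<open>ring_1\<close>, with an explicit scalar multiplication; \<open>alg_of\<close> is its record.
\<close>

locale k_algebra = vector_space scale
  for scale :: "'k::field \<Rightarrow> 'x::ring_1 \<Rightarrow> 'x" +
  assumes scale_mult_left: "scale c x * y = scale c (x * y)"
    and mult_scale_right: "x * scale c y = scale c (x * y)"

definition alg_of :: "('k::field \<Rightarrow> 'x::ring_1 \<Rightarrow> 'x) \<Rightarrow> ('k, 'x) module" where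
  "alg_of scale =
     \<lparr>carrier = UNIV, monoid.mult = (*), one = 1, zero = 0, add = (+), smult = scale\<rparr>"

definition alg_hom :: "('k, 'x) module \<Rightarrow> ('k, 'y) module \<Rightarrow> ('x \<Rightarrow> 'y) set" where
  "alg_hom A B =
     {h \<in> Ring.ring_hom A B. \<forall>c. \<forall>x \<in> carrier A. h (c \<odot>\<^bsub>A\<^esub> x) = c \<odot>\<^bsub>B\<^esub> h x}"

definition alg_iso :: "('k, 'x) module \<Rightarrow> ('k, 'y) module \<Rightarrow> ('x \<Rightarrow> 'y) set" where
  "alg_iso A B = {h \<in> alg_hom A B. bij_betw h (carrier A) (carrier B)}"

definition fin_dim :: "('k, 'x) module \<Rightarrow> bool" where
  "fin_dim A \<longleftrightarrow> (\<exists>B \<subseteq> carrier A. finite B \<and>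
     (\<forall>x \<in> carrier A. \<exists>c. x = (\<Oplus>\<^bsub>A\<^esub>b \<in> B. c b \<odot>\<^bsub>A\<^esub> b)))"

definition left_ideal :: "'x::ring_1 set \<Rightarrow> bool" where
  "left_ideal L \<longleftrightarrow>
     0 \<in> L \<and> (\<forall>x \<in> L. \<forall>y \<in> L. x + y \<in> L) \<and> (\<forall>r. \<forall>x \<in> L. r * x \<in> L)"

definition simple_left_ideal :: "'x::ring_1 set \<Rightarrow> bool" where
  "simple_left_ideal L \<longleftrightarrow> left_ideal L \<and> L \<noteq> {0} \<and>
     (\<forall>M. left_ideal M \<and> M \<subseteq> L \<longrightarrow> M = {0} \<or> M = L)"

text \<open>
  The left regular module is a direct sum of simple submodules. As the ring has an identity, such a
  direct sum has finitely many summands.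
\<close>

definition semisimple_ring :: "'x::ring_1 itself \<Rightarrow> bool" where
  "semisimple_ring _ \<longleftrightarrow> (\<exists>(n::nat) (L :: nat \<Rightarrow> 'x set).
     (\<forall>i<n. simple_left_ideal (L i)) \<and>
     (\<forall>v. \<exists>!x. x \<in> (\<Pi>\<^sub>E i\<in>{..<n}. L i) \<and> v = (\<Sum>i<n. x i)))"

text \<open>Only the actions of elements of \<open>carrier A\<close> on \<^typ>\<open>'e\<close> are constrained.\<close>

locale bimodule = vector_space scale
  for A :: "('k::field, 'x) module"
  and scale :: "'k \<Rightarrow> 'e::ab_group_add \<Rightarrow> 'e"
  and lact :: "'x \<Rightarrow> 'e \<Rightarrow> 'e"
  and ract :: "'e \<Rightarrow> 'x \<Rightarrow> 'e" +
  assumes lact_add: "x \<in> carrier A \<Longrightarrow> lact x (m + n) = lact x m + lact x n"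
    and lact_add_left:
      "\<lbrakk>x \<in> carrier A; y \<in> carrier A\<rbrakk> \<Longrightarrow> lact (x \<oplus>\<^bsub>A\<^esub> y) m = lact x m + lact y m"
    and lact_mult:
      "\<lbrakk>x \<in> carrier A; y \<in> carrier A\<rbrakk> \<Longrightarrow> lact (x \<otimes>\<^bsub>A\<^esub> y) m = lact x (lact y m)"
    and lact_one: "lact \<one>\<^bsub>A\<^esub> m = m"
    and lact_scale: "x \<in> carrier A \<Longrightarrow> lact x (scale c m) = scale c (lact x m)"
    and lact_smult: "x \<in> carrier A \<Longrightarrow> lact (c \<odot>\<^bsub>A\<^esub> x) m = scale c (lact x m)"
    and ract_add: "x \<in> carrier A \<Longrightarrow> ract (m + n) x = ract m x + ract n x"
    and ract_add_right:
      "\<lbrakk>x \<in> carrier A; y \<in> carrier A\<rbrakk> \<Longrightarrow> ract m (x \<oplus>\<^bsub>A\<^esub> y) = ract m x + ract m y"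
    and ract_mult:
      "\<lbrakk>x \<in> carrier A; y \<in> carrier A\<rbrakk> \<Longrightarrow> ract m (x \<otimes>\<^bsub>A\<^esub> y) = ract (ract m x) y"
    and ract_one: "ract m \<one>\<^bsub>A\<^esub> = m"
    and ract_scale: "x \<in> carrier A \<Longrightarrow> ract (scale c m) x = scale c (ract m x)"
    and ract_smult: "x \<in> carrier A \<Longrightarrow> ract m (c \<odot>\<^bsub>A\<^esub> x) = scale c (ract m x)"
    and lact_ract:
      "\<lbrakk>x \<in> carrier A; y \<in> carrier A\<rbrakk> \<Longrightarrow> ract (lact x m) y = lact x (ract m y)"

section \<open>Path algebras\<close>

text \<open>
  A quiver is a \<^typ>\<open>('v, 'a) pre_digraph\<close> satisfying \<^locale>\<open>fin_digraph\<close> (loops and parallel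
  arrows are allowed). A path is the pair of its source and its list of arrows, composed from left
  to right, so that \<open>(a, [])\<close> is the path of length 0 at \<open>a\<close>.
\<close>

type_synonym ('v, 'a) qpath = "'v \<times> 'a list"

definition psource :: "('v, 'a) qpath \<Rightarrow> 'v" where
  "psource p = fst p"

definition ptarget :: "('v, 'a) pre_digraph \<Rightarrow> ('v, 'a) qpath \<Rightarrow> 'v" where
  "ptarget Q p = pre_digraph.awlast Q (fst p) (snd p)"

definition plength :: "('v, 'a) qpath \<Rightarrow> nat" where
  "plength p = length (snd p)"

definition paths :: "('v, 'a) pre_digraph \<Rightarrow> ('v, 'a) qpath set" where
  "paths Q = {p. pre_digraph.awalk Q (psource p) (snd p) (ptarget Q p)}"

text \<open>
  For \<open>0 \<le> i \<le> j \<le> l\<close> and the path \<open>p = \<alpha>\<^sub>1 \<dots> \<alpha>\<^sub>l\<close> with vertices \<open>a\<^sub>0, \<dots>, a\<^sub>l\<close>, \<open>vertex_at Q p i\<close> is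
  \<open>a\<^sub>i\<close> and \<open>subpath Q p i j\<close> is the path from \<open>a\<^sub>i\<close> to \<open>a\<^sub>j\<close> with arrows \<open>\<alpha>\<^bsub>i+1\<^esub> \<dots> \<alpha>\<^sub>j\<close>.
\<close>

definition vertex_at :: "('v, 'a) pre_digraph \<Rightarrow> ('v, 'a) qpath \<Rightarrow> nat \<Rightarrow> 'v" where
  "vertex_at Q p i = pre_digraph.awlast Q (fst p) (take i (snd p))"

definition subpath ::
    "('v, 'a) pre_digraph \<Rightarrow> ('v, 'a) qpath \<Rightarrow> nat \<Rightarrow> nat \<Rightarrow> ('v, 'a) qpath" where
  "subpath Q p i j = (vertex_at Q p i, drop i (take j (snd p)))"

text \<open>
  The elements of \<open>KQ\<close> are the finitely supported functions on the set of paths. The product is the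
  bilinear extension of concatenation: the coefficient of \<open>p\<close> in \<open>f g\<close> is the sum of
  \<open>f q * g r\<close> over the factorisations \<open>p = q r\<close>, and these correspond to the splitting points of \<open>p\<close>.
\<close>

definition path_algebra ::
    "('v, 'a) pre_digraph \<Rightarrow> ('k::field, ('v, 'a) qpath \<Rightarrow> 'k) module" where
  "path_algebra Q =
     \<lparr>carrier = {f. finite {p. f p \<noteq> 0} \<and> {p. f p \<noteq> 0} \<subseteq> paths Q},
      monoid.mult = (\<lambda>f g p. \<Sum>i\<le>plength p. f (subpath Q p 0 i) * g (subpath Q p i (plength p))),
      one = (\<lambda>p. if p \<in> paths Q \<and> plength p = 0 then 1 else 0),
      zero = (\<lambda>p. 0),
      add = (\<lambda>f g p. f p + g p),
      smult = (\<lambda>c f p. c * f p)\<rparr>"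

definition single :: "('v, 'a) qpath \<Rightarrow> ('v, 'a) qpath \<Rightarrow> 'k::field" where
  "single p = (\<lambda>q. if q = p then 1 else 0)"

text \<open>
  The algebra \<open>KQ / I\<close>: its ring structure is that of \<^const>\<open>FactRing\<close>, its scalar multiplication is
  the induced one.
\<close>

definition quiver_algebra ::
    "('v, 'a) pre_digraph \<Rightarrow> (('v, 'a) qpath \<Rightarrow> 'k::field) set
      \<Rightarrow> ('k, (('v, 'a) qpath \<Rightarrow> 'k) set) module" where
  "quiver_algebra Q I = ring.extend (path_algebra Q Quot I)
     (module.fields
       (\<lambda>c X. \<Union>f\<in>X. I +>\<^bsub>path_algebra Q\<^esub> (c \<odot>\<^bsub>path_algebra Q\<^esub> f)))"

definition cls ::
    "('v, 'a) pre_digraph \<Rightarrow> (('v, 'a) qpath \<Rightarrow> 'k::field) set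
      \<Rightarrow> ('v, 'a) qpath \<Rightarrow> (('v, 'a) qpath \<Rightarrow> 'k) set" where
  "cls Q I p = I +>\<^bsub>path_algebra Q\<^esub> single p"

definition apaths ::
    "('v, 'a) pre_digraph \<Rightarrow> (('v, 'a) qpath \<Rightarrow> 'k::field) set \<Rightarrow> ('v, 'a) qpath set" where
  "apaths Q I = {p \<in> paths Q. single p \<notin> I}"

section \<open>Gentle algebras\<close>

text \<open>\<open>in_ideal Q I \<alpha> \<beta>\<close> is \<open>\<alpha>\<beta> \<in> I\<close>, for arrows with \<open>t(\<alpha>) = s(\<beta>)\<close>.\<close>

definition in_ideal ::
    "('v, 'a) pre_digraph \<Rightarrow> (('v, 'a) qpath \<Rightarrow> 'k::field) set \<Rightarrow> 'a \<Rightarrow> 'a \<Rightarrow> bool" where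
  "in_ideal Q I \<alpha> \<beta> \<longleftrightarrow> single (tail Q \<alpha>, [\<alpha>, \<beta>]) \<in> I"

definition locally_gentle ::
    "('v, 'a) pre_digraph \<Rightarrow> (('v, 'a) qpath \<Rightarrow> 'k::field) set \<Rightarrow> bool" where
  "locally_gentle Q I \<longleftrightarrow>
     fin_digraph Q \<and>
     (\<exists>R \<subseteq> {p \<in> paths Q. plength p = 2}. I = Idl\<^bsub>path_algebra Q\<^esub> (single ` R)) \<and>
     (\<forall>a \<in> verts Q. in_degree Q a \<le> 2 \<and> out_degree Q a \<le> 2) \<and>
     (\<forall>\<alpha> \<in> arcs Q.
        (\<exists>\<^sub>\<le>\<^sub>1 \<beta>. \<beta> \<in> arcs Q \<and> head Q \<beta> = tail Q \<alpha> \<and> in_ideal Q I \<beta> \<alpha>) \<and>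
        (\<exists>\<^sub>\<le>\<^sub>1 \<beta>. \<beta> \<in> arcs Q \<and> head Q \<beta> = tail Q \<alpha> \<and> \<not> in_ideal Q I \<beta> \<alpha>) \<and>
        (\<exists>\<^sub>\<le>\<^sub>1 \<beta>. \<beta> \<in> arcs Q \<and> tail Q \<beta> = head Q \<alpha> \<and> in_ideal Q I \<alpha> \<beta>) \<and>
        (\<exists>\<^sub>\<le>\<^sub>1 \<beta>. \<beta> \<in> arcs Q \<and> tail Q \<beta> = head Q \<alpha> \<and> \<not> in_ideal Q I \<alpha> \<beta>))"

definition gentle ::
    "('v, 'a) pre_digraph \<Rightarrow> (('v, 'a) qpath \<Rightarrow> 'k::field) set \<Rightarrow> bool" where
  "gentle Q I \<longleftrightarrow> locally_gentle Q I \<and> fin_dim (quiver_algebra Q I)"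

definition max_paths ::
    "('v, 'a) pre_digraph \<Rightarrow> (('v, 'a) qpath \<Rightarrow> 'k::field) set \<Rightarrow> ('v, 'a) qpath set" where
  "max_paths Q I = {\<rho> \<in> apaths Q I. plength \<rho> > 0 \<and>
     (\<forall>\<alpha> \<in> arcs Q.
        \<not> (head Q \<alpha> = psource \<rho> \<and> (tail Q \<alpha>, \<alpha> # snd \<rho>) \<in> apaths Q I) \<and>
        \<not> (tail Q \<alpha> = ptarget Q \<rho> \<and> (psource \<rho>, snd \<rho> @ [\<alpha>]) \<in> apaths Q I))}"

definition triv_vertices ::
    "('v, 'a) pre_digraph \<Rightarrow> (('v, 'a) qpath \<Rightarrow> 'k::field) set \<Rightarrow> 'v set" where
  "triv_vertices Q I = {a \<in> verts Q. in_degree Q a \<le> 1 \<and> out_degree Q a \<le> 1 \<and>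
     (\<forall>\<beta> \<in> arcs Q. \<forall>\<gamma> \<in> arcs Q. head Q \<beta> = a \<and> tail Q \<gamma> = a \<longrightarrow> \<not> in_ideal Q I \<beta> \<gamma>)}"

section \<open>The dual of \<open>A\<close> and almost standard duals\<close>

definition dual_space :: "('k::field, 'x) module \<Rightarrow> ('x \<Rightarrow> 'k) set" where
  "dual_space A = {f \<in> extensional (carrier A).
     (\<forall>x \<in> carrier A. \<forall>y \<in> carrier A. f (x \<oplus>\<^bsub>A\<^esub> y) = f x + f y) \<and>
     (\<forall>c. \<forall>x \<in> carrier A. f (c \<odot>\<^bsub>A\<^esub> x) = c * f x)}"

definition dual_zero :: "('k::field, 'x) module \<Rightarrow> 'x \<Rightarrow> 'k" where
  "dual_zero A = (\<lambda>x \<in> carrier A. 0)"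

definition dual_lact :: "('k::field, 'x) module \<Rightarrow> 'x \<Rightarrow> ('x \<Rightarrow> 'k) \<Rightarrow> 'x \<Rightarrow> 'k" where
  "dual_lact A t f = (\<lambda>x \<in> carrier A. f (x \<otimes>\<^bsub>A\<^esub> t))"

definition dual_ract :: "('k::field, 'x) module \<Rightarrow> ('x \<Rightarrow> 'k) \<Rightarrow> 'x \<Rightarrow> 'x \<Rightarrow> 'k" where
  "dual_ract A f t = (\<lambda>x \<in> carrier A. f (t \<otimes>\<^bsub>A\<^esub> x))"

text \<open>The member \<open>\<xi>\<^sup>\<bullet>\<close> of the basis of \<open>DA\<close> dual to the basis of paths in \<open>A\<close>.\<close>

definition dual_path ::
    "('v, 'a) pre_digraph \<Rightarrow> (('v, 'a) qpath \<Rightarrow> 'k::field) set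
      \<Rightarrow> ('v, 'a) qpath \<Rightarrow> (('v, 'a) qpath \<Rightarrow> 'k) set \<Rightarrow> 'k" where
  "dual_path Q I \<xi> = (THE f. f \<in> dual_space (quiver_algebra Q I) \<and>
     (\<forall>\<omega> \<in> apaths Q I. f (cls Q I \<omega>) = (if \<omega> = \<xi> then 1 else 0)))"

definition almost_standard_dual ::
    "('v, 'a) pre_digraph \<Rightarrow> (('v, 'a) qpath \<Rightarrow> 'k::field) set
      \<Rightarrow> ('k \<Rightarrow> 'e::ab_group_add \<Rightarrow> 'e)
      \<Rightarrow> ((('v, 'a) qpath \<Rightarrow> 'k) set \<Rightarrow> 'e \<Rightarrow> 'e)
      \<Rightarrow> ('e \<Rightarrow> (('v, 'a) qpath \<Rightarrow> 'k) set \<Rightarrow> 'e) \<Rightarrow> bool" where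
  "almost_standard_dual Q I scale lact ract \<longleftrightarrow>
    (let A = quiver_algebra Q I; P = apaths Q I; c = cls Q I; d = dual_path Q I;
         e = (\<lambda>a. (a, [])) in
     bimodule A scale lact ract \<and>
     (\<exists>b :: ('v, 'a) qpath \<Rightarrow> 'e.
        inj_on b P \<and> \<not> module.dependent scale (b ` P) \<and> module.span scale (b ` P) = UNIV \<and>
        (\<forall>\<xi> \<in> P. \<exists>m. b \<xi> = ract (lact (c (e (ptarget Q \<xi>))) m) (c (e (psource \<xi>)))) \<and>
        (\<forall>\<theta> \<in> P. \<forall>\<xi> \<in> P. plength \<theta> > 0 \<longrightarrow>
           (lact (c \<theta>) (b \<xi>) = 0 \<longleftrightarrow> dual_lact A (c \<theta>) (d \<xi>) = dual_zero A) \<and>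
           (plength \<theta> < plength \<xi> \<longrightarrow> (\<forall>\<omega> \<in> P.
              lact (c \<theta>) (b \<xi>) = b \<omega> \<longleftrightarrow> dual_lact A (c \<theta>) (d \<xi>) = d \<omega>)) \<and>
           (plength \<theta> = plength \<xi> \<longrightarrow> (\<forall>a \<in> verts Q.
              (\<exists>C. C \<noteq> 0 \<and> lact (c \<theta>) (b \<xi>) = scale C (b (e a))) \<longleftrightarrow>
              dual_lact A (c \<theta>) (d \<xi>) = d (e a))) \<and>
           (ract (b \<xi>) (c \<theta>) = 0 \<longleftrightarrow> dual_ract A (d \<xi>) (c \<theta>) = dual_zero A) \<and>
           (plength \<theta> < plength \<xi> \<longrightarrow> (\<forall>\<omega> \<in> P.
              ract (b \<xi>) (c \<theta>) = b \<omega> \<longleftrightarrow> dual_ract A (d \<xi>) (c \<theta>) = d \<omega>)) \<and>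
           (plength \<theta> = plength \<xi> \<longrightarrow> (\<forall>a \<in> verts Q.
              (\<exists>C. C \<noteq> 0 \<and> ract (b \<xi>) (c \<theta>) = scale C (b (e a))) \<longleftrightarrow>
              dual_ract A (d \<xi>) (c \<theta>) = d (e a))))))"

section \<open>The algebra \<open>V(A)\<close> and the map \<open>\<eta>\<^sub>A\<close>\<close>

definition VA ::
    "('v, 'a) pre_digraph \<Rightarrow> (('v, 'a) qpath \<Rightarrow> 'k::field) set
      \<Rightarrow> ('k, (('v, 'a) qpath \<Rightarrow> 'k mat) \<times> ('v \<Rightarrow> 'k)) module" where
  "VA Q I =
    (let M = max_paths Q I; T = triv_vertices Q I in
     \<lparr>carrier = (\<Pi>\<^sub>E \<rho>\<in>M. carrier_mat (plength \<rho> + 1) (plength \<rho> + 1)) \<times> (\<Pi>\<^sub>E a\<in>T. UNIV),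
      monoid.mult = (\<lambda>(x, y) (x', y'). (\<lambda>\<rho>\<in>M. x \<rho> * x' \<rho>, \<lambda>a\<in>T. y a * y' a)),
      one = (\<lambda>\<rho>\<in>M. 1\<^sub>m (plength \<rho> + 1), \<lambda>a\<in>T. 1),
      zero = (\<lambda>\<rho>\<in>M. 0\<^sub>m (plength \<rho> + 1) (plength \<rho> + 1), \<lambda>a\<in>T. 0),
      add = (\<lambda>(x, y) (x', y'). (\<lambda>\<rho>\<in>M. x \<rho> + x' \<rho>, \<lambda>a\<in>T. y a + y' a)),
      smult = (\<lambda>c (x, y). (\<lambda>\<rho>\<in>M. c \<cdot>\<^sub>m x \<rho>, \<lambda>a\<in>T. c * y a))\<rparr>)"

text \<open>
  The value of \<open>\<eta>\<^sub>A\<^sup>\<rho>\<close> on a path \<open>\<theta>\<close>: the sum of the matrix units \<open>\<rho>\<^bsub>i,j\<^esub>\<close> with \<open>i \<le> j\<close> such that \<open>\<theta>\<close> is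
  the subpath of \<open>\<rho>\<close> from position \<open>i\<close> to position \<open>j\<close>. For \<open>\<theta> = e\<^sub>a\<close> these are the \<open>\<rho>\<^bsub>u,u\<^esub>\<close> with
  \<open>a\<^sub>u = a\<close>. For \<open>\<theta>\<close> of positive length there is at most one, because a maximal path of a
  finite-dimensional locally gentle algebra contains no arrow twice; for
  \<open>\<theta> = \<alpha>\<^sub>u \<dots> \<alpha>\<^sub>v\<close> it is \<open>\<rho>\<^bsub>u-1,v\<^esub>\<close>.
\<close>

definition eta_path ::
    "('v, 'a) pre_digraph \<Rightarrow> ('v, 'a) qpath \<Rightarrow> ('v, 'a) qpath \<Rightarrow> 'k::field mat" where
  "eta_path Q \<rho> \<theta> = mat (plength \<rho> + 1) (plength \<rho> + 1)
     (\<lambda>(i, j). if i \<le> j \<and> \<theta> = subpath Q \<rho> i j then 1 else 0)"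

text \<open>\<open>\<eta>\<^sub>A\<close> is the linear extension of its values on the basis of paths in \<open>A\<close>.\<close>

definition eta_max ::
    "('v, 'a) pre_digraph \<Rightarrow> (('v, 'a) qpath \<Rightarrow> 'k::field) set
      \<Rightarrow> ('v, 'a) qpath \<Rightarrow> (('v, 'a) qpath \<Rightarrow> 'k) set \<Rightarrow> 'k mat" where
  "eta_max Q I \<rho> x = mat (plength \<rho> + 1) (plength \<rho> + 1)
     (\<lambda>ij. \<Sum>\<theta>\<in>apaths Q I. dual_path Q I \<theta> x * (eta_path Q \<rho> \<theta> $$ ij))"

definition eta_vertex ::
    "('v, 'a) pre_digraph \<Rightarrow> (('v, 'a) qpath \<Rightarrow> 'k::field) set
      \<Rightarrow> 'v \<Rightarrow> (('v, 'a) qpath \<Rightarrow> 'k) set \<Rightarrow> 'k" where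
  "eta_vertex Q I a x =
     (\<Sum>\<theta>\<in>apaths Q I. dual_path Q I \<theta> x * (if \<theta> = (a, []) then 1 else 0))"

definition eta ::
    "('v, 'a) pre_digraph \<Rightarrow> (('v, 'a) qpath \<Rightarrow> 'k::field) set
      \<Rightarrow> (('v, 'a) qpath \<Rightarrow> 'k) set \<Rightarrow> (('v, 'a) qpath \<Rightarrow> 'k mat) \<times> ('v \<Rightarrow> 'k)" where
  "eta Q I x = (\<lambda>\<rho>\<in>max_paths Q I. eta_max Q I \<rho> x, \<lambda>a\<in>triv_vertices Q I. eta_vertex Q I a x)"

section \<open>The short exact sequence\<close>

text \<open>
  Exactness of \<open>0 \<rightarrow> A \<rightarrow> V \<rightarrow> E \<rightarrow> 0\<close> as bimodules, where \<open>x v = \<eta>(x) * v\<close> and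
  \<open>v x = v * \<eta>(x)\<close>. The multiplicativity clause for \<open>\<eta>\<close> is both its left and its right
  \<open>A\<close>-linearity: \<open>\<eta> (x y) = x \<eta>(y)\<close> and \<open>\<eta> (x y) = \<eta>(x) y\<close>.
\<close>

definition short_exact ::
    "('k::field, 'x) module \<Rightarrow> ('k \<Rightarrow> 'w::ring_1 \<Rightarrow> 'w) \<Rightarrow> ('k \<Rightarrow> 'e::ab_group_add \<Rightarrow> 'e)
      \<Rightarrow> ('x \<Rightarrow> 'e \<Rightarrow> 'e) \<Rightarrow> ('e \<Rightarrow> 'x \<Rightarrow> 'e) \<Rightarrow> ('x \<Rightarrow> 'w) \<Rightarrow> ('w \<Rightarrow> 'e) \<Rightarrow> bool" where
  "short_exact A scaleV scaleE lact ract \<eta> \<pi> \<longleftrightarrow>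
     (\<forall>x \<in> carrier A. \<forall>y \<in> carrier A. \<eta> (x \<oplus>\<^bsub>A\<^esub> y) = \<eta> x + \<eta> y) \<and>
     (\<forall>c. \<forall>x \<in> carrier A. \<eta> (c \<odot>\<^bsub>A\<^esub> x) = scaleV c (\<eta> x)) \<and>
     (\<forall>x \<in> carrier A. \<forall>y \<in> carrier A. \<eta> (x \<otimes>\<^bsub>A\<^esub> y) = \<eta> x * \<eta> y) \<and>
     Vector_Spaces.linear scaleV scaleE \<pi> \<and>
     (\<forall>x \<in> carrier A. \<forall>v. \<pi> (\<eta> x * v) = lact x (\<pi> v) \<and> \<pi> (v * \<eta> x) = ract (\<pi> v) x) \<and>
     inj_on \<eta> (carrier A) \<and> \<eta> ` carrier A = {v. \<pi> v = 0} \<and> surj \<pi>"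

end

theory Submission
  imports Defs
begin

text \<open>
  Regard \<open>A\<close> as a subalgebra of \<open>V\<close> by means of \<open>\<eta>'\<close>. A maximal path \<open>\<rho> = \<alpha>\<^sub>1 \<dots> \<alpha>\<^sub>l\<close> becomes the matrix unit
  \<open>\<rho>\<^bsub>0,l\<^esub>\<close> in \<open>V(A)\<close>. So the task is to find in \<open>V\<close> an element \<open>g\<^sub>\<rho>\<close> which behaves like \<open>\<rho>\<^bsub>l,0\<^esub>\<close>; then the
  elements \<open>\<alpha>\<^bsub>u+1\<^esub> \<dots> \<alpha>\<^sub>l g\<^sub>\<rho> \<alpha>\<^sub>1 \<dots> \<alpha>\<^sub>v\<close> are matrix units (\<open>E_E\<close>), and it remains to show that they fill \<open>V\<close>,
  up to the idempotents which belong to \<open>\<T>\<^sub>A\<close>.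

  The element \<open>g\<^sub>\<rho>\<close> exists because \<open>\<rho> V \<rho> = K \<rho>\<close> (\<open>sandwich_scalar\<close>, \<open>sandwich_l\<close>). Indeed, in \<open>E\<close> one has
  \<open>\<omega>\<^sup>\<dagger>\<rho> = 0\<close> unless \<open>\<omega> = \<rho>\<close>, and \<open>\<rho>\<^sup>\<dagger>\<rho>\<close> is a multiple of \<open>e\<^bsub>t(\<rho>)\<^esub>\<^sup>\<dagger>\<close>. So modulo \<open>A\<close> every \<open>v \<rho>\<close> is a multiple of a
  fixed lift \<open>w\<close> of \<open>e\<^bsub>t(\<rho>)\<^esub>\<^sup>\<dagger>\<close>. For an arrow \<open>\<alpha>\<close> ending at a vertex \<open>b\<close> and a lift \<open>w\<^sub>b\<close> of \<open>e\<^sub>b\<^sup>\<dagger>\<close>, the product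
  \<open>\<alpha> w\<^sub>b\<close> lies in \<open>A\<close>, and gentleness together with the absence of an arrow parallel to a maximal path
  puts it in \<open>\<alpha> A\<close> (\<open>arrow_mult_w\<close>). Hence \<open>\<rho> w\<close> is a multiple of \<open>\<rho>\<close>, and \<open>\<rho> V \<rho>\<close> is contained in \<open>K \<rho>\<close>; it is
  not zero because a semisimple ring is semiprime. For a lift \<open>l\<close> of \<open>\<rho>\<^sup>\<dagger>\<close>, a multiple \<open>g\<close> of \<open>l \<rho> l\<close> satisfies
  \<open>\<rho> g \<rho> = \<rho>\<close> and \<open>g \<rho> g = g\<close>. The hypothesis on parallel arrows also shows that \<open>g\<close> is killed from the left by
  all arrows except \<open>\<alpha>\<^sub>l\<close> and from the right by all arrows except \<open>\<alpha>\<^sub>1\<close>. A last correction makes the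
  products of these elements for different maximal paths vanish (\<open>ex_orthogonal_partial_inverses\<close>).

  Let \<open>\<epsilon>\<^sub>a\<close> be the difference of \<open>e\<^sub>a\<close> and the diagonal matrix units at \<open>a\<close>. It is nonzero for \<open>a \<in> \<T>\<^sub>A\<close>,
  since otherwise \<open>e\<^sub>a V e\<^sub>a = K e\<^sub>a\<close>, which has no room for a lift of \<open>e\<^sub>a\<^sup>\<dagger>\<close>. Thus the matrix units and the
  idempotents \<open>\<epsilon>\<^sub>a\<close> with \<open>a \<in> \<T>\<^sub>A\<close> are linearly independent. Their number is \<open>dim V(A) \<ge> 2 dim A\<close>
  (\<open>card_cells\<close>), while \<open>dim V \<le> dim A + dim E = 2 dim A\<close>; so they form a basis of \<open>V\<close> (\<open>Psi_surj\<close>). This gives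
  an isomorphism between \<open>V(A)\<close> and \<open>V\<close>. It follows that \<open>\<epsilon>\<^sub>a = 0\<close> for \<open>a \<notin> \<T>\<^sub>A\<close> and that arrows annihilate the
  remaining \<open>\<epsilon>\<^sub>a\<close>, so that multiplying a path by \<open>e\<^sub>b\<close>, for \<open>b\<close> its end, expands it in matrix units exactly as
  \<open>\<eta>\<^sub>A\<close> does (\<open>m_eq_Psi\<close>).
\<close>

section \<open>Maximal paths of a gentle bound quiver\<close>

text \<open>
  When every element has at most one successor, two chains which cannot be prolonged agree from a
  common element on. With the converse relation and reversed lists the same fact concerns prefixes.
\<close>

lemma successively_drop_eq:
  assumes fun_r: "\<And>x y y'. r x y \<Longrightarrow> r x y' \<Longrightarrow> y = y'"
    and xs: "successively r xs" "i < length xs" "\<And>z. \<not> r (last xs) z"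
    and ys: "successively r ys" "j < length ys" "\<And>z. \<not> r (last ys) z"
    and eq: "xs ! i = ys ! j"
  shows "drop i xs = drop j ys"
proof -
  have *: "us = vs"
    if "successively r (x # us)" "successively r (x # vs)"
      and "\<And>z. \<not> r (last (x # us)) z" "\<And>z. \<not> r (last (x # vs)) z" for x us vs
    using that
  proof (induction us arbitrary: x vs)
    case Nil
    then show ?case
      by (cases vs) auto
  next
    case (Cons a us)
    then obtain b vs' where vs: "vs = b # vs'"
      by (cases vs) auto
    with Cons.prems have "a = b"
      using fun_r by auto
    with vs Cons show ?case
      by auto
  qed
  have tail: "successively r (drop k zs)" if "successively r zs" for k and zs :: "'a list"
    using that by (metis append_take_drop_id successively_append_iff)
  have "drop i xs = xs ! i # drop (Suc i) xs" "drop j ys = xs ! i # drop (Suc j) ys"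
    using xs(2) ys(2) eq by (metis Cons_nth_drop_Suc)+
  moreover have "drop (Suc i) xs = drop (Suc j) ys"
    using tail[OF xs(1), of i] tail[OF ys(1), of j] xs ys calculation
    by (intro *[of "xs ! i"]) (metis last_drop)+
  ultimately show ?thesis
    by simp
qed

text \<open>
  The combinatorics of a gentle bound quiver depends only on the relation ``the composite
  \<open>\<alpha>\<beta>\<close> is defined and nonzero in \<open>A\<close>'', called \<open>flow\<close> here. Finitely many nonzero paths
  stand for finite dimension. That no vertex is isolated follows from connectedness and the existence
  of an arrow.
\<close>

locale gentle_quiver = fin_digraph Q
  for Q :: "('v, 'a) pre_digraph" +
  fixes flow :: "'a \<Rightarrow> 'a \<Rightarrow> bool"
  assumes flowD: "flow \<alpha> \<beta> \<Longrightarrow> \<alpha> \<in> arcs Q \<and> \<beta> \<in> arcs Q \<and> head Q \<alpha> = tail Q \<beta>"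
    and flow_right_unique: "\<lbrakk>flow \<alpha> \<beta>; flow \<alpha> \<beta>'\<rbrakk> \<Longrightarrow> \<beta> = \<beta>'"
    and flow_left_unique: "\<lbrakk>flow \<beta> \<alpha>; flow \<beta>' \<alpha>\<rbrakk> \<Longrightarrow> \<beta> = \<beta>'"
    and finite_threads: "finite {xs. set xs \<subseteq> arcs Q \<and> successively flow xs}"
    and incident: "a \<in> verts Q \<Longrightarrow> \<exists>\<alpha> \<in> arcs Q. tail Q \<alpha> = a \<or> head Q \<alpha> = a"
begin

text \<open>
  A path of positive length is determined by its list of arrows, and it is nonzero in \<open>A\<close> iff this
  list is a thread. Working with plain lists avoids carrying the source along.
\<close>

definition thread :: "'a list \<Rightarrow> bool" where
  "thread xs \<longleftrightarrow> set xs \<subseteq> arcs Q \<and> successively flow xs"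

definition src :: "'a list \<Rightarrow> 'v" where
  "src xs = tail Q (hd xs)"

definition tgt :: "'a list \<Rightarrow> 'v" where
  "tgt xs = head Q (last xs)"

definition maximal :: "'a list \<Rightarrow> bool" where
  "maximal xs \<longleftrightarrow> xs \<noteq> [] \<and> thread xs \<and>
     (\<forall>\<alpha> \<in> arcs Q. \<not> thread (\<alpha> # xs) \<and> \<not> thread (xs @ [\<alpha>]))"

text \<open>
  The vertices \<open>a\<^sub>0, \<dots>, a\<^sub>l\<close> of a path with \<open>l\<close> arrows; the arrow at list index \<open>u\<close> leads from
  \<open>a\<^sub>u\<close> to \<open>a\<^bsub>u+1\<^esub>\<close>.
\<close>

definition vert :: "'a list \<Rightarrow> nat \<Rightarrow> 'v" where
  "vert xs u = (if u = 0 then src xs else head Q (xs ! (u - 1)))"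

definition positions :: "'v \<Rightarrow> ('a list \<times> nat) set" where
  "positions a = {(xs, u). maximal xs \<and> u \<le> length xs \<and> vert xs u = a}"

text \<open>
  The set of these vertices is \<open>\<T>\<^sub>A\<close>; the degree bounds are expressed by the uniqueness of the arrows.
\<close>

definition solitary :: "'v \<Rightarrow> bool" where
  "solitary a \<longleftrightarrow> a \<in> verts Q \<and>
     (\<forall>\<beta> \<in> arcs Q. \<forall>\<beta>' \<in> arcs Q. head Q \<beta> = a \<and> head Q \<beta>' = a \<longrightarrow> \<beta> = \<beta>') \<and>
     (\<forall>\<gamma> \<in> arcs Q. \<forall>\<gamma>' \<in> arcs Q. tail Q \<gamma> = a \<and> tail Q \<gamma>' = a \<longrightarrow> \<gamma> = \<gamma>') \<and>
     (\<forall>\<beta> \<in> arcs Q. \<forall>\<gamma> \<in> arcs Q. head Q \<beta> = a \<and> tail Q \<gamma> = a \<longrightarrow> flow \<beta> \<gamma>)"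

definition nonzero_paths :: "('v, 'a) qpath set" where
  "nonzero_paths = {(a, xs). if xs = [] then a \<in> verts Q else a = src xs \<and> thread xs}"

lemma thread_Nil [simp]: "thread []"
  by (simp add: thread_def)

lemma thread_single [simp]: "thread [\<alpha>] \<longleftrightarrow> \<alpha> \<in> arcs Q"
  by (simp add: thread_def)

lemma thread_Cons:
  "thread (\<alpha> # xs) \<longleftrightarrow> \<alpha> \<in> arcs Q \<and> thread xs \<and> (xs = [] \<or> flow \<alpha> (hd xs))"
  by (auto simp: thread_def successively_Cons)

lemma thread_append:
  "thread (xs @ ys) \<longleftrightarrow> thread xs \<and> thread ys \<and> (xs = [] \<or> ys = [] \<or> flow (last xs) (hd ys))"
  by (auto simp: thread_def successively_append_iff)

lemma finite_thread: "finite {xs. thread xs}"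
  using finite_threads by (simp add: thread_def)

lemma src_Cons [simp]: "src (\<alpha> # xs) = tail Q \<alpha>"
  by (simp add: src_def)

lemma tgt_snoc [simp]: "tgt (xs @ [\<alpha>]) = head Q \<alpha>"
  by (simp add: tgt_def)

lemma src_append: "xs \<noteq> [] \<Longrightarrow> src (xs @ ys) = src xs"
  by (simp add: src_def)

lemma maximalD:
  assumes "maximal xs"
  shows "xs \<noteq> []" "thread xs" "\<not> flow \<alpha> (hd xs)" "\<not> flow (last xs) \<alpha>"
  using assms flowD by (auto simp: maximal_def thread_Cons thread_append)

lemma maximalI:
  assumes "xs \<noteq> []" "thread xs" "\<And>\<alpha>. \<not> flow \<alpha> (hd xs)" "\<And>\<alpha>. \<not> flow (last xs) \<alpha>"
  shows "maximal xs"
  using assms by (auto simp: maximal_def thread_Cons thread_append)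

lemma thread_src_in: "\<lbrakk>thread xs; xs \<noteq> []\<rbrakk> \<Longrightarrow> src xs \<in> verts Q"
  by (cases xs) (auto simp: thread_Cons)

lemma thread_tgt_in: "\<lbrakk>thread xs; xs \<noteq> []\<rbrakk> \<Longrightarrow> tgt xs \<in> verts Q"
  by (cases xs rule: rev_cases) (auto simp: thread_append)

lemma finite_maximal: "finite {xs. maximal xs}"
  by (rule finite_subset[OF _ finite_thread]) (auto simp: maximal_def)

lemma finite_nonzero_paths: "finite nonzero_paths"
proof -
  have "nonzero_paths \<subseteq> verts Q \<times> {xs. thread xs}"
    using thread_src_in by (auto simp: nonzero_paths_def split: if_splits)
  then show ?thesis
    by (rule finite_subset) (simp add: finite_thread)
qed

text \<open>
  A loop with nonzero square would have nonzero powers of every length.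
\<close>

lemma flow_irrefl: "\<not> flow \<alpha> \<alpha>"
proof
  assume f: "flow \<alpha> \<alpha>"
  then have a: "\<alpha> \<in> arcs Q"
    using flowD by blast
  have s: "successively flow (replicate n \<alpha>)" for n
  proof (induction n)
    case (Suc n)
    then show ?case
      using f by (cases n) (auto simp: successively_Cons)
  qed simp
  have "range (\<lambda>n. replicate n \<alpha>) \<subseteq> {xs. set xs \<subseteq> arcs Q \<and> successively flow xs}"
    using s a by (auto dest: in_set_replicate[THEN iffD1])
  then have "finite (range (\<lambda>n. replicate n \<alpha>))"
    using finite_threads finite_subset by blast
  moreover have "inj (\<lambda>n. replicate n \<alpha>)"
    by (intro injI) (metis length_replicate)
  ultimately show False
    using finite_imageD infinite_UNIV_nat by blast
qed

lemma maximal_eq_if_hd_eq: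
  assumes "maximal xs" "maximal ys" "hd xs = hd ys"
  shows "xs = ys"
  using successively_drop_eq[of flow xs 0 ys 0] assms flow_right_unique
  by (simp add: maximalD thread_def[symmetric] hd_conv_nth)
     (metis hd_conv_nth length_greater_0_conv maximalD(1,2,4) thread_def)

text \<open>
  An arrow occurs at exactly one place of one maximal path: nonzero prolongations to the right and to
  the left of that arrow are unique.
\<close>

lemma maximal_nth_eq:
  assumes xs: "maximal xs" "i < length xs" and ys: "maximal ys" "j < length ys" and eq: "xs ! i = ys ! j"
  shows "xs = ys \<and> i = j"
proof -
  have s: "successively flow xs" "successively flow ys"
    using xs ys maximalD(2) by (auto simp: thread_def)
  have d: "drop i xs = drop j ys"
    by (rule successively_drop_eq[of flow])
      (use flow_right_unique s xs ys eq maximalD(4) in blast)+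
  have "drop (length xs - Suc i) (rev xs) = drop (length ys - Suc j) (rev ys)"
    using s xs ys eq maximalD(3) flow_left_unique
    by (intro successively_drop_eq[of "\<lambda>x y. flow y x"]) (auto simp: rev_nth last_rev)
  then have t: "take (Suc i) xs = take (Suc j) ys"
    using xs(2) ys(2) by (simp add: drop_rev)
  then have "i = j"
    using xs(2) ys(2) by (metis Suc_inject Suc_leI length_take min_absorb2)
  moreover have "take i xs = take j ys"
    using t \<open>i = j\<close> by (metis lessI min.absorb1 less_imp_le take_take)
  ultimately show ?thesis
    using d by (metis append_take_drop_id)
qed

lemma maximal_eq_if_last_eq:
  assumes "maximal xs" "maximal ys" "last xs = last ys"
  shows "xs = ys"
  using maximal_nth_eq[of xs "length xs - 1" ys "length ys - 1"] assms
  by (simp add: maximalD(1) last_conv_nth)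

lemma thread_take: "thread xs \<Longrightarrow> thread (take n xs)"
  by (metis append_take_drop_id thread_append)

lemma thread_drop: "thread xs \<Longrightarrow> thread (drop n xs)"
  by (metis append_take_drop_id thread_append)

lemma thread_nth_arc: "\<lbrakk>thread xs; i < length xs\<rbrakk> \<Longrightarrow> xs ! i \<in> arcs Q"
  by (auto simp: thread_def)

lemma thread_nth_flow: "\<lbrakk>thread xs; Suc i < length xs\<rbrakk> \<Longrightarrow> flow (xs ! i) (xs ! Suc i)"
  using successively_conv_nth[of flow xs] by (auto simp: thread_def)

lemma vert_tail: "\<lbrakk>thread xs; u < length xs\<rbrakk> \<Longrightarrow> vert xs u = tail Q (xs ! u)"
  using thread_nth_flow[of xs "u - 1"] flowD
  by (cases u) (auto simp: vert_def src_def hd_conv_nth)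

lemma vert_0 [simp]: "vert xs 0 = src xs"
  by (simp add: vert_def)

lemma vert_length: "xs \<noteq> [] \<Longrightarrow> vert xs (length xs) = tgt xs"
  by (simp add: vert_def tgt_def last_conv_nth)

lemma vert_in: "\<lbrakk>thread xs; xs \<noteq> []; u \<le> length xs\<rbrakk> \<Longrightarrow> vert xs u \<in> verts Q"
  using thread_nth_arc[of xs "u - 1"] thread_src_in[of xs] by (cases u) (auto simp: vert_def)

lemma ex_maximal_extension:
  assumes "thread xs" "xs \<noteq> []"
  shows "\<exists>us vs. maximal (us @ xs @ vs)"
proof -
  define S where "S = {ys. thread ys \<and> (\<exists>us vs. ys = us @ xs @ vs)}"
  have fin: "finite S"
    by (rule finite_subset[OF _ finite_thread]) (auto simp: S_def)
  have "xs \<in> S"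
    using assms by (auto simp: S_def intro!: exI[of _ "[] :: 'a list"])
  then have "Max (length ` S) \<in> length ` S"
    using fin by (intro Max_in) auto
  then obtain ys where ys: "ys \<in> S" and max_ys: "Max (length ` S) = length ys"
    by blast
  have m: "length zs \<le> length ys" if "zs \<in> S" for zs
    unfolding max_ys[symmetric] using that fin by simp
  obtain us vs where e: "ys = us @ xs @ vs"
    using ys by (auto simp: S_def)
  have "\<not> thread (\<alpha> # ys)" for \<alpha>
  proof
    assume "thread (\<alpha> # ys)"
    then have "\<alpha> # ys \<in> S"
      using exI[of "\<lambda>us'. \<exists>vs'. \<alpha> # ys = us' @ xs @ vs'" "\<alpha> # us"] by (simp add: S_def e)
    then show False
      using m by force
  qed
  moreover have "\<not> thread (ys @ [\<alpha>])" for \<alpha>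
  proof
    assume "thread (ys @ [\<alpha>])"
    then have "ys @ [\<alpha>] \<in> S"
      using exI[of "\<lambda>vs'. ys @ [\<alpha>] = us @ xs @ vs'" "vs @ [\<alpha>]"] by (auto simp: S_def e)
    then show False
      using m by force
  qed
  ultimately have "maximal ys"
    using ys assms(2) by (auto simp: maximal_def S_def)
  then show ?thesis
    using e by blast
qed

lemma ex_maximal_nth:
  assumes "\<alpha> \<in> arcs Q"
  obtains xs i where "maximal xs" "i < length xs" "xs ! i = \<alpha>"
proof -
  obtain us vs where "maximal (us @ [\<alpha>] @ vs)"
    using ex_maximal_extension[of "[\<alpha>]"] assms by auto
  then show ?thesis
    by (rule that[of _ "length us"]) auto
qed

lemma finite_positions: "finite (positions a)"
proof -
  have "positions a \<subseteq> (SIGMA xs:{xs. maximal xs}. {..length xs})"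
    by (auto simp: positions_def)
  then show ?thesis
    by (rule finite_subset) (simp add: finite_maximal)
qed

lemma position_after:
  assumes "\<alpha> \<in> arcs Q" "head Q \<alpha> = a"
  obtains xs i where "maximal xs" "i < length xs" "xs ! i = \<alpha>" "(xs, Suc i) \<in> positions a"
  using ex_maximal_nth[OF assms(1)] assms(2) by (auto simp: positions_def vert_def)

lemma position_before:
  assumes "\<alpha> \<in> arcs Q" "tail Q \<alpha> = a"
  obtains xs i where "maximal xs" "i < length xs" "xs ! i = \<alpha>" "(xs, i) \<in> positions a"
proof -
  obtain xs i where *: "maximal xs" "i < length xs" "xs ! i = \<alpha>"
    using ex_maximal_nth[OF assms(1)] .
  then have "(xs, i) \<in> positions a"
    using maximalD(2) by (simp add: positions_def vert_tail assms(2))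
  with * show ?thesis
    by (rule that)
qed

text \<open>
  Two different arrows ending at \<open>a\<close> (or starting at \<open>a\<close>) give two passages of maximal paths through
  \<open>a\<close>, and so does a zero relation at \<open>a\<close>, because then the two arrows are not consecutive in any
  maximal path. Only the vertices of \<open>\<T>\<^sub>A\<close> can have a single passage.
\<close>

lemma card_positions:
  assumes a: "a \<in> verts Q"
  shows "2 \<le> card (positions a) + (if solitary a then 1 else 0)"
proof -
  have two: "2 \<le> card (positions a)" if "p \<in> positions a" "q \<in> positions a" "p \<noteq> q" for p q
    using card_mono[OF finite_positions, of "{p, q}" a] that by auto
  show ?thesis
  proof (cases "solitary a")
    case True
    obtain p where "p \<in> positions a"
      using incident[OF a] position_after position_before by metis
    then have "card (positions a) \<noteq> 0"
      using finite_positions by auto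
    then show ?thesis
      using True by simp
  next
    case False
    then consider \<beta> \<beta>' where "\<beta> \<in> arcs Q" "\<beta>' \<in> arcs Q" "head Q \<beta> = a" "head Q \<beta>' = a" "\<beta> \<noteq> \<beta>'"
      | \<gamma> \<gamma>' where "\<gamma> \<in> arcs Q" "\<gamma>' \<in> arcs Q" "tail Q \<gamma> = a" "tail Q \<gamma>' = a" "\<gamma> \<noteq> \<gamma>'"
      | \<beta> \<gamma> where "\<beta> \<in> arcs Q" "\<gamma> \<in> arcs Q" "head Q \<beta> = a" "tail Q \<gamma> = a" "\<not> flow \<beta> \<gamma>"
      using a unfolding solitary_def by blast
    then have "2 \<le> card (positions a)"
    proof cases
      case 1
      obtain xs i where x: "xs ! i = \<beta>" "(xs, Suc i) \<in> positions a"
        using position_after 1 by metis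
      obtain ys j where y: "ys ! j = \<beta>'" "(ys, Suc j) \<in> positions a"
        using position_after 1 by metis
      show ?thesis
        using x y 1 by (intro two[OF x(2) y(2)]) auto
    next
      case 2
      obtain xs i where x: "xs ! i = \<gamma>" "(xs, i) \<in> positions a"
        using position_before 2 by metis
      obtain ys j where y: "ys ! j = \<gamma>'" "(ys, j) \<in> positions a"
        using position_before 2 by metis
      show ?thesis
        using x y 2 by (intro two[OF x(2) y(2)]) auto
    next
      case 3
      obtain xs i where x: "xs ! i = \<beta>" "(xs, Suc i) \<in> positions a"
        using position_after 3 by metis
      obtain ys j where y: "maximal ys" "j < length ys" "ys ! j = \<gamma>" "(ys, j) \<in> positions a"
        using position_before 3 by metis
      have "(xs, Suc i) \<noteq> (ys, j)"
        using x y 3 thread_nth_flow[of ys i] maximalD(2)[of ys] by auto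
      then show ?thesis
        by (rule two[OF x(2) y(4)])
    qed
    then show ?thesis
      by simp
  qed
qed

text \<open>
  An arrow ending at \<open>a\<close> prolongs every maximal path starting at \<open>a\<close>, so each passage through \<open>a\<close> uses
  that arrow; if there is none, each passage is at the start and uses the unique arrow leaving \<open>a\<close>.
\<close>

lemma solitary_position_unique:
  assumes a: "solitary a" and p: "(xs, u) \<in> positions a" and q: "(ys, v) \<in> positions a"
  shows "xs = ys \<and> u = v"
proof -
  have x: "maximal xs" "u \<le> length xs" "vert xs u = a" and y: "maximal ys" "v \<le> length ys" "vert ys v = a"
    using p q by (auto simp: positions_def)
  show ?thesis
  proof (cases "\<exists>\<beta> \<in> arcs Q. head Q \<beta> = a")
    case True
    then obtain \<beta> where b: "\<beta> \<in> arcs Q" "head Q \<beta> = a"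
      by blast
    have *: "\<exists>i. w = Suc i \<and> i < length zs \<and> zs ! i = \<beta>" if "maximal zs" "w \<le> length zs" "vert zs w = a" for zs w
    proof (cases w)
      case 0
      then have "tail Q (hd zs) = a" "hd zs \<in> arcs Q"
        using that maximalD(1,2)[OF that(1)] by (auto simp: src_def thread_def)
      then have "flow \<beta> (hd zs)"
        using a b by (auto simp: solitary_def)
      then show ?thesis
        using maximalD(3)[OF that(1)] by simp
    next
      case (Suc i)
      then have "zs ! i \<in> arcs Q" "head Q (zs ! i) = a"
        using that maximalD(2)[OF that(1)] by (auto simp: thread_def vert_def)
      then show ?thesis
        using a b Suc that by (auto simp: solitary_def)
    qed
    show ?thesis
      using *[OF x] *[OF y] x(1) y(1) maximal_nth_eq by metis
  next
    case False
    have *: "w = 0 \<and> hd zs \<in> arcs Q \<and> tail Q (hd zs) = a" if "maximal zs" "w \<le> length zs" "vert zs w = a" for zs w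
      using False that maximalD(1,2)[OF that(1)] thread_nth_arc[OF maximalD(2)[OF that(1)], of "w - 1"]
      by (cases w) (auto simp: src_def thread_def vert_def)
    have "hd xs = hd ys"
      using *[OF x] *[OF y] a by (auto simp: solitary_def)
    then show ?thesis
      using *[OF x] *[OF y] x(1) y(1) maximal_eq_if_hd_eq by blast
  qed
qed

text \<open>
  The index set of the matrix units of \<open>\<Prod>\<^sub>\<rho> M\<^bsub>l(\<rho>)+1\<^esub>(K)\<close>.
\<close>

definition cells :: "('a list \<times> nat \<times> nat) set" where
  "cells = (SIGMA xs:{xs. maximal xs}. {..length xs} \<times> {..length xs})"

lemma finite_cells: "finite cells"
  by (simp add: cells_def finite_maximal)

lemma finite_solitary: "finite {a. solitary a}"
  by (rule finite_subset[OF _ finite_verts]) (auto simp: solitary_def)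

text \<open>
  The inequality \<open>2 dim A \<le> dim V(A)\<close>. The cells above the diagonal map onto the paths of positive
  length, since each such path is part of a maximal one, and so do the cells below it; the diagonal
  cells are the passages through vertices, of which there are at least two at each vertex outside
  \<open>\<T>\<^sub>A\<close> and at least one elsewhere.
\<close>

lemma card_cells: "2 * card nonzero_paths \<le> card cells + card {a. solitary a}"
proof -
  define D where "D = {(xs, i, j) \<in> cells. i = j}"
  define U where "U = {(xs, i, j) \<in> cells. i < j}"
  define L where "L = {(xs, i, j) \<in> cells. j < i}"
  have "D \<subseteq> cells" "U \<subseteq> cells" "L \<subseteq> cells"
    by (auto simp: D_def U_def L_def)
  then have fin: "finite D" "finite U" "finite L"
    using finite_cells finite_subset by blast+
  have "cells = D \<union> U \<union> L" "D \<inter> U = {}" "(D \<union> U) \<inter> L = {}"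
    by (auto simp: D_def U_def L_def)
  then have 1: "card cells = card D + card U + card L"
    using fin by (simp add: card_Un_disjoint)
  have "bij_betw (\<lambda>(xs, i, j). (xs, j, i)) U L"
    by (rule bij_betwI[where g = "\<lambda>(xs, i, j). (xs, j, i)"]) (auto simp: U_def L_def cells_def)
  then have 2: "card U = card L"
    by (rule bij_betw_same_card)
  define P where "P = {p \<in> nonzero_paths. snd p \<noteq> []}"
  define N where "N = (\<lambda>a. (a, [] :: 'a list)) ` verts Q"
  have un: "nonzero_paths = P \<union> N"
    unfolding P_def N_def by (auto simp: nonzero_paths_def)
  have "P \<inter> N = {}"
    by (auto simp: P_def N_def)
  moreover have "finite P" "finite N"
    using finite_nonzero_paths by (simp_all add: P_def N_def)
  ultimately have "card nonzero_paths = card P + card N"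
    unfolding un by (rule card_Un_disjoint[rotated 2])
  moreover have "card N = card (verts Q)"
    unfolding N_def by (rule card_image) (simp add: inj_on_def)
  ultimately have 3: "card nonzero_paths = card P + card (verts Q)"
    by simp
  have "P \<subseteq> (\<lambda>(xs, i, j). (src (drop i (take j xs)), drop i (take j xs))) ` U"
  proof
    fix p
    assume "p \<in> P"
    then obtain ys where ys: "p = (src ys, ys)" "ys \<noteq> []" "thread ys"
      by (cases p) (auto simp: P_def nonzero_paths_def)
    obtain us vs where m: "maximal (us @ ys @ vs)"
      using ex_maximal_extension ys by blast
    let ?x = "(us @ ys @ vs, length us, length us + length ys)"
    have "?x \<in> U"
      using m ys by (auto simp: U_def cells_def)
    moreover have "p = (\<lambda>(xs, i, j). (src (drop i (take j xs)), drop i (take j xs))) ?x"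
      using ys by simp
    ultimately show "p \<in> (\<lambda>(xs, i, j). (src (drop i (take j xs)), drop i (take j xs))) ` U"
      by blast
  qed
  then have 4: "card P \<le> card U"
    by (rule surj_card_le[OF fin(2)])
  have "bij_betw (\<lambda>(xs, i, j). (xs, i)) D (\<Union>a\<in>verts Q. positions a)"
  proof (rule bij_betwI[where g = "\<lambda>(xs, i). (xs, i, i)"])
    show "(\<lambda>(xs, i, j). (xs, i)) \<in> D \<rightarrow> (\<Union>a\<in>verts Q. positions a)"
      by (auto simp: D_def cells_def positions_def intro!: vert_in maximalD)
    show "(\<lambda>(xs, i). (xs, i, i)) \<in> (\<Union>a\<in>verts Q. positions a) \<rightarrow> D"
      by (auto simp: D_def cells_def positions_def)
  qed (auto simp: D_def)
  then have "card D = card (\<Union>a\<in>verts Q. positions a)"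
    by (rule bij_betw_same_card)
  also have "\<dots> = (\<Sum>a\<in>verts Q. card (positions a))"
    by (rule card_UN_disjoint) (auto simp: finite_positions, auto simp: positions_def)
  finally have 5: "card D = (\<Sum>a\<in>verts Q. card (positions a))" .
  have "2 * card (verts Q) = (\<Sum>a\<in>verts Q. 2)"
    by simp
  also have "\<dots> \<le> (\<Sum>a\<in>verts Q. card (positions a) + (if solitary a then 1 else 0))"
    by (rule sum_mono) (rule card_positions)
  also have "\<dots> = card D + card {a \<in> verts Q. solitary a}"
    by (simp add: sum.distrib 5 flip: sum.inter_filter)
  also have "{a \<in> verts Q. solitary a} = {a. solitary a}"
    unfolding solitary_def by blast
  finally show ?thesis
    using 1 2 3 4 by linarith
qed

end

section \<open>Algebras containing a gentle algebra\<close>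

text \<open>
  A copy of \<open>A\<close> inside an algebra \<open>V\<close>: the images \<open>e a\<close> of the trivial paths and \<open>ar \<alpha>\<close> of the arrows
  satisfy the relations of \<open>A\<close>, and the products along nonzero paths are linearly independent.
\<close>

locale gentle_subalgebra =
  gentle_quiver Q flow + k_algebra scale
  for Q :: "('v, 'a) pre_digraph" and flow :: "'a \<Rightarrow> 'a \<Rightarrow> bool"
    and scale :: "'k::field \<Rightarrow> 'w::ring_1 \<Rightarrow> 'w" (infixr \<open>*s\<close> 75) +
  fixes e :: "'v \<Rightarrow> 'w" and ar :: "'a \<Rightarrow> 'w"
  assumes e_mult: "\<lbrakk>a \<in> verts Q; b \<in> verts Q\<rbrakk> \<Longrightarrow> e a * e b = (if a = b then e a else 0)"
    and e_ar: "\<alpha> \<in> arcs Q \<Longrightarrow> e (tail Q \<alpha>) * ar \<alpha> = ar \<alpha>"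
    and ar_e: "\<alpha> \<in> arcs Q \<Longrightarrow> ar \<alpha> * e (head Q \<alpha>) = ar \<alpha>"
    and ar_ar: "\<lbrakk>\<alpha> \<in> arcs Q; \<beta> \<in> arcs Q; \<not> flow \<alpha> \<beta>\<rbrakk> \<Longrightarrow> ar \<alpha> * ar \<beta> = 0"
    and paths_independent:
      "\<lbrakk>(\<Sum>p\<in>nonzero_paths. c p *s (if snd p = [] then e (fst p) else prod_list (map ar (snd p)))) = 0; p \<in> nonzero_paths\<rbrakk>
        \<Longrightarrow> c p = 0"
begin

definition M :: "'a list \<Rightarrow> 'w" where
  "M xs = prod_list (map ar xs)"

definition m :: "('v, 'a) qpath \<Rightarrow> 'w" where
  "m p = (if snd p = [] then e (fst p) else M (snd p))"

text \<open>
  The inclusion of \<open>A\<close> in \<open>V\<close>, in coordinates with respect to the basis of paths: \<open>range H\<close> is the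
  subalgebra \<open>A\<close>.
\<close>

definition H :: "(('v, 'a) qpath \<Rightarrow> 'k) \<Rightarrow> 'w" where
  "H c = (\<Sum>p\<in>nonzero_paths. c p *s m p)"

lemma H_eq_0D: "\<lbrakk>H c = 0; p \<in> nonzero_paths\<rbrakk> \<Longrightarrow> c p = 0"
  unfolding H_def m_def M_def by (rule paths_independent)

lemma H_cong: "(\<And>p. p \<in> nonzero_paths \<Longrightarrow> c p = d p) \<Longrightarrow> H c = H d"
  by (simp add: H_def)

lemma H_add: "H c + H d = H (\<lambda>p. c p + d p)"
  by (simp add: H_def sum.distrib scale_left_distrib)

lemma H_scale: "k *s H c = H (\<lambda>p. k * c p)"
  by (simp add: H_def scale_sum_right)

lemma H_diff: "H c - H d = H (\<lambda>p. c p - d p)"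
  by (simp add: H_def sum_subtractf scale_left_diff_distrib)

lemma H_eqD:
  assumes "H c = H d" "p \<in> nonzero_paths"
  shows "c p = d p"
  using H_eq_0D[of "\<lambda>p. c p - d p" p] assms by (simp add: H_diff[symmetric])

lemma H_zero: "H (\<lambda>p. 0) = 0"
  by (simp add: H_def)

lemma H_indicator: "p \<in> nonzero_paths \<Longrightarrow> H (\<lambda>q. if q = p then 1 else 0) = m p"
  by (simp add: H_def finite_nonzero_paths if_distrib[of "\<lambda>k. k *s _"] sum.delta cong: if_cong)

lemma range_H_add: "\<lbrakk>x \<in> range H; y \<in> range H\<rbrakk> \<Longrightarrow> x + y \<in> range H"
  using H_add by blast

lemma range_H_scale: "x \<in> range H \<Longrightarrow> k *s x \<in> range H"
  using H_scale by blast

lemma range_H_diff: "\<lbrakk>x \<in> range H; y \<in> range H\<rbrakk> \<Longrightarrow> x - y \<in> range H"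
  using H_diff by blast

lemma range_H_0: "0 \<in> range H"
  using H_zero by (metis rangeI)

lemma range_H_sum: "(\<And>i. i \<in> S \<Longrightarrow> f i \<in> range H) \<Longrightarrow> sum f S \<in> range H"
  by (induction S rule: infinite_finite_induct) (auto intro: range_H_add simp: range_H_0)

lemma range_H_m: "p \<in> nonzero_paths \<Longrightarrow> m p \<in> range H"
  using H_indicator by (metis rangeI)

lemma M_Nil [simp]: "M [] = 1" and M_Cons [simp]: "M (\<alpha> # xs) = ar \<alpha> * M xs"
  by (simp_all add: M_def)

lemma M_append: "M (xs @ ys) = M xs * M ys"
  by (simp add: M_def)

lemma M_eq_0: "\<lbrakk>set xs \<subseteq> arcs Q; \<not> thread xs\<rbrakk> \<Longrightarrow> M xs = 0"
proof (induction xs)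
  case (Cons \<alpha> xs)
  then show ?case
  proof (cases "thread xs")
    case True
    then obtain \<beta> ys where "xs = \<beta> # ys" "\<not> flow \<alpha> \<beta>"
      using Cons.prems by (cases xs) (auto simp: thread_Cons)
    then show ?thesis
      using Cons.prems ar_ar[of \<alpha> \<beta>] by (simp flip: mult.assoc)
  qed auto
qed simp

lemma M_mult_eq_0:
  assumes "thread xs" "thread ys" "xs \<noteq> []" "ys \<noteq> []" "\<not> flow (last xs) (hd ys)"
  shows "M xs * M ys = 0"
proof -
  have "\<not> thread (xs @ ys)" "set (xs @ ys) \<subseteq> arcs Q"
    using assms thread_append by (auto simp: thread_def)
  then show ?thesis
    using M_eq_0 M_append by metis
qed

lemma e_M:
  assumes "thread xs" "xs \<noteq> []" "a \<in> verts Q"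
  shows "e a * M xs = (if a = src xs then M xs else 0)"
proof -
  obtain \<alpha> ys where xs: "xs = \<alpha> # ys"
    using assms by (cases xs) auto
  then have a: "\<alpha> \<in> arcs Q"
    using assms by (simp add: thread_Cons)
  have *: "e (tail Q \<alpha>) * M xs = M xs"
    by (simp add: xs e_ar[OF a] flip: mult.assoc)
  have "e a * M xs = e a * e (tail Q \<alpha>) * M xs"
    unfolding mult.assoc * ..
  then show ?thesis
    using a assms(3) * by (simp add: e_mult xs)
qed

lemma M_e:
  assumes "thread xs" "xs \<noteq> []" "a \<in> verts Q"
  shows "M xs * e a = (if a = tgt xs then M xs else 0)"
proof -
  obtain \<alpha> ys where xs: "xs = ys @ [\<alpha>]"
    using assms by (cases xs rule: rev_cases) auto
  then have a: "\<alpha> \<in> arcs Q"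
    using assms by (simp add: thread_append)
  have *: "M xs * e (head Q \<alpha>) = M xs"
    by (simp add: xs M_append ar_e[OF a] mult.assoc)
  have "M xs * e a = M xs * (e (head Q \<alpha>) * e a)"
    unfolding mult.assoc[symmetric] * ..
  then show ?thesis
    using a assms(3) * by (simp add: e_mult xs)
qed

lemma e_m: "\<lbrakk>p \<in> nonzero_paths; a \<in> verts Q\<rbrakk> \<Longrightarrow> e a * m p = (if fst p = a then m p else 0)"
  by (cases p) (auto simp: m_def nonzero_paths_def e_mult e_M split: if_splits)

definition endpt :: "('v, 'a) qpath \<Rightarrow> 'v" where
  "endpt p = (if snd p = [] then fst p else tgt (snd p))"

lemma m_e: "\<lbrakk>p \<in> nonzero_paths; a \<in> verts Q\<rbrakk> \<Longrightarrow> m p * e a = (if endpt p = a then m p else 0)"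
  by (cases p) (auto simp: m_def nonzero_paths_def e_mult M_e endpt_def split: if_splits)

lemma ar_m:
  assumes p: "p \<in> nonzero_paths" and z: "\<zeta> \<in> arcs Q"
  shows "ar \<zeta> * m p =
    (if fst p = head Q \<zeta> \<and> thread (\<zeta> # snd p) then m (tail Q \<zeta>, \<zeta> # snd p) else 0)"
proof (cases "snd p = []")
  case True
  then have v: "fst p \<in> verts Q"
    using p by (cases p) (auto simp: nonzero_paths_def)
  have "ar \<zeta> * e (fst p) = ar \<zeta> * (e (head Q \<zeta>) * e (fst p))"
    using ar_e[OF z] by (simp flip: mult.assoc)
  then show ?thesis
    using True z ar_e[OF z] v by (auto simp: m_def e_mult)
next
  case False
  then have t: "thread (snd p)" "fst p = src (snd p)"
    using p by (cases p; auto simp: nonzero_paths_def)+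
  then have "fst p = head Q \<zeta> \<or> \<not> thread (\<zeta> # snd p)"
    using flowD False by (auto simp: thread_Cons src_def)
  moreover have "M (\<zeta> # snd p) = 0" if "\<not> thread (\<zeta> # snd p)"
    using that t z by (intro M_eq_0) (auto simp: thread_def)
  ultimately show ?thesis
    using False by (auto simp: m_def)
qed

lemma m_ar:
  assumes p: "p \<in> nonzero_paths" and z: "\<zeta> \<in> arcs Q"
  shows "m p * ar \<zeta> =
    (if endpt p = tail Q \<zeta> \<and> thread (snd p @ [\<zeta>]) then m (fst p, snd p @ [\<zeta>]) else 0)"
proof (cases "snd p = []")
  case True
  then have v: "fst p \<in> verts Q"
    using p by (cases p) (auto simp: nonzero_paths_def)
  have "e (fst p) * ar \<zeta> = e (fst p) * e (tail Q \<zeta>) * ar \<zeta>"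
    using e_ar[OF z] by (simp add: mult.assoc)
  then show ?thesis
    using True z e_ar[OF z] v by (auto simp: m_def e_mult endpt_def)
next
  case False
  then have t: "thread (snd p)" "fst p = src (snd p)"
    using p by (cases p; auto simp: nonzero_paths_def)+
  then have "endpt p = tail Q \<zeta> \<or> \<not> thread (snd p @ [\<zeta>])"
    using flowD False by (auto simp: thread_append tgt_def endpt_def)
  moreover have "M (snd p @ [\<zeta>]) = 0" if "\<not> thread (snd p @ [\<zeta>])"
    using that t z by (intro M_eq_0) (auto simp: thread_def)
  ultimately show ?thesis
    using False by (auto simp: m_def M_append)
qed

lemma e_H: "a \<in> verts Q \<Longrightarrow> e a * H c = H (\<lambda>p. if fst p = a then c p else 0)"
  unfolding H_def sum_distrib_left by (rule sum.cong) (auto simp: mult_scale_right e_m)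

lemma H_e: "a \<in> verts Q \<Longrightarrow> H c * e a = H (\<lambda>p. if endpt p = a then c p else 0)"
  unfolding H_def sum_distrib_right by (rule sum.cong) (auto simp: scale_mult_left m_e)

lemma nonzero_paths_ConsD: "(a, \<zeta> # xs) \<in> nonzero_paths \<Longrightarrow> a = tail Q \<zeta> \<and> (head Q \<zeta>, xs) \<in> nonzero_paths"
  using flowD by (cases xs) (auto simp: nonzero_paths_def thread_Cons split: if_splits)

lemma nonzero_paths_snocD: "(a, xs @ [\<zeta>]) \<in> nonzero_paths \<Longrightarrow> (a, xs) \<in> nonzero_paths \<and> endpt (a, xs) = tail Q \<zeta>"
  by (cases xs) (auto simp: nonzero_paths_def thread_append thread_Cons src_def endpt_def tgt_def dest: flowD split: if_splits)

text \<open>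
  Left multiplication by an arrow is injective on the paths which it prolongs, so it only moves
  coordinates. Comparing coordinates on both sides is how the structure of \<open>A\<close> is exploited below.
\<close>

lemma ar_H:
  assumes z: "\<zeta> \<in> arcs Q"
  shows "ar \<zeta> * H c = H (\<lambda>(a, ys). if ys \<noteq> [] \<and> hd ys = \<zeta> then c (head Q \<zeta>, tl ys) else 0)"
proof -
  let ?S = "{p \<in> nonzero_paths. fst p = head Q \<zeta> \<and> thread (\<zeta> # snd p)}"
  let ?T = "{p \<in> nonzero_paths. snd p \<noteq> [] \<and> hd (snd p) = \<zeta>}"
  have "ar \<zeta> * H c = (\<Sum>p\<in>nonzero_paths. c p *s (ar \<zeta> * m p))"
    by (simp add: H_def sum_distrib_left mult_scale_right)
  also have "\<dots> = (\<Sum>p\<in>?S. c p *s m (tail Q \<zeta>, \<zeta> # snd p))"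
    unfolding sum.inter_filter[OF finite_nonzero_paths] by (rule sum.cong) (auto simp: ar_m z)
  also have "\<dots> = (\<Sum>q\<in>?T. c (head Q \<zeta>, tl (snd q)) *s m q)"
  proof (rule sum.reindex_bij_witness[where i = "\<lambda>q. (head Q \<zeta>, tl (snd q))"
        and j = "\<lambda>p. (tail Q \<zeta>, \<zeta> # snd p)"])
    fix q
    assume q: "q \<in> ?T"
    then obtain a ys where e: "q = (a, \<zeta> # ys)"
      by (cases q; cases "snd q") auto
    then have "(a, \<zeta> # ys) \<in> nonzero_paths"
      using q by simp
    then have "a = tail Q \<zeta>" "(head Q \<zeta>, ys) \<in> nonzero_paths" "thread (\<zeta> # ys)"
      using nonzero_paths_ConsD[of a \<zeta> ys] by (simp_all add: nonzero_paths_def)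
    then show "(tail Q \<zeta>, \<zeta> # snd (head Q \<zeta>, tl (snd q))) = q" "(head Q \<zeta>, tl (snd q)) \<in> ?S"
      by (simp_all add: e)
  qed (auto simp: nonzero_paths_def)
  also have "\<dots> = H (\<lambda>(a, ys). if ys \<noteq> [] \<and> hd ys = \<zeta> then c (head Q \<zeta>, tl ys) else 0)"
    unfolding H_def sum.inter_filter[OF finite_nonzero_paths] by (rule sum.cong) auto
  finally show ?thesis .
qed

lemma H_ar:
  assumes z: "\<zeta> \<in> arcs Q"
  shows "H c * ar \<zeta> = H (\<lambda>(a, ys). if ys \<noteq> [] \<and> last ys = \<zeta> then c (a, butlast ys) else 0)"
proof -
  let ?S = "{p \<in> nonzero_paths. endpt p = tail Q \<zeta> \<and> thread (snd p @ [\<zeta>])}"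
  let ?T = "{p \<in> nonzero_paths. snd p \<noteq> [] \<and> last (snd p) = \<zeta>}"
  have "H c * ar \<zeta> = (\<Sum>p\<in>nonzero_paths. c p *s (m p * ar \<zeta>))"
    by (simp add: H_def sum_distrib_right scale_mult_left)
  also have "\<dots> = (\<Sum>p\<in>?S. c p *s m (fst p, snd p @ [\<zeta>]))"
    unfolding sum.inter_filter[OF finite_nonzero_paths] by (rule sum.cong) (auto simp: m_ar z)
  also have "\<dots> = (\<Sum>q\<in>?T. c (fst q, butlast (snd q)) *s m q)"
  proof (rule sum.reindex_bij_witness[where i = "\<lambda>q. (fst q, butlast (snd q))"
        and j = "\<lambda>p. (fst p, snd p @ [\<zeta>])"])
    fix q
    assume q: "q \<in> ?T"
    then obtain a ys where e: "q = (a, ys @ [\<zeta>])"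
      by (cases q; cases "snd q" rule: rev_cases) auto
    then have "(a, ys @ [\<zeta>]) \<in> nonzero_paths"
      using q by simp
    then have "(a, ys) \<in> nonzero_paths" "endpt (a, ys) = tail Q \<zeta>" "thread (ys @ [\<zeta>])"
      using nonzero_paths_snocD[of a ys \<zeta>] by (blast, blast, simp add: nonzero_paths_def)
    then show "(fst (fst q, butlast (snd q)), snd (fst q, butlast (snd q)) @ [\<zeta>]) = q"
      "(fst q, butlast (snd q)) \<in> ?S"
      by (simp_all add: e)
  next
    fix p
    assume "p \<in> ?S"
    then show "(fst p, snd p @ [\<zeta>]) \<in> ?T"
      by (cases p; cases "snd p") (auto simp: nonzero_paths_def endpt_def)
  qed auto
  also have "\<dots> = H (\<lambda>(a, ys). if ys \<noteq> [] \<and> last ys = \<zeta> then c (a, butlast ys) else 0)"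
    unfolding H_def sum.inter_filter[OF finite_nonzero_paths] by (rule sum.cong) auto
  finally show ?thesis .
qed

text \<open>
  Only the trivial path at its source can be composed with a maximal path from the left.
\<close>

lemma H_M_maximal:
  assumes r: "maximal \<rho>"
  shows "H c * M \<rho> = c (src \<rho>, []) *s M \<rho>"
proof -
  note d = maximalD[OF r]
  have *: "m p * M \<rho> = (if p = (src \<rho>, []) then M \<rho> else 0)" if p: "p \<in> nonzero_paths" for p
  proof (cases "snd p = []")
    case True
    then show ?thesis
      using p d by (cases p) (auto simp: m_def nonzero_paths_def e_M)
  next
    case False
    then show ?thesis
      using p d by (cases p) (auto simp: m_def nonzero_paths_def M_mult_eq_0)
  qed
  have "(src \<rho>, []) \<in> nonzero_paths"
    using d thread_src_in by (simp add: nonzero_paths_def)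
  then show ?thesis
    by (simp add: H_def sum_distrib_right scale_mult_left * if_distrib[of "(*s) _"] sum.delta finite_nonzero_paths cong: if_cong)
qed

lemma M_H_maximal:
  assumes r: "maximal \<rho>"
  shows "M \<rho> * H c = c (tgt \<rho>, []) *s M \<rho>"
proof -
  note d = maximalD[OF r]
  have *: "M \<rho> * m p = (if p = (tgt \<rho>, []) then M \<rho> else 0)" if p: "p \<in> nonzero_paths" for p
  proof (cases "snd p = []")
    case True
    then show ?thesis
      using p d by (cases p) (auto simp: m_def nonzero_paths_def M_e)
  next
    case False
    then show ?thesis
      using p d by (cases p) (auto simp: m_def nonzero_paths_def M_mult_eq_0)
  qed
  have "(tgt \<rho>, []) \<in> nonzero_paths"
    using d thread_tgt_in by (simp add: nonzero_paths_def)
  then show ?thesis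
    by (simp add: H_def sum_distrib_left mult_scale_right * if_distrib[of "(*s) _"] sum.delta finite_nonzero_paths cong: if_cong)
qed

end

section \<open>Lifts of dual elements\<close>

text \<open>
  What remains of the exact sequence \<open>0 \<rightarrow> A \<rightarrow> V \<rightarrow> E \<rightarrow> 0\<close> when \<open>E\<close> is eliminated: \<open>w a\<close> and \<open>l \<rho>\<close> are lifts to
  \<open>V\<close> of \<open>e\<^sub>a\<^sup>\<dagger>\<close> and of \<open>\<rho>\<^sup>\<dagger>\<close> for maximal \<open>\<rho>\<close>, and membership in \<open>range H\<close> means vanishing in \<open>E\<close>.
  Assumption \<open>mod_l\<close> says that \<open>\<omega>\<^sup>\<dagger>\<rho> = 0\<close> for all paths \<open>\<omega> \<noteq> \<rho>\<close>, and \<open>l_M\<close> that \<open>\<rho>\<^sup>\<dagger>\<rho>\<close> is a multiple of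
  \<open>e\<^bsub>t(\<rho>)\<^esub>\<^sup>\<dagger>\<close>. Semisimplicity enters as semiprimeness, and \<open>spanned\<close> is the bound \<open>dim V \<le> 2 dim A\<close>.
\<close>

locale dual_extension = gentle_subalgebra Q flow scale e ar
  for Q :: "('v, 'a) pre_digraph" and flow :: "'a \<Rightarrow> 'a \<Rightarrow> bool"
    and scale :: "'k::field \<Rightarrow> 'w::ring_1 \<Rightarrow> 'w" (infixr \<open>*s\<close> 75)
    and e :: "'v \<Rightarrow> 'w" and ar :: "'a \<Rightarrow> 'w" +
  fixes w :: "'v \<Rightarrow> 'w" and l :: "'a list \<Rightarrow> 'w"
  assumes no_parallel:
      "\<lbrakk>maximal \<rho>; \<alpha> \<in> arcs Q; tail Q \<alpha> = src \<rho>; head Q \<alpha> = tgt \<rho>\<rbrakk> \<Longrightarrow> \<rho> = [\<alpha>]"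
    and e_w: "a \<in> verts Q \<Longrightarrow> e a * w a = w a"
    and w_e: "a \<in> verts Q \<Longrightarrow> w a * e a = w a"
    and w_notin: "a \<in> verts Q \<Longrightarrow> w a \<notin> range H"
    and ar_w: "\<lbrakk>a \<in> verts Q; \<alpha> \<in> arcs Q\<rbrakk> \<Longrightarrow> ar \<alpha> * w a \<in> range H"
    and w_ar: "\<lbrakk>a \<in> verts Q; \<alpha> \<in> arcs Q\<rbrakk> \<Longrightarrow> w a * ar \<alpha> \<in> range H"
    and e_l: "maximal \<rho> \<Longrightarrow> e (tgt \<rho>) * l \<rho> = l \<rho>"
    and l_e: "maximal \<rho> \<Longrightarrow> l \<rho> * e (src \<rho>) = l \<rho>"
    and ar_l: "\<lbrakk>maximal \<rho>; \<alpha> \<in> arcs Q; \<alpha> \<noteq> last \<rho>\<rbrakk> \<Longrightarrow> ar \<alpha> * l \<rho> \<in> range H"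
    and l_ar: "\<lbrakk>maximal \<rho>; \<alpha> \<in> arcs Q; \<alpha> \<noteq> hd \<rho>\<rbrakk> \<Longrightarrow> l \<rho> * ar \<alpha> \<in> range H"
    and l_M: "maximal \<rho> \<Longrightarrow> \<exists>C. l \<rho> * M \<rho> - C *s w (tgt \<rho>) \<in> range H"
    and mod_l: "maximal \<rho> \<Longrightarrow> \<exists>k. (v - k *s l \<rho>) * M \<rho> \<in> range H"
    and spanned: "\<exists>S. finite S \<and> card S \<le> 2 * card nonzero_paths \<and> span S = UNIV"
    and semiprime: "(x :: 'w) \<noteq> 0 \<Longrightarrow> \<exists>y. x * y * x \<noteq> 0"
begin

text \<open>
  Let \<open>\<alpha> w\<^sub>b = \<Sum> c\<^sub>p p\<close> in \<open>A\<close> and suppose that \<open>c\<^sub>p \<noteq> 0\<close> for a path \<open>p\<close> which does not start with \<open>\<alpha>\<close>. If an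
  arrow \<open>\<zeta>\<close> prolonged \<open>p\<close> to the left, then \<open>\<zeta>\<alpha> = 0\<close>, and multiplying by \<open>\<zeta>\<close> would give \<open>c\<^sub>p = 0\<close>. If
  an arrow \<open>\<epsilon>\<close> prolonged \<open>p\<close> to the right, then multiplying by \<open>\<epsilon>\<close> would give \<open>c\<^sub>p = 0\<close> too, because
  \<open>w\<^sub>b \<epsilon>\<close> lies in \<open>A\<close> and so \<open>\<alpha> w\<^sub>b \<epsilon>\<close> lies in \<open>\<alpha> A\<close>. Hence \<open>p\<close> is a maximal path parallel to the arrow
  \<open>\<alpha>\<close>, which is excluded.
\<close>

lemma arrow_mult_w:
  assumes a: "\<alpha> \<in> arcs Q"
  shows "\<exists>d. ar \<alpha> * w (head Q \<alpha>) = ar \<alpha> * H d"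
proof -
  define b where "b = head Q \<alpha>"
  have b: "b \<in> verts Q"
    using a by (simp add: b_def)
  obtain c where c: "ar \<alpha> * w b = H c"
    using ar_w[OF b a] by blast
  have "e (tail Q \<alpha>) * H c = H c"
    by (simp add: e_ar[OF a] flip: c mult.assoc)
  then have "H (\<lambda>p. if fst p = tail Q \<alpha> then c p else 0) = H c"
    using a by (simp add: e_H)
  then have source: "fst p = tail Q \<alpha>" if "p \<in> nonzero_paths" "c p \<noteq> 0" for p
    using H_eqD[of "\<lambda>p. if fst p = tail Q \<alpha> then c p else 0" c p] that by (auto split: if_splits)
  have "H c * e b = H c"
    by (simp add: w_e[OF b] mult.assoc flip: c)
  then have "H (\<lambda>p. if endpt p = b then c p else 0) = H c"
    using b by (simp add: H_e)
  then have target: "endpt p = b" if "p \<in> nonzero_paths" "c p \<noteq> 0" for p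
    using H_eqD[of "\<lambda>p. if endpt p = b then c p else 0" c p] that by (auto split: if_splits)
  have starts: "snd p \<noteq> [] \<and> hd (snd p) = \<alpha>" if p: "p \<in> nonzero_paths" and cp: "c p \<noteq> 0" for p
  proof (rule ccontr)
    assume ns: "\<not> (snd p \<noteq> [] \<and> hd (snd p) = \<alpha>)"
    show False
    proof (cases "snd p = []")
      case True
      \<comment> \<open>Here \<open>\<alpha>\<close> is a loop with \<open>\<alpha>\<alpha> = 0\<close>, so \<open>0 = \<alpha>\<alpha> w\<^sub>b\<close> has the coordinate \<open>c\<^sub>p\<close> at \<open>\<alpha>\<close>.\<close>
      then have "p = (head Q \<alpha>, [])"
        using target[OF p cp] by (cases p) (simp add: endpt_def b_def)
      moreover have "ar \<alpha> * H c = 0"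
        using ar_ar[OF a a flow_irrefl] by (simp flip: c mult.assoc)
      then have "c (head Q \<alpha>, []) = 0"
        using H_eq_0D[of "\<lambda>(a, ys). if ys \<noteq> [] \<and> hd ys = \<alpha> then c (head Q \<alpha>, tl ys) else 0"
            "(tail Q \<alpha>, [\<alpha>])"] a
        by (simp add: ar_H nonzero_paths_def)
      ultimately show False
        using cp by simp
    next
      case False
      then obtain ys where ys: "p = (src ys, ys)" "ys \<noteq> []" "thread ys" "hd ys \<noteq> \<alpha>"
        using p ns by (cases p) (auto simp: nonzero_paths_def)
      have "\<not> flow \<zeta> (hd ys)" for \<zeta>
      proof
        assume f: "flow \<zeta> (hd ys)"
        then have z: "\<zeta> \<in> arcs Q" "head Q \<zeta> = src ys"
          using flowD by (auto simp: src_def)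
        have "\<not> flow \<zeta> \<alpha>"
          using f ys flow_right_unique by blast
        then have "ar \<zeta> * H c = 0"
          using ar_ar[OF z(1) a] by (simp flip: c mult.assoc)
        then have "c (head Q \<zeta>, ys) = 0"
          using H_eq_0D[of "\<lambda>(a, ys). if ys \<noteq> [] \<and> hd ys = \<zeta> then c (head Q \<zeta>, tl ys) else 0"
              "(tail Q \<zeta>, \<zeta> # ys)"] f ys z
          by (simp add: ar_H nonzero_paths_def thread_Cons)
        then show False
          using cp ys z by simp
      qed
      moreover have "\<not> flow (last ys) \<epsilon>" for \<epsilon>
      proof
        assume f: "flow (last ys) \<epsilon>"
        then have z: "\<epsilon> \<in> arcs Q"
          using flowD by blast
        obtain d where d: "w b * ar \<epsilon> = H d"
          using w_ar[OF b z] by blast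
        have "H c * ar \<epsilon> = ar \<alpha> * H d"
          by (simp add: mult.assoc flip: c d)
        moreover have "(src ys, ys @ [\<epsilon>]) \<in> nonzero_paths"
          using f ys z by (simp add: nonzero_paths_def thread_append src_append)
        ultimately have "c (src ys, ys) = 0"
          using H_eqD[of "\<lambda>(a, ys). if ys \<noteq> [] \<and> last ys = \<epsilon> then c (a, butlast ys) else 0"
              "\<lambda>(a, ys). if ys \<noteq> [] \<and> hd ys = \<alpha> then d (head Q \<alpha>, tl ys) else 0"
              "(src ys, ys @ [\<epsilon>])"] ys
          by (simp add: ar_H H_ar a z)
        then show False
          using cp ys by simp
      qed
      ultimately have "maximal ys"
        using ys maximalI by blast
      then have "ys = [\<alpha>]"
        using no_parallel[OF _ a] source[OF p cp] target[OF p cp] ys by (simp add: endpt_def b_def)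
      then show False
        using ys by simp
    qed
  qed
  have "ar \<alpha> * H (\<lambda>(a, ys). c (tail Q \<alpha>, \<alpha> # ys)) = H c"
    unfolding ar_H[OF a]
  proof (rule H_cong)
    fix p
    assume p: "p \<in> nonzero_paths"
    show "(case p of (x, ys) \<Rightarrow> if ys \<noteq> [] \<and> hd ys = \<alpha>
        then case (head Q \<alpha>, tl ys) of (x, ys) \<Rightarrow> c (tail Q \<alpha>, \<alpha> # ys) else 0) = c p"
    proof (cases "snd p \<noteq> [] \<and> hd (snd p) = \<alpha>")
      case True
      then obtain a ys where e: "p = (a, \<alpha> # ys)"
        by (cases p; cases "snd p") auto
      then have "a = tail Q \<alpha>"
        using p nonzero_paths_ConsD by blast
      then show ?thesis
        by (simp add: e)
    next
      case False
      then show ?thesis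
        using starts[OF p] by (cases p) auto
    qed
  qed
  then have "ar \<alpha> * w (head Q \<alpha>) = ar \<alpha> * H (\<lambda>(a, ys). c (tail Q \<alpha>, \<alpha> # ys))"
    using c by (simp add: b_def)
  then show ?thesis
    by blast
qed

text \<open>
  By the previous lemma, applied to the last arrow of \<open>\<rho>\<close>, the product lies in \<open>\<rho> A = K \<rho>\<close>.
\<close>

lemma maximal_mult_w:
  assumes r: "maximal \<rho>"
  shows "\<exists>k. M \<rho> * w (tgt \<rho>) = k *s M \<rho>"
proof -
  obtain xs \<alpha> where xs: "\<rho> = xs @ [\<alpha>]"
    using maximalD(1)[OF r] by (cases \<rho> rule: rev_cases) auto
  then have "\<alpha> \<in> arcs Q"
    using maximalD(2)[OF r] by (simp add: thread_append)
  then obtain d where "ar \<alpha> * w (head Q \<alpha>) = ar \<alpha> * H d"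
    using arrow_mult_w by blast
  then have "M \<rho> * w (tgt \<rho>) = M \<rho> * H d"
    by (simp add: xs M_append mult.assoc)
  then show ?thesis
    using M_H_maximal[OF r] by auto
qed

lemma M_mult_range_H: "\<lbrakk>set xs \<subseteq> arcs Q; x \<in> range H\<rbrakk> \<Longrightarrow> M xs * x \<in> range H"
proof (induction xs)
  case (Cons \<alpha> xs)
  then obtain c where "M xs * x = H c"
    by auto
  then show ?case
    using Cons.prems by (simp add: mult.assoc ar_H)
qed simp

lemma maximal_in_verts: "maximal \<rho> \<Longrightarrow> src \<rho> \<in> verts Q" "maximal \<rho> \<Longrightarrow> tgt \<rho> \<in> verts Q"
  using thread_src_in thread_tgt_in maximalD(1,2) by blast+

lemma M_maximal_neq_0: "maximal \<rho> \<Longrightarrow> M \<rho> \<noteq> 0"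
proof
  assume r: "maximal \<rho>" and z: "M \<rho> = 0"
  then have p: "(src \<rho>, \<rho>) \<in> nonzero_paths"
    using maximalD(1,2)[OF r] by (simp add: nonzero_paths_def)
  have "H (\<lambda>q. if q = (src \<rho>, \<rho>) then 1 else 0) = 0"
    using H_indicator[OF p] z maximalD(1)[OF r] by (simp add: m_def)
  then show False
    using H_eq_0D[OF _ p] by fastforce
qed

text \<open>
  Write \<open>y = v \<rho>\<close> and \<open>w' = w - k\<close> with \<open>\<rho> w' = 0\<close>. Modulo \<open>A\<close>, every nontrivial path kills \<open>w'\<close>, so
  \<open>0 = y w'\<close> is \<open>w'\<close> times the coordinate of \<open>y\<close> at the trivial path \<open>e\<^bsub>t(\<rho>)\<^esub>\<close>. As \<open>w'\<close> is not in \<open>A\<close>, this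
  coordinate vanishes; but \<open>\<rho> y\<close> is this coordinate times \<open>\<rho>\<close>.
\<close>

lemma sandwich_eq_0:
  assumes r: "maximal \<rho>" and v: "v * M \<rho> \<in> range H"
  shows "M \<rho> * v * M \<rho> = 0"
proof -
  define t where "t = tgt \<rho>"
  have t: "t \<in> verts Q"
    using maximal_in_verts[OF r] by (simp add: t_def)
  obtain c where c: "v * M \<rho> = H c"
    using v by blast
  obtain k where k: "M \<rho> * w t = k *s M \<rho>"
    using maximal_mult_w[OF r] t_def by blast
  define w' where "w' = w t - k *s e t"
  have "M \<rho> * w' = 0"
    using k M_e[OF maximalD(2,1)[OF r] t]
    by (simp add: w'_def right_diff_distrib mult_scale_right t_def)
  then have "H c * w' = 0"
    by (simp add: mult.assoc flip: c)
  then have sum0: "(\<Sum>p\<in>nonzero_paths. c p *s (m p * w')) = 0"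
    by (simp add: H_def sum_distrib_right scale_mult_left)
  have e_w': "e a * w' = (if a = t then w' else 0)" if a: "a \<in> verts Q" for a
  proof -
    have "e a * w t = e a * e t * w t"
      using e_w[OF t] by (simp add: mult.assoc)
    then show ?thesis
      using a t e_w[OF t] by (simp add: w'_def right_diff_distrib mult_scale_right e_mult)
  qed
  have ar_w': "ar \<alpha> * w' \<in> range H" if a: "\<alpha> \<in> arcs Q" for \<alpha>
  proof -
    have "(t, []) \<in> nonzero_paths"
      using t by (simp add: nonzero_paths_def)
    then have "ar \<alpha> * e t \<in> range H"
      using ar_H[OF a] range_H_m[of "(t, [])"] by (auto simp: m_def)
    then show ?thesis
      using ar_w[OF t a]
      by (auto simp: w'_def right_diff_distrib mult_scale_right intro!: range_H_diff range_H_scale)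
  qed
  have rest: "m p * w' \<in> range H" if p: "p \<in> nonzero_paths" "p \<noteq> (t, [])" for p
  proof (cases "snd p = []")
    case True
    then have "m p * w' = 0"
      using p by (cases p) (auto simp: m_def nonzero_paths_def e_w')
    then show ?thesis
      using range_H_0 by simp
  next
    case False
    then obtain ys \<alpha> where ys: "snd p = ys @ [\<alpha>]"
      by (cases "snd p" rule: rev_cases) auto
    then have "set ys \<subseteq> arcs Q" "\<alpha> \<in> arcs Q"
      using p by (cases p; auto simp: nonzero_paths_def thread_def)+
    then show ?thesis
      using ys M_mult_range_H[OF _ ar_w'] by (simp add: m_def M_append mult.assoc)
  qed
  have tp: "(t, []) \<in> nonzero_paths"
    using t by (simp add: nonzero_paths_def)
  have "(\<Sum>p\<in>nonzero_paths. c p *s (m p * w')) =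
      c (t, []) *s w' + (\<Sum>p\<in>nonzero_paths - {(t, [])}. c p *s (m p * w'))"
    using sum.remove[OF finite_nonzero_paths tp, of "\<lambda>p. c p *s (m p * w')"] e_w'[OF t] by (simp add: m_def)
  then have "c (t, []) *s w' = 0 - (\<Sum>p\<in>nonzero_paths - {(t, [])}. c p *s (m p * w'))"
    using sum0 by (simp add: eq_neg_iff_add_eq_0)
  also have "\<dots> \<in> range H"
    using rest by (intro range_H_diff range_H_0 range_H_sum range_H_scale) auto
  finally have w'_in: "c (t, []) *s w' \<in> range H" .
  have "c (t, []) = 0"
  proof (rule ccontr)
    assume nz: "c (t, []) \<noteq> 0"
    then have "w' \<in> range H"
      using range_H_scale[OF w'_in, of "inverse (c (t, []))"] by simp
    moreover have "e t \<in> range H"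
      using range_H_m[OF tp] by (simp add: m_def)
    ultimately have "w' + k *s e t \<in> range H"
      by (intro range_H_add range_H_scale)
    then show False
      using w_notin[OF t] by (simp add: w'_def)
  qed
  then show ?thesis
    using M_H_maximal[OF r, of c] c by (simp add: mult.assoc t_def)
qed

text \<open>
  Modulo multiples of \<open>l \<rho>\<close>, every \<open>v\<close> satisfies \<open>\<rho> v \<rho> = 0\<close>. If \<open>\<rho> (l \<rho>) \<rho>\<close> vanished as well, then \<open>\<rho> V \<rho> = 0\<close>,
  which is impossible in a semiprime ring.
\<close>

lemma sandwich_l:
  assumes r: "maximal \<rho>"
  obtains \<kappa> where "\<kappa> \<noteq> 0" "M \<rho> * l \<rho> * M \<rho> = \<kappa> *s M \<rho>"
proof -
  obtain C c where c: "l \<rho> * M \<rho> - C *s w (tgt \<rho>) = H c"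
    using l_M[OF r] by blast
  obtain k where k: "M \<rho> * w (tgt \<rho>) = k *s M \<rho>"
    using maximal_mult_w[OF r] by blast
  have "l \<rho> * M \<rho> = C *s w (tgt \<rho>) + H c"
    using c by (simp add: algebra_simps)
  then have *: "M \<rho> * l \<rho> * M \<rho> = (C * k + c (tgt \<rho>, [])) *s M \<rho>"
    using k M_H_maximal[OF r, of c]
    by (simp add: mult.assoc distrib_left mult_scale_right scale_left_distrib)
  have "C * k + c (tgt \<rho>, []) \<noteq> 0"
  proof
    assume z: "C * k + c (tgt \<rho>, []) = 0"
    obtain v where v: "M \<rho> * v * M \<rho> \<noteq> 0"
      using semiprime[OF M_maximal_neq_0[OF r]] ..
    have "M \<rho> * v * M \<rho> = 0"
    proof -
      obtain d where "(v - d *s l \<rho>) * M \<rho> \<in> range H"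
        using mod_l[OF r] by blast
      then have "M \<rho> * (v - d *s l \<rho>) * M \<rho> = 0"
        by (rule sandwich_eq_0[OF r])
      then show ?thesis
        using * z by (simp add: algebra_simps mult_scale_right scale_mult_left)
    qed
    with v show False ..
  qed
  then show ?thesis
    using * by (rule that)
qed

lemma sandwich_scalar:
  assumes r: "maximal \<rho>"
  shows "\<exists>k. M \<rho> * v * M \<rho> = k *s M \<rho>"
proof -
  obtain \<kappa> where k: "M \<rho> * l \<rho> * M \<rho> = \<kappa> *s M \<rho>"
    using sandwich_l[OF r] by blast
  obtain d where "(v - d *s l \<rho>) * M \<rho> \<in> range H"
    using mod_l[OF r] by blast
  then have "M \<rho> * (v - d *s l \<rho>) * M \<rho> = 0"
    by (rule sandwich_eq_0[OF r])
  then have "M \<rho> * v * M \<rho> = (d * \<kappa>) *s M \<rho>"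
    using k by (simp add: algebra_simps mult_scale_right scale_mult_left)
  then show ?thesis
    by blast
qed

text \<open>
  An arrow \<open>\<alpha>\<close> other than the last arrow of \<open>\<rho>\<close> kills \<open>\<rho>\<^sup>\<dagger>\<close>, so \<open>\<alpha> (l \<rho>)\<close> is in \<open>A\<close>, and only its coordinate
  at \<open>e\<^bsub>s(\<rho>)\<^esub>\<close> survives multiplication by \<open>\<rho>\<close>. That coordinate can be nonzero only if \<open>\<alpha>\<close> is parallel
  to \<open>\<rho>\<close>.
\<close>

lemma arrow_mult_l_M:
  assumes r: "maximal \<rho>" and a: "\<alpha> \<in> arcs Q" "\<alpha> \<noteq> last \<rho>"
  shows "ar \<alpha> * l \<rho> * M \<rho> = 0"
proof -
  note v = maximal_in_verts[OF r]
  obtain c where c: "ar \<alpha> * l \<rho> = H c"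
    using ar_l[OF r a] by blast
  have s: "(src \<rho>, []) \<in> nonzero_paths"
    using v by (simp add: nonzero_paths_def)
  have "e (tail Q \<alpha>) * H c = H c"
    by (simp add: e_ar[OF a(1)] flip: c mult.assoc)
  then have "H (\<lambda>p. if fst p = tail Q \<alpha> then c p else 0) = H c"
    using a(1) by (simp add: e_H)
  from H_eqD[OF this s] have tail: "tail Q \<alpha> = src \<rho> \<or> c (src \<rho>, []) = 0"
    by (simp split: if_splits)
  have "H c = ar \<alpha> * e (head Q \<alpha>) * (e (tgt \<rho>) * l \<rho>)"
    by (simp add: ar_e[OF a(1)] e_l[OF r] c)
  also have "\<dots> = ar \<alpha> * (e (head Q \<alpha>) * e (tgt \<rho>)) * l \<rho>"
    by (simp only: mult.assoc)
  finally have "H c = 0" if "head Q \<alpha> \<noteq> tgt \<rho>"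
    using a(1) v that by (simp add: e_mult)
  note zero = H_eq_0D[OF this s]
  have "c (src \<rho>, []) = 0"
  proof (rule ccontr)
    assume nz: "c (src \<rho>, []) \<noteq> 0"
    have "head Q \<alpha> = tgt \<rho>"
      using zero nz by blast
    moreover have "tail Q \<alpha> = src \<rho>"
      using tail nz by simp
    ultimately have "\<rho> = [\<alpha>]"
      using no_parallel[OF r a(1)] by simp
    with a(2) show False
      by simp
  qed
  then show ?thesis
    using H_M_maximal[OF r, of c] c by simp
qed

lemma M_l_mult_arrow:
  assumes r: "maximal \<rho>" and a: "\<alpha> \<in> arcs Q" "\<alpha> \<noteq> hd \<rho>"
  shows "M \<rho> * l \<rho> * ar \<alpha> = 0"
proof -
  note v = maximal_in_verts[OF r]
  obtain c where c: "l \<rho> * ar \<alpha> = H c"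
    using l_ar[OF r a] by blast
  have s: "(tgt \<rho>, []) \<in> nonzero_paths"
    using v by (simp add: nonzero_paths_def)
  have "H c * e (head Q \<alpha>) = H c"
    by (simp add: ar_e[OF a(1)] mult.assoc flip: c)
  then have "H (\<lambda>p. if endpt p = head Q \<alpha> then c p else 0) = H c"
    using a(1) by (simp add: H_e)
  from H_eqD[OF this s] have head: "head Q \<alpha> = tgt \<rho> \<or> c (tgt \<rho>, []) = 0"
    by (simp add: endpt_def split: if_splits)
  have "H c = l \<rho> * e (src \<rho>) * (e (tail Q \<alpha>) * ar \<alpha>)"
    by (simp add: e_ar[OF a(1)] l_e[OF r] c)
  also have "\<dots> = l \<rho> * (e (src \<rho>) * e (tail Q \<alpha>)) * ar \<alpha>"
    by (simp only: mult.assoc)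
  finally have "H c = 0" if "tail Q \<alpha> \<noteq> src \<rho>"
    using a(1) v that by (simp add: e_mult)
  note zero = H_eq_0D[OF this s]
  have "c (tgt \<rho>, []) = 0"
  proof (rule ccontr)
    assume nz: "c (tgt \<rho>, []) \<noteq> 0"
    have "tail Q \<alpha> = src \<rho>"
      using zero nz by blast
    moreover have "head Q \<alpha> = tgt \<rho>"
      using head nz by simp
    ultimately have "\<rho> = [\<alpha>]"
      using no_parallel[OF r a(1)] by simp
    with a(2) show False
      by simp
  qed
  then show ?thesis
    using M_H_maximal[OF r, of c] c by (simp add: mult.assoc)
qed

end

section \<open>Matrix units along maximal paths\<close>

context dual_extension
begin

text \<open>
  The properties which the matrix unit \<open>\<rho>\<^bsub>l,0\<^esub>\<close> of \<open>V(A)\<close> has with respect to \<open>\<rho> = \<rho>\<^bsub>0,l\<^esub>\<close> and the arrows.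
\<close>

definition partial_inverse :: "'a list \<Rightarrow> 'w \<Rightarrow> bool" where
  "partial_inverse \<rho> g \<longleftrightarrow> e (tgt \<rho>) * g = g \<and> g * e (src \<rho>) = g \<and>
     M \<rho> * g * M \<rho> = M \<rho> \<and> g * M \<rho> * g = g \<and>
     (\<forall>\<alpha> \<in> arcs Q. \<alpha> \<noteq> last \<rho> \<longrightarrow> ar \<alpha> * g = 0) \<and> (\<forall>\<alpha> \<in> arcs Q. \<alpha> \<noteq> hd \<rho> \<longrightarrow> g * ar \<alpha> = 0)"

lemma ex_partial_inverse:
  assumes r: "maximal \<rho>"
  shows "\<exists>g. partial_inverse \<rho> g"
proof -
  obtain \<kappa> where k: "\<kappa> \<noteq> 0" "M \<rho> * l \<rho> * M \<rho> = \<kappa> *s M \<rho>"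
    using sandwich_l[OF r] .
  define g where "g = (1 / \<kappa>\<^sup>2) *s (l \<rho> * M \<rho> * l \<rho>)"
  have "e (tgt \<rho>) * g = g"
    by (simp add: g_def mult_scale_right e_l[OF r] flip: mult.assoc)
  moreover have "g * e (src \<rho>) = g"
    by (simp add: g_def scale_mult_left l_e[OF r] mult.assoc)
  moreover have "M \<rho> * g * M \<rho> = M \<rho>"
  proof -
    have "M \<rho> * (l \<rho> * M \<rho> * l \<rho>) * M \<rho> = M \<rho> * l \<rho> * M \<rho> * l \<rho> * M \<rho>"
      by (simp only: mult.assoc)
    also have "\<dots> = (\<kappa> * \<kappa>) *s M \<rho>"
      by (simp add: k(2) scale_mult_left)
    finally show ?thesis
      using k(1) by (simp add: g_def scale_mult_left mult_scale_right power2_eq_square)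
  qed
  moreover have "g * M \<rho> * g = g"
  proof -
    have "(l \<rho> * M \<rho> * l \<rho>) * M \<rho> * (l \<rho> * M \<rho> * l \<rho>) =
        l \<rho> * (M \<rho> * l \<rho> * M \<rho> * l \<rho> * M \<rho>) * l \<rho>"
      by (simp only: mult.assoc)
    also have "\<dots> = (\<kappa> * \<kappa>) *s (l \<rho> * M \<rho> * l \<rho>)"
      by (simp add: k(2) scale_mult_left mult_scale_right)
    finally show ?thesis
      using k(1) by (simp add: g_def scale_mult_left mult_scale_right power2_eq_square)
  qed
  moreover have "ar \<alpha> * g = 0" if "\<alpha> \<in> arcs Q" "\<alpha> \<noteq> last \<rho>" for \<alpha>
    using arrow_mult_l_M[OF r that] by (simp add: g_def mult_scale_right flip: mult.assoc)
  moreover have "g * ar \<alpha> = 0" if "\<alpha> \<in> arcs Q" "\<alpha> \<noteq> hd \<rho>" for \<alpha>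
    using M_l_mult_arrow[OF r that] by (simp add: g_def scale_mult_left mult.assoc)
  ultimately show ?thesis
    unfolding partial_inverse_def by blast
qed

lemma M_mult_partial_inverse_eq_0:
  assumes r: "maximal \<rho>" and s: "maximal \<sigma>" and g: "partial_inverse \<sigma> g" and ne: "\<rho> \<noteq> \<sigma>"
  shows "M \<rho> * g = 0"
proof -
  obtain xs \<alpha> where xs: "\<rho> = xs @ [\<alpha>]"
    using maximalD(1)[OF r] by (cases \<rho> rule: rev_cases) auto
  then have "\<alpha> \<in> arcs Q" "\<alpha> \<noteq> last \<sigma>"
    using maximalD(2)[OF r] maximal_eq_if_last_eq[OF r s] ne by (auto simp: thread_append)
  then have "ar \<alpha> * g = 0"
    using g by (simp add: partial_inverse_def)
  then show ?thesis
    by (simp add: xs M_append mult.assoc)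
qed

text \<open>
  A product \<open>g\<^sub>0(\<rho>) g\<^sub>0(\<sigma>)\<close> can be nonzero only when \<open>\<sigma>\<close> ends where \<open>\<rho>\<close> starts. The sum \<open>h(\<rho>)\<close> of the
  idempotents \<open>g\<^sub>0(\<sigma>) \<sigma>\<close> over such \<open>\<sigma>\<close> fixes each of these \<open>g\<^sub>0(\<sigma>)\<close> from the left, and all arrows
  kill it from the right because \<open>\<sigma>\<close> is maximal. Therefore \<open>g(\<rho>) = g\<^sub>0(\<rho>) (1 - h(\<rho>))\<close> keeps the
  required properties and annihilates the products.
\<close>

lemma ex_orthogonal_partial_inverses:
  "\<exists>g. (\<forall>\<rho>. maximal \<rho> \<longrightarrow> partial_inverse \<rho> (g \<rho>)) \<and>
    (\<forall>\<rho> \<sigma>. maximal \<rho> \<longrightarrow> maximal \<sigma> \<longrightarrow> g \<rho> * g \<sigma> = 0)"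
proof -
  define g0 where "g0 = (\<lambda>\<rho>. SOME g. partial_inverse \<rho> g)"
  have g0: "partial_inverse \<rho> (g0 \<rho>)" if "maximal \<rho>" for \<rho>
    unfolding g0_def by (rule someI_ex) (rule ex_partial_inverse[OF that])
  note g0D = g0[unfolded partial_inverse_def]
  define X where "X = (\<lambda>a. {\<sigma>. maximal \<sigma> \<and> tgt \<sigma> = a})"
  define h where "h = (\<lambda>\<rho>. \<Sum>\<sigma>\<in>X (src \<rho>). g0 \<sigma> * M \<sigma>)"
  define g where "g = (\<lambda>\<rho>. g0 \<rho> - g0 \<rho> * h \<rho>)"
  have finX: "finite (X a)" for a
    using finite_maximal by (simp add: X_def)
  have h_g0: "h \<rho> * g0 \<tau> = g0 \<tau>" if "maximal \<tau>" "tgt \<tau> = src \<rho>" for \<rho> \<tau>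
  proof -
    have "h \<rho> * g0 \<tau> = (\<Sum>\<sigma>\<in>X (src \<rho>). if \<sigma> = \<tau> then g0 \<tau> else 0)"
      unfolding h_def sum_distrib_right
    proof (rule sum.cong)
      fix \<sigma>
      assume "\<sigma> \<in> X (src \<rho>)"
      then have s: "maximal \<sigma>"
        by (simp add: X_def)
      show "g0 \<sigma> * M \<sigma> * g0 \<tau> = (if \<sigma> = \<tau> then g0 \<tau> else 0)"
        using M_mult_partial_inverse_eq_0[OF s that(1) g0[OF that(1)]] g0D[OF that(1)]
        by (simp add: mult.assoc)
    qed simp
    also have "\<dots> = g0 \<tau>"
      using that finX by (simp add: X_def)
    finally show ?thesis .
  qed
  have h_ar: "h \<rho> * ar \<alpha> = 0" if "\<alpha> \<in> arcs Q" for \<rho> \<alpha>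
    unfolding h_def sum_distrib_right
  proof (rule sum.neutral, rule ballI)
    fix \<sigma>
    assume "\<sigma> \<in> X (src \<rho>)"
    then have s: "maximal \<sigma>"
      by (simp add: X_def)
    have "M \<sigma> * M [\<alpha>] = 0"
      using maximalD[OF s] that by (intro M_mult_eq_0) auto
    then show "g0 \<sigma> * M \<sigma> * ar \<alpha> = 0"
      by (simp add: mult.assoc)
  qed
  have h_M: "h \<rho> * M \<tau> = 0" if t: "maximal \<tau>" for \<rho> \<tau>
  proof -
    obtain \<alpha> xs where "\<tau> = \<alpha> # xs" "\<alpha> \<in> arcs Q"
      using maximalD(1,2)[OF t] by (cases \<tau>) (auto simp: thread_Cons)
    then show ?thesis
      using h_ar by (simp flip: mult.assoc)
  qed
  have h_e: "h \<rho> * e (src \<rho>) = h \<rho>" for \<rho>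
    unfolding h_def sum_distrib_right
  proof (rule sum.cong)
    fix \<sigma>
    assume "\<sigma> \<in> X (src \<rho>)"
    then have s: "maximal \<sigma>" "tgt \<sigma> = src \<rho>"
      by (simp_all add: X_def)
    then have "M \<sigma> * e (src \<rho>) = M \<sigma>"
      using M_e[OF maximalD(2,1)[OF s(1)]] maximal_in_verts[OF s(1)] by simp
    then show "g0 \<sigma> * M \<sigma> * e (src \<rho>) = g0 \<sigma> * M \<sigma>"
      by (simp add: mult.assoc)
  qed simp
  have "partial_inverse \<rho> (g \<rho>)" if r: "maximal \<rho>" for \<rho>
  proof -
    note d = g0D[OF r]
    have gM: "g \<rho> * M \<rho> = g0 \<rho> * M \<rho>"
      using h_M[OF r, of \<rho>] by (simp add: g_def left_diff_distrib mult.assoc)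
    have "e (tgt \<rho>) * g \<rho> = g \<rho>"
      using d by (simp add: g_def right_diff_distrib flip: mult.assoc)
    moreover have "g \<rho> * e (src \<rho>) = g \<rho>"
      using d h_e[of \<rho>] by (simp add: g_def left_diff_distrib mult.assoc)
    moreover have "M \<rho> * g \<rho> * M \<rho> = M \<rho>"
      using d gM by (simp add: mult.assoc)
    moreover have "g \<rho> * M \<rho> * g \<rho> = g \<rho>"
    proof -
      have "g0 \<rho> * M \<rho> * (g0 \<rho> * h \<rho>) = g0 \<rho> * M \<rho> * g0 \<rho> * h \<rho>"
        by (simp only: mult.assoc)
      then show ?thesis
        using d gM by (simp add: g_def right_diff_distrib)
    qed
    moreover have "ar \<alpha> * g \<rho> = 0" if "\<alpha> \<in> arcs Q" "\<alpha> \<noteq> last \<rho>" for \<alpha>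
      using d that by (simp add: g_def right_diff_distrib flip: mult.assoc)
    moreover have "g \<rho> * ar \<alpha> = 0" if "\<alpha> \<in> arcs Q" "\<alpha> \<noteq> hd \<rho>" for \<alpha>
      using d that h_ar[OF that(1), of \<rho>] by (simp add: g_def left_diff_distrib mult.assoc)
    ultimately show ?thesis
      unfolding partial_inverse_def by blast
  qed
  moreover have "g \<rho> * g \<sigma> = 0" if r: "maximal \<rho>" and s: "maximal \<sigma>" for \<rho> \<sigma>
  proof (cases "tgt \<sigma> = src \<rho>")
    case True
    have "g \<rho> * g0 \<sigma> = 0"
      using h_g0[OF s True] by (simp add: g_def left_diff_distrib mult.assoc)
    then show ?thesis
      by (simp add: g_def[of] right_diff_distrib flip: mult.assoc)
  next
    case False
    have "g \<rho> * g \<sigma> = g \<rho> * e (src \<rho>) * (e (tgt \<sigma>) * g \<sigma>)"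
      using calculation r s by (simp add: partial_inverse_def)
    also have "\<dots> = g \<rho> * (e (src \<rho>) * e (tgt \<sigma>)) * g \<sigma>"
      by (simp only: mult.assoc)
    finally show ?thesis
      using False maximal_in_verts[OF r] maximal_in_verts[OF s] by (simp add: e_mult)
  qed
  ultimately show ?thesis
    by blast
qed

definition G :: "'a list \<Rightarrow> 'w" where
  "G = (SOME g. (\<forall>\<rho>. maximal \<rho> \<longrightarrow> partial_inverse \<rho> (g \<rho>)) \<and>
    (\<forall>\<rho> \<sigma>. maximal \<rho> \<longrightarrow> maximal \<sigma> \<longrightarrow> g \<rho> * g \<sigma> = 0))"

lemma
  assumes r: "maximal \<rho>"
  shows e_G: "e (tgt \<rho>) * G \<rho> = G \<rho>" and G_e: "G \<rho> * e (src \<rho>) = G \<rho>"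
    and M_G_M: "M \<rho> * G \<rho> * M \<rho> = M \<rho>" and G_M_G: "G \<rho> * M \<rho> * G \<rho> = G \<rho>"
    and ar_G: "\<lbrakk>\<alpha> \<in> arcs Q; \<alpha> \<noteq> last \<rho>\<rbrakk> \<Longrightarrow> ar \<alpha> * G \<rho> = 0"
    and G_ar: "\<lbrakk>\<alpha> \<in> arcs Q; \<alpha> \<noteq> hd \<rho>\<rbrakk> \<Longrightarrow> G \<rho> * ar \<alpha> = 0"
    and G_G: "maximal \<sigma> \<Longrightarrow> G \<rho> * G \<sigma> = 0"
proof -
  have *: "(\<forall>\<rho>. maximal \<rho> \<longrightarrow> partial_inverse \<rho> (G \<rho>)) \<and>
    (\<forall>\<rho> \<sigma>. maximal \<rho> \<longrightarrow> maximal \<sigma> \<longrightarrow> G \<rho> * G \<sigma> = 0)"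
    unfolding G_def by (rule someI_ex[OF ex_orthogonal_partial_inverses])
  then have "partial_inverse \<rho> (G \<rho>)"
    using r by blast
  then show "e (tgt \<rho>) * G \<rho> = G \<rho>" "G \<rho> * e (src \<rho>) = G \<rho>"
    "M \<rho> * G \<rho> * M \<rho> = M \<rho>" "G \<rho> * M \<rho> * G \<rho> = G \<rho>"
    "\<lbrakk>\<alpha> \<in> arcs Q; \<alpha> \<noteq> last \<rho>\<rbrakk> \<Longrightarrow> ar \<alpha> * G \<rho> = 0"
    "\<lbrakk>\<alpha> \<in> arcs Q; \<alpha> \<noteq> hd \<rho>\<rbrakk> \<Longrightarrow> G \<rho> * ar \<alpha> = 0"
    by (simp_all add: partial_inverse_def)
  show "maximal \<sigma> \<Longrightarrow> G \<rho> * G \<sigma> = 0"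
    using * r by blast
qed

text \<open>
  For \<open>\<rho> = \<alpha>\<^sub>1 \<dots> \<alpha>\<^sub>l\<close> this is \<open>\<alpha>\<^bsub>u+1\<^esub> \<dots> \<alpha>\<^sub>l g\<^sub>\<rho> \<alpha>\<^sub>1 \<dots> \<alpha>\<^sub>v\<close>, the candidate for the matrix unit \<open>\<rho>\<^bsub>u,v\<^esub>\<close>.
\<close>

definition E :: "'a list \<Rightarrow> nat \<Rightarrow> nat \<Rightarrow> 'w" where
  "E \<rho> u v = M (drop u \<rho>) * G \<rho> * M (take v \<rho>)"

text \<open>
  By gentleness only the arrow \<open>\<alpha>\<^sub>u\<close> of \<open>\<rho>\<close> has a nonzero product with \<open>\<alpha>\<^bsub>u+1\<^esub> \<dots> \<alpha>\<^sub>l\<close>; for \<open>u = 0\<close> there is none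
  because \<open>\<rho>\<close> is maximal, and for \<open>u = l\<close> the choice of \<open>g\<^sub>\<rho>\<close> takes over.
\<close>

lemma ar_E:
  assumes r: "maximal \<rho>" and a: "\<alpha> \<in> arcs Q" and u: "u \<le> length \<rho>"
  shows "ar \<alpha> * E \<rho> u v = (if 0 < u \<and> \<rho> ! (u - 1) = \<alpha> then E \<rho> (u - 1) v else 0)"
proof (cases "0 < u \<and> \<rho> ! (u - 1) = \<alpha>")
  case True
  then obtain i where "u = Suc i"
    by (cases u) auto
  then have "drop (u - 1) \<rho> = \<alpha> # drop u \<rho>"
    using u True Cons_nth_drop_Suc[of i \<rho>] by simp
  then show ?thesis
    using True by (simp add: E_def mult.assoc)
next
  case False
  note d = maximalD[OF r]
  have "ar \<alpha> * (M (drop u \<rho>) * G \<rho>) = 0"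
  proof (cases "u = length \<rho>")
    case True
    then have "\<alpha> \<noteq> last \<rho>"
      using False d(1) by (auto simp: last_conv_nth)
    then show ?thesis
      using True ar_G[OF r a] by simp
  next
    case ne: False
    then have u': "u < length \<rho>"
      using u by simp
    have "\<not> flow \<alpha> (\<rho> ! u)"
    proof
      assume f: "flow \<alpha> (\<rho> ! u)"
      show False
      proof (cases u)
        case 0
        then show False
          using f d(1,3) by (simp add: hd_conv_nth)
      next
        case (Suc i)
        then have "flow (\<rho> ! i) (\<rho> ! u)"
          using thread_nth_flow[OF d(2), of i] u' by simp
        then show False
          using flow_left_unique f False Suc by auto
      qed
    qed
    then have "\<not> thread (\<alpha> # drop u \<rho>)"
      using u' by (simp add: thread_Cons hd_drop_conv_nth)
    moreover have "set (\<alpha> # drop u \<rho>) \<subseteq> arcs Q"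
      using a d(2) by (auto simp: thread_def dest: in_set_dropD)
    ultimately have "M (\<alpha> # drop u \<rho>) = 0"
      by (intro M_eq_0)
    then show ?thesis
      by (simp flip: mult.assoc)
  qed
  then have "ar \<alpha> * E \<rho> u v = 0"
    by (simp add: E_def flip: mult.assoc)
  then show ?thesis
    using False by auto
qed

lemma e_E:
  assumes r: "maximal \<rho>" and a: "a \<in> verts Q" and u: "u \<le> length \<rho>"
  shows "e a * E \<rho> u v = (if vert \<rho> u = a then E \<rho> u v else 0)"
proof -
  note d = maximalD[OF r]
  have "e a * (M (drop u \<rho>) * G \<rho>) = (if vert \<rho> u = a then M (drop u \<rho>) * G \<rho> else 0)"
  proof (cases "u = length \<rho>")
    case True
    have "e a * G \<rho> = e a * e (tgt \<rho>) * G \<rho>"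
      unfolding mult.assoc e_G[OF r] ..
    also have "\<dots> = (if tgt \<rho> = a then G \<rho> else 0)"
      using a maximal_in_verts[OF r] e_G[OF r] by (auto simp: e_mult)
    finally show ?thesis
      using True d(1) by (simp add: vert_length)
  next
    case False
    then have "thread (drop u \<rho>)" "drop u \<rho> \<noteq> []" "src (drop u \<rho>) = vert \<rho> u"
      using u d(2) by (simp_all add: thread_drop src_def vert_tail hd_drop_conv_nth)
    then show ?thesis
      using e_M[of "drop u \<rho>" a] a by (simp flip: mult.assoc)
  qed
  then show ?thesis
    by (simp add: E_def flip: mult.assoc)
qed

lemma E_e:
  assumes r: "maximal \<rho>" and a: "a \<in> verts Q" and v: "v \<le> length \<rho>"
  shows "E \<rho> u v * e a = (if vert \<rho> v = a then E \<rho> u v else 0)"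
proof -
  note d = maximalD[OF r]
  have "G \<rho> * M (take v \<rho>) * e a = (if vert \<rho> v = a then G \<rho> * M (take v \<rho>) else 0)"
  proof (cases "v = 0")
    case True
    have "G \<rho> * e a = G \<rho> * (e (src \<rho>) * e a)"
      unfolding mult.assoc[symmetric] G_e[OF r] ..
    also have "\<dots> = (if src \<rho> = a then G \<rho> else 0)"
      using a maximal_in_verts[OF r] G_e[OF r] by (auto simp: e_mult)
    finally show ?thesis
      using True by simp
  next
    case False
    then have "thread (take v \<rho>)" "take v \<rho> \<noteq> []" "tgt (take v \<rho>) = vert \<rho> v"
      using v d(1,2) by (simp_all add: thread_take tgt_def vert_def last_conv_nth)
    then show ?thesis
      using M_e[of "take v \<rho>" a] a by (simp add: mult.assoc)
  qed
  then show ?thesis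
    by (simp add: E_def mult.assoc)
qed

lemma M_E:
  assumes r: "maximal \<rho>" and u: "u \<le> length \<rho>" and xs: "set xs \<subseteq> arcs Q"
  shows "M xs * E \<rho> u v = (if length xs \<le> u \<and> xs = drop (u - length xs) (take u \<rho>)
    then E \<rho> (u - length xs) v else 0)"
  using xs
proof (induction xs)
  case Nil
  then show ?case
    using u by simp
next
  case (Cons \<alpha> xs)
  show ?case
  proof (cases "length xs \<le> u \<and> xs = drop (u - length xs) (take u \<rho>)")
    case True
    define i where "i = u - length xs"
    have i: "i \<le> length \<rho>" "u = i + length xs"
      using True u by (simp_all add: i_def)
    have "M (\<alpha> # xs) * E \<rho> u v = ar \<alpha> * E \<rho> i v"
      using Cons True by (simp add: mult.assoc i_def)
    also have "\<dots> = (if 0 < i \<and> \<rho> ! (i - 1) = \<alpha> then E \<rho> (i - 1) v else 0)"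
      using Cons.prems i by (intro ar_E[OF r]) auto
    also have "(0 < i \<and> \<rho> ! (i - 1) = \<alpha>) \<longleftrightarrow>
        length (\<alpha> # xs) \<le> u \<and> \<alpha> # xs = drop (u - length (\<alpha> # xs)) (take u \<rho>)"
    proof (cases i)
      case 0
      then show ?thesis
        using i by simp
    next
      case (Suc j)
      have A: "drop j (take u \<rho>) = \<rho> ! j # drop (Suc j) (take u \<rho>)"
        using Suc i u by (subst Cons_nth_drop_Suc[symmetric]) auto
      have len: "u - length (\<alpha> # xs) = j" "u - length xs = Suc j" and le: "length (\<alpha> # xs) \<le> u"
        using i(2) Suc by simp_all
      have B: "drop (Suc j) (take u \<rho>) = xs"
        using conjunct2[OF True] unfolding len by (rule sym)
      show ?thesis
        unfolding len A B using le Suc by auto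
    qed
    also have "i - 1 = u - length (\<alpha> # xs)"
      using i by simp
    finally show ?thesis .
  next
    case False
    have "\<not> (length (\<alpha> # xs) \<le> u \<and> \<alpha> # xs = drop (u - length (\<alpha> # xs)) (take u \<rho>))"
    proof
      assume h: "length (\<alpha> # xs) \<le> u \<and> \<alpha> # xs = drop (u - length (\<alpha> # xs)) (take u \<rho>)"
      then have "xs = tl (drop (u - length (\<alpha> # xs)) (take u \<rho>))"
        by (metis list.sel(3))
      then have d: "xs = drop (Suc (u - length (\<alpha> # xs))) (take u \<rho>)"
        by (simp only: drop_Suc tl_drop)
      have le: "Suc (length xs) \<le> u"
        using conjunct1[OF h] by simp
      then have "Suc (u - length (\<alpha> # xs)) = u - length xs"
        by simp
      from d[unfolded this] show False
        using False le by (auto dest: Suc_leD)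
    qed
    moreover have "M (\<alpha> # xs) * E \<rho> u v = 0"
    proof -
      have "M (\<alpha> # xs) * E \<rho> u v = ar \<alpha> * (M xs * E \<rho> u v)"
        by (simp add: mult.assoc)
      then show ?thesis
        using Cons False by simp
    qed
    ultimately show ?thesis
      by (simp only: if_False)
  qed
qed

text \<open>
  The factor \<open>\<alpha>\<^sub>1 \<dots> \<alpha>\<^sub>v\<close> shifts the first index of \<open>E \<sigma> i j\<close> down to \<open>i - v\<close>, or gives zero. A nonzero result
  forces \<open>\<rho>\<close> and \<open>\<sigma>\<close> to share the arrow \<open>\<alpha>\<^sub>1\<close>, hence \<open>\<rho> = \<sigma>\<close> and \<open>v = i\<close>, and then \<open>g\<^sub>\<rho> \<rho> g\<^sub>\<rho> = g\<^sub>\<rho>\<close> applies.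
  For \<open>v = 0\<close> the same follows from \<open>g\<^sub>\<rho> \<beta> = 0\<close> for \<open>\<beta> \<noteq> \<alpha>\<^sub>1\<close>, and the case \<open>i = l(\<sigma>)\<close> is the orthogonality
  of the partial inverses.
\<close>

lemma E_E:
  assumes r: "maximal \<rho>" and s: "maximal \<sigma>"
    and v: "v \<le> length \<rho>" and i: "i \<le> length \<sigma>"
  shows "E \<rho> u v * E \<sigma> i j = (if \<rho> = \<sigma> \<and> v = i then E \<rho> u j else 0)"
proof -
  note d = maximalD[OF r] and d' = maximalD[OF s]
  have sigma_0: "G \<rho> * E \<sigma> 0 j = (if \<rho> = \<sigma> then G \<rho> * M (take j \<rho>) else 0)"
  proof (cases "\<rho> = \<sigma>")
    case True
    have "G \<rho> * E \<rho> 0 j = G \<rho> * M \<rho> * G \<rho> * M (take j \<rho>)"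
      by (simp add: E_def mult.assoc)
    then show ?thesis
      using True G_M_G[OF r] by simp
  next
    case False
    obtain \<beta> ys where ys: "\<sigma> = \<beta> # ys" "\<beta> \<in> arcs Q"
      using d'(1,2) by (cases \<sigma>) (auto simp: thread_Cons)
    have "\<beta> \<noteq> hd \<rho>"
      using maximal_eq_if_hd_eq[OF r s] False ys(1) by auto
    then have "G \<rho> * ar \<beta> = 0"
      using G_ar[OF r ys(2)] by simp
    then have "G \<rho> * M \<sigma> = 0"
      by (simp add: ys(1) flip: mult.assoc)
    then show ?thesis
      using False by (simp add: E_def flip: mult.assoc)
  qed
  have "G \<rho> * (M (take v \<rho>) * E \<sigma> i j) = (if \<rho> = \<sigma> \<and> v = i then G \<rho> * M (take j \<rho>) else 0)"
  proof (cases "v = 0")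
    case True
    show ?thesis
    proof (cases "i = 0")
      case i0: True
      show ?thesis
        using sigma_0 by (simp add: \<open>v = 0\<close> i0)
    next
      case i0: False
      have "G \<rho> * M (drop i \<sigma>) * G \<sigma> = 0"
      proof (cases "i = length \<sigma>")
        case True
        then show ?thesis
          using G_G[OF r s] by simp
      next
        case False
        then have i': "i < length \<sigma>"
          using i by simp
        have "\<sigma> ! i \<noteq> \<rho> ! 0"
          using maximal_nth_eq[OF s i' r, of 0] i0 d(1) by auto
        then have "\<sigma> ! i \<noteq> hd \<rho>"
          using d(1) by (simp add: hd_conv_nth)
        then have "G \<rho> * ar (\<sigma> ! i) = 0"
          using G_ar[OF r] thread_nth_arc[OF d'(2) i'] by simp
        moreover have "drop i \<sigma> = \<sigma> ! i # drop (Suc i) \<sigma>"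
          using i' by (simp add: Cons_nth_drop_Suc)
        ultimately show ?thesis
          by (simp flip: mult.assoc)
      qed
      then have "G \<rho> * E \<sigma> i j = 0"
        by (simp add: E_def flip: mult.assoc)
      then show ?thesis
        using True i0 by simp
    qed
  next
    case False
    have len: "length (take v \<rho>) = v"
      using v by simp
    have "set (take v \<rho>) \<subseteq> arcs Q"
      using d(2) by (auto simp: thread_def dest: in_set_takeD)
    note ME = M_E[OF s i this, of j, unfolded len]
    show ?thesis
    proof (cases "v \<le> i \<and> take v \<rho> = drop (i - v) (take i \<sigma>)")
      case True
      have "\<rho> ! 0 = take v \<rho> ! 0"
        using False by simp
      also have "\<dots> = drop (i - v) (take i \<sigma>) ! 0"
        by (simp only: conjunct2[OF True])
      also have "\<dots> = \<sigma> ! (i - v)"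
        using conjunct1[OF True] False i by simp
      finally have "\<rho> ! 0 = \<sigma> ! (i - v)" .
      then have eq: "\<rho> = \<sigma> \<and> 0 = i - v"
        using True False i d(1) by (intro maximal_nth_eq[OF r _ s]) auto
      then have "v = i"
        using True by simp
      have "M (take v \<rho>) * E \<sigma> i j = E \<sigma> 0 j"
        using trans[OF ME if_P[OF True]] eq by simp
      then show ?thesis
        using sigma_0 eq \<open>v = i\<close> by simp
    next
      case nc: False
      have "M (take v \<rho>) * E \<sigma> i j = 0"
        using trans[OF ME if_not_P[OF nc]] .
      moreover have "\<not> (\<rho> = \<sigma> \<and> v = i)"
        using nc i by auto
      ultimately show ?thesis
        by auto
    qed
  qed
  moreover have "E \<rho> u v * E \<sigma> i j = M (drop u \<rho>) * (G \<rho> * (M (take v \<rho>) * E \<sigma> i j))"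
    by (simp add: E_def[of \<rho> u] mult.assoc)
  ultimately have "E \<rho> u v * E \<sigma> i j =
      M (drop u \<rho>) * (if \<rho> = \<sigma> \<and> v = i then G \<rho> * M (take j \<rho>) else 0)"
    by (simp only:)
  also have "\<dots> = (if \<rho> = \<sigma> \<and> v = i then E \<rho> u j else 0)"
    by (simp add: E_def mult.assoc)
  finally show ?thesis .
qed

lemma E_neq_0:
  assumes r: "maximal \<rho>" and u: "u \<le> length \<rho>" and v: "v \<le> length \<rho>"
  shows "E \<rho> u v \<noteq> 0"
proof
  assume "E \<rho> u v = 0"
  then have "E \<rho> 0 u * E \<rho> u v * E \<rho> v 0 = 0"
    by simp
  then have "E \<rho> 0 0 = 0"
    using u v by (simp add: E_E[OF r r])
  then have "M \<rho> * G \<rho> = 0"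
    by (simp add: E_def)
  then have "M \<rho> = 0"
    using M_G_M[OF r] by simp
  then show False
    using M_maximal_neq_0[OF r] by simp
qed

text \<open>
  Since \<open>g\<^sub>\<rho> = g\<^sub>\<rho> \<rho> g\<^sub>\<rho>\<close>, this reduces to \<open>\<rho> V \<rho> = K \<rho>\<close>.
\<close>

lemma E_sandwich:
  assumes r: "maximal \<rho>"
  shows "\<exists>k. E \<rho> u v * x * E \<rho> i j = k *s E \<rho> u j"
proof -
  obtain k where k: "M \<rho> * (G \<rho> * M (take v \<rho>) * x * M (drop i \<rho>) * G \<rho>) * M \<rho> = k *s M \<rho>"
    using sandwich_scalar[OF r] by blast
  have "E \<rho> u v * x * E \<rho> i j =
      M (drop u \<rho>) * (G \<rho> * M \<rho> * G \<rho>) * M (take v \<rho>) * x * M (drop i \<rho>) * (G \<rho> * M \<rho> * G \<rho>) * M (take j \<rho>)"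
    unfolding E_def G_M_G[OF r] by (simp add: mult.assoc)
  also have "\<dots> = M (drop u \<rho>) * G \<rho> *
      (M \<rho> * (G \<rho> * M (take v \<rho>) * x * M (drop i \<rho>) * G \<rho>) * M \<rho>) * G \<rho> * M (take j \<rho>)"
    by (simp only: mult.assoc)
  also have "\<dots> = k *s (M (drop u \<rho>) * (G \<rho> * M \<rho> * G \<rho>) * M (take j \<rho>))"
    unfolding k by (simp add: scale_mult_left mult_scale_right mult.assoc)
  also have "\<dots> = k *s E \<rho> u j"
    unfolding E_def G_M_G[OF r] by (simp add: mult.assoc)
  finally show ?thesis
    by blast
qed

text \<open>
  What the diagonal matrix units leave of \<open>e\<^sub>a\<close>. In \<open>V(A)\<close> it is \<open>\<e>\<^sub>a\<close> if \<open>a \<in> \<T>\<^sub>A\<close> and zero otherwise.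
\<close>

definition eps :: "'v \<Rightarrow> 'w" where
  "eps a = e a - (\<Sum>(\<rho>, u)\<in>positions a. E \<rho> u u)"

lemma eps_E:
  assumes a: "a \<in> verts Q" and r: "maximal \<rho>" and u: "u \<le> length \<rho>"
  shows "eps a * E \<rho> u v = 0"
proof -
  have "(\<Sum>(\<sigma>, i)\<in>positions a. E \<sigma> i i) * E \<rho> u v =
      (\<Sum>p\<in>positions a. if p = (\<rho>, u) then E \<rho> u v else 0)"
    unfolding sum_distrib_right
    by (rule sum.cong) (auto simp: positions_def E_E r u split: if_splits)
  also have "\<dots> = (if vert \<rho> u = a then E \<rho> u v else 0)"
    using finite_positions r u by (simp add: positions_def)
  finally show ?thesis
    by (simp add: eps_def left_diff_distrib e_E[OF r a u])
qed

lemma E_eps: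
  assumes a: "a \<in> verts Q" and r: "maximal \<rho>" and v: "v \<le> length \<rho>"
  shows "E \<rho> u v * eps a = 0"
proof -
  have "E \<rho> u v * (\<Sum>(\<sigma>, i)\<in>positions a. E \<sigma> i i) =
      (\<Sum>p\<in>positions a. if p = (\<rho>, v) then E \<rho> u v else 0)"
    unfolding sum_distrib_left
    by (rule sum.cong) (auto simp: positions_def E_E r v split: if_splits)
  also have "\<dots> = (if vert \<rho> v = a then E \<rho> u v else 0)"
    using finite_positions r v by (simp add: positions_def)
  finally show ?thesis
    by (simp add: eps_def right_diff_distrib E_e[OF r a v])
qed

lemma e_eps:
  assumes a: "a \<in> verts Q" and b: "b \<in> verts Q"
  shows "e b * eps a = (if a = b then eps a else 0)"
proof -
  have "e b * (\<Sum>(\<rho>, u)\<in>positions a. E \<rho> u u) =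
      (\<Sum>(\<rho>, u)\<in>positions a. if a = b then E \<rho> u u else 0)"
    unfolding sum_distrib_left
    by (rule sum.cong) (auto simp: positions_def e_E b)
  then show ?thesis
    using a b by (simp add: eps_def right_diff_distrib e_mult)
qed

lemma eps_eps:
  assumes a: "a \<in> verts Q" and b: "b \<in> verts Q"
  shows "eps a * eps b = (if a = b then eps a else 0)"
proof -
  have "(\<Sum>(\<rho>, u)\<in>positions a. E \<rho> u u) * eps b = 0"
    unfolding sum_distrib_right
    by (rule sum.neutral) (auto simp: positions_def E_eps b)
  then have "eps a * eps b = e a * eps b"
    by (simp add: eps_def[of a] left_diff_distrib)
  then show ?thesis
    using e_eps[OF b a] by auto
qed

text \<open>
  Otherwise \<open>e\<^sub>a\<close> is the single idempotent \<open>E \<rho> u u\<close>, so \<open>e\<^sub>a V e\<^sub>a = K e\<^sub>a\<close>. But \<open>e\<^sub>a V e\<^sub>a\<close> contains \<open>w a\<close>,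
  which is not in \<open>A\<close>.
\<close>

lemma eps_neq_0:
  assumes a: "solitary a"
  shows "eps a \<noteq> 0"
proof
  assume z: "eps a = 0"
  have v: "a \<in> verts Q"
    using a by (simp add: solitary_def)
  have "card (positions a) \<noteq> 0"
    using card_positions[OF v] a by simp
  then obtain \<rho> u where p: "(\<rho>, u) \<in> positions a"
    by (metis all_not_in_conv card.empty surj_pair)
  have "positions a = {(\<rho>, u)}"
    using p by (auto dest: solitary_position_unique[OF a p])
  then have ea: "e a = E \<rho> u u"
    using z by (simp add: eps_def)
  have "maximal \<rho>"
    using p by (simp add: positions_def)
  then obtain k where "E \<rho> u u * w a * E \<rho> u u = k *s E \<rho> u u"
    using E_sandwich by blast
  moreover have "e a * w a * e a = w a"
    using e_w[OF v] w_e[OF v] by simp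
  ultimately have "w a = k *s e a"
    by (simp add: ea)
  moreover have "e a \<in> range H"
    using range_H_m[of "(a, [])"] v by (simp add: m_def nonzero_paths_def)
  ultimately show False
    using w_notin[OF v] range_H_scale by simp
qed

end

section \<open>The matrix units form a basis\<close>

lemma (in vector_space) independent_family:
  assumes fin: "finite I"
    and zero: "\<And>c i. \<lbrakk>(\<Sum>i\<in>I. scale (c i) (f i)) = 0; i \<in> I\<rbrakk> \<Longrightarrow> c i = 0"
  shows "inj_on f I \<and> independent (f ` I)"
proof
  show inj: "inj_on f I"
  proof (rule inj_onI, rule ccontr)
    fix i j
    assume ij: "i \<in> I" "j \<in> I" "f i = f j" "i \<noteq> j"
    define c where "c = (\<lambda>k. if k = i then 1 else if k = j then - 1 else 0 :: 'a)"
    have "(\<Sum>k\<in>I. scale (c k) (f k)) = (\<Sum>k\<in>{i, j}. scale (c k) (f k))"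
      using fin ij by (intro sum.mono_neutral_right) (auto simp: c_def)
    also have "\<dots> = 0"
      using ij by (simp add: c_def)
    finally have "c i = 0"
      using zero ij by blast
    then show False
      by (simp add: c_def)
  qed
  show "independent (f ` I)"
  proof (rule independent_if_scalars_zero)
    fix g x
    assume "(\<Sum>x\<in>f ` I. scale (g x) x) = 0" "x \<in> f ` I"
    then show "g x = 0"
      using zero[of "\<lambda>i. g (f i)"] by (auto simp: sum.reindex[OF inj])
  qed (use fin in simp)
qed

lemma (in vector_space) spanning_family:
  assumes fin: "finite I"
    and zero: "\<And>c i. \<lbrakk>(\<Sum>i\<in>I. scale (c i) (f i)) = 0; i \<in> I\<rbrakk> \<Longrightarrow> c i = 0"
    and S: "finite S" "card S \<le> card I" "span S = UNIV"
  shows "\<exists>c. v = (\<Sum>i\<in>I. scale (c i) (f i))"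
proof -
  have inj: "inj_on f I" and ind: "independent (f ` I)"
    using independent_family[of I f] fin zero by blast+
  have "v \<in> span (f ` I)"
  proof (rule ccontr)
    assume v: "v \<notin> span (f ` I)"
    then have "independent (insert v (f ` I))"
      using ind by (rule independent_insertI)
    then have "card (insert v (f ` I)) \<le> card S"
      using independent_span_bound[OF S(1)] S(3) by blast
    moreover have "v \<notin> f ` I"
      using v span_base by blast
    ultimately show False
      using fin S(2) card_image[OF inj] by simp
  qed
  then obtain u where "v = (\<Sum>x\<in>f ` I. scale (u x) x)"
    using fin by (auto simp: span_finite)
  then show ?thesis
    by (auto simp: sum.reindex[OF inj])
qed

context dual_extension
begin

text \<open>
  The map \<open>V(A) \<rightarrow> V\<close> which sends the matrix units to the elements \<open>E \<rho> i j\<close> and the identities of the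
  one-dimensional factors to the idempotents \<open>eps a\<close>.
\<close>

definition Psi :: "('a list \<Rightarrow> nat \<Rightarrow> nat \<Rightarrow> 'k) \<Rightarrow> ('v \<Rightarrow> 'k) \<Rightarrow> 'w" where
  "Psi X Y = (\<Sum>\<rho> | maximal \<rho>. \<Sum>i\<le>length \<rho>. \<Sum>j\<le>length \<rho>. X \<rho> i j *s E \<rho> i j) +
     (\<Sum>a | solitary a. Y a *s eps a)"

lemma solitary_in: "solitary a \<Longrightarrow> a \<in> verts Q"
  by (simp add: solitary_def)

lemma Psi_cong:
  assumes "\<And>\<rho> i j. \<lbrakk>maximal \<rho>; i \<le> length \<rho>; j \<le> length \<rho>\<rbrakk> \<Longrightarrow> X \<rho> i j = X' \<rho> i j"
    and "\<And>a. solitary a \<Longrightarrow> Y a = Y' a"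
  shows "Psi X Y = Psi X' Y'"
  unfolding Psi_def using assms by simp

lemma Psi_add: "Psi X Y + Psi X' Y' = Psi (\<lambda>\<rho> i j. X \<rho> i j + X' \<rho> i j) (\<lambda>a. Y a + Y' a)"
  by (simp add: Psi_def sum.distrib scale_left_distrib)

lemma Psi_diff: "Psi X Y - Psi X' Y' = Psi (\<lambda>\<rho> i j. X \<rho> i j - X' \<rho> i j) (\<lambda>a. Y a - Y' a)"
  by (simp add: Psi_def sum_subtractf scale_left_diff_distrib)

lemma Psi_scale: "k *s Psi X Y = Psi (\<lambda>\<rho> i j. k * X \<rho> i j) (\<lambda>a. k * Y a)"
  by (simp add: Psi_def scale_right_distrib scale_sum_right)

lemma Psi_mult_E:
  assumes s: "maximal \<sigma>" and u: "u \<le> length \<sigma>"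
  shows "Psi X Y * E \<sigma> u v = (\<Sum>i\<le>length \<sigma>. X \<sigma> i u *s E \<sigma> i v)"
proof -
  have row: "(\<Sum>i\<le>length \<rho>. \<Sum>j\<le>length \<rho>. X \<rho> i j *s E \<rho> i j) * E \<sigma> u v =
      (if \<rho> = \<sigma> then (\<Sum>i\<le>length \<sigma>. X \<sigma> i u *s E \<sigma> i v) else 0)" if r: "maximal \<rho>" for \<rho>
  proof -
    have "(\<Sum>i\<le>length \<rho>. \<Sum>j\<le>length \<rho>. X \<rho> i j *s E \<rho> i j) * E \<sigma> u v =
        (\<Sum>i\<le>length \<rho>. \<Sum>j\<le>length \<rho>. if j = u \<and> \<rho> = \<sigma> then X \<rho> i u *s E \<rho> i v else 0)"
      unfolding sum_distrib_right by (intro sum.cong) (auto simp: scale_mult_left E_E r s u)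
    also have "\<dots> = (if \<rho> = \<sigma> then (\<Sum>i\<le>length \<sigma>. X \<sigma> i u *s E \<sigma> i v) else 0)"
      using u by (simp add: sum.delta)
    finally show ?thesis .
  qed
  have "(\<Sum>a | solitary a. Y a *s eps a) * E \<sigma> u v = 0"
    unfolding sum_distrib_right
    by (rule sum.neutral) (simp add: scale_mult_left eps_E solitary_in s u)
  moreover have "(\<Sum>\<rho> | maximal \<rho>. \<Sum>i\<le>length \<rho>. \<Sum>j\<le>length \<rho>. X \<rho> i j *s E \<rho> i j) * E \<sigma> u v =
      (\<Sum>\<rho> | maximal \<rho>. if \<rho> = \<sigma> then (\<Sum>i\<le>length \<sigma>. X \<sigma> i u *s E \<sigma> i v) else 0)"
    unfolding sum_distrib_right[of _ _ "E \<sigma> u v"]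
    by (rule sum.cong) (simp_all add: row flip: sum_distrib_right)
  ultimately show ?thesis
    using s finite_maximal by (simp add: Psi_def distrib_right)
qed

lemma Psi_mult_eps:
  assumes b: "b \<in> verts Q"
  shows "Psi X Y * eps b = (if solitary b then Y b *s eps b else 0)"
proof -
  have "(\<Sum>\<rho> | maximal \<rho>. \<Sum>i\<le>length \<rho>. \<Sum>j\<le>length \<rho>. X \<rho> i j *s E \<rho> i j) * eps b = 0"
    unfolding sum_distrib_right
    by (intro sum.neutral ballI) (simp add: scale_mult_left E_eps b)
  moreover have "(\<Sum>a | solitary a. Y a *s eps a) * eps b =
      (\<Sum>a | solitary a. if a = b then Y b *s eps b else 0)"
    unfolding sum_distrib_right
    by (rule sum.cong) (auto simp: scale_mult_left eps_eps b solitary_in)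
  ultimately show ?thesis
    using finite_solitary by (simp add: Psi_def distrib_right)
qed

lemma Psi_eq_0:
  assumes z: "Psi X Y = 0"
  shows "\<lbrakk>maximal \<rho>; i \<le> length \<rho>; j \<le> length \<rho>\<rbrakk> \<Longrightarrow> X \<rho> i j = 0" and "solitary a \<Longrightarrow> Y a = 0"
proof -
  assume r: "maximal \<rho>" and i: "i \<le> length \<rho>" and j: "j \<le> length \<rho>"
  have "0 = E \<rho> i i * (Psi X Y * E \<rho> j j)"
    by (simp add: z)
  also have "\<dots> = (\<Sum>k\<le>length \<rho>. if k = i then X \<rho> i j *s E \<rho> i j else 0)"
    unfolding Psi_mult_E[OF r j] sum_distrib_left
    by (rule sum.cong) (auto simp: mult_scale_right E_E r i)
  also have "\<dots> = X \<rho> i j *s E \<rho> i j"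
    using i by simp
  finally show "X \<rho> i j = 0"
    using E_neq_0[OF r i j] by simp
next
  assume a: "solitary a"
  then have "Y a *s eps a = 0"
    using Psi_mult_eps[OF solitary_in[OF a], of X Y] z by simp
  then show "Y a = 0"
    using eps_neq_0[OF a] by simp
qed

lemma Psi_mult:
  "Psi X Y * Psi X' Y' =
    Psi (\<lambda>\<rho> i j. \<Sum>k\<le>length \<rho>. X \<rho> i k * X' \<rho> k j) (\<lambda>a. Y a * Y' a)"
proof -
  have "Psi X Y * (\<Sum>\<rho> | maximal \<rho>. \<Sum>i\<le>length \<rho>. \<Sum>j\<le>length \<rho>. X' \<rho> i j *s E \<rho> i j) =
      (\<Sum>\<rho> | maximal \<rho>. \<Sum>i\<le>length \<rho>. \<Sum>j\<le>length \<rho>. (\<Sum>k\<le>length \<rho>. X \<rho> i k * X' \<rho> k j) *s E \<rho> i j)"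
    unfolding sum_distrib_left[of "Psi X Y"]
  proof (rule sum.cong[OF refl])
    fix \<rho>
    assume "\<rho> \<in> {\<rho>. maximal \<rho>}"
    then have r: "maximal \<rho>"
      by simp
    have "(\<Sum>k\<le>length \<rho>. \<Sum>j\<le>length \<rho>. Psi X Y * (X' \<rho> k j *s E \<rho> k j)) =
        (\<Sum>k\<le>length \<rho>. \<Sum>j\<le>length \<rho>. \<Sum>i\<le>length \<rho>. (X \<rho> i k * X' \<rho> k j) *s E \<rho> i j)"
      by (intro sum.cong refl)
        (simp add: mult_scale_right Psi_mult_E[OF r] scale_sum_right mult.commute)
    also have "\<dots> = (\<Sum>j\<le>length \<rho>. \<Sum>k\<le>length \<rho>. \<Sum>i\<le>length \<rho>. (X \<rho> i k * X' \<rho> k j) *s E \<rho> i j)"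
      by (rule sum.swap)
    also have "\<dots> = (\<Sum>j\<le>length \<rho>. \<Sum>i\<le>length \<rho>. \<Sum>k\<le>length \<rho>. (X \<rho> i k * X' \<rho> k j) *s E \<rho> i j)"
      by (rule sum.cong[OF refl]) (rule sum.swap)
    also have "\<dots> = (\<Sum>i\<le>length \<rho>. \<Sum>j\<le>length \<rho>. \<Sum>k\<le>length \<rho>. (X \<rho> i k * X' \<rho> k j) *s E \<rho> i j)"
      by (rule sum.swap)
    also have "\<dots> = (\<Sum>i\<le>length \<rho>. \<Sum>j\<le>length \<rho>. (\<Sum>k\<le>length \<rho>. X \<rho> i k * X' \<rho> k j) *s E \<rho> i j)"
      by (simp only: scale_sum_left)
    finally show "(\<Sum>k\<le>length \<rho>. \<Sum>j\<le>length \<rho>. Psi X Y * (X' \<rho> k j *s E \<rho> k j)) =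
        (\<Sum>i\<le>length \<rho>. \<Sum>j\<le>length \<rho>. (\<Sum>k\<le>length \<rho>. X \<rho> i k * X' \<rho> k j) *s E \<rho> i j)" .
  qed
  moreover have "Psi X Y * (\<Sum>a | solitary a. Y' a *s eps a) = (\<Sum>a | solitary a. (Y a * Y' a) *s eps a)"
    unfolding sum_distrib_left
    by (rule sum.cong) (auto simp: mult_scale_right Psi_mult_eps solitary_in mult.commute)
  ultimately show ?thesis
    unfolding Psi_def[of X' Y'] distrib_left by (simp add: Psi_def)
qed

lemma Psi_cells:
  "Psi X Y = (\<Sum>t\<in>cells <+> {a. solitary a}.
    case_sum (\<lambda>(\<rho>, i, j). X \<rho> i j) Y t *s case_sum (\<lambda>(\<rho>, i, j). E \<rho> i j) eps t)"
proof -
  have "(\<Sum>\<rho> | maximal \<rho>. \<Sum>i\<le>length \<rho>. \<Sum>j\<le>length \<rho>. X \<rho> i j *s E \<rho> i j) =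
      (\<Sum>(\<rho>, i, j)\<in>cells. X \<rho> i j *s E \<rho> i j)"
    unfolding cells_def sum.cartesian_product
    by (subst sum.Sigma) (auto simp: finite_maximal intro!: sum.cong)
  then show ?thesis
    by (simp add: Psi_def sum.Plus finite_cells finite_solitary comp_def case_prod_beta)
qed

text \<open>
  The images of the basis of \<open>V(A)\<close> are independent, and there are at least \<open>2 dim A \<ge> dim V\<close> of them.
\<close>

lemma Psi_surj: "\<exists>X Y. v = Psi X Y"
proof -
  define f where "f = case_sum (\<lambda>(\<rho>, i, j). E \<rho> i j) eps"
  define I where "I = cells <+> {a. solitary a}"
  have sum_eq: "(\<Sum>t\<in>I. c t *s f t) = Psi (\<lambda>\<rho> i j. c (Inl (\<rho>, i, j))) (\<lambda>a. c (Inr a))" for c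
    unfolding Psi_cells I_def f_def by (rule sum.cong) (auto split: sum.splits)
  obtain S where S: "finite S" "card S \<le> 2 * card nonzero_paths" "span S = UNIV"
    using spanned by blast
  have fin: "finite I"
    by (simp add: I_def finite_cells finite_solitary)
  have "\<exists>c. v = (\<Sum>t\<in>I. c t *s f t)"
  proof (rule spanning_family[OF fin _ S(1) _ S(3)])
    fix c t
    assume "(\<Sum>t\<in>I. c t *s f t) = 0" and t: "t \<in> I"
    then have z: "Psi (\<lambda>\<rho> i j. c (Inl (\<rho>, i, j))) (\<lambda>a. c (Inr a)) = 0"
      by (simp add: sum_eq)
    show "c t = 0"
      using t Psi_eq_0[OF z] by (auto simp: I_def cells_def)
  next
    show "card S \<le> card I"
      using S(2) card_cells by (simp add: I_def card_Plus finite_cells finite_solitary)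
  qed
  then show ?thesis
    unfolding sum_eq by blast
qed

text \<open>
  By surjectivity \<open>eps a\<close> is a combination of matrix units and of idempotents \<open>eps b\<close> with \<open>b \<in> \<T>\<^sub>A\<close>, all of
  which are annihilated by the idempotent \<open>eps a\<close> from the right.
\<close>

lemma eps_eq_0:
  assumes a: "a \<in> verts Q" and ns: "\<not> solitary a"
  shows "eps a = 0"
proof -
  obtain X Y where "eps a = Psi X Y"
    using Psi_surj by blast
  then have "eps a * eps a = 0"
    using Psi_mult_eps[OF a, of X Y] ns by simp
  then show ?thesis
    using eps_eps[OF a a] by simp
qed

text \<open>
  The product lies in \<open>K eps b\<close> by surjectivity, hence in \<open>e\<^sub>b V e\<^sub>b\<close>. A loop at \<open>b \<in> \<T>\<^sub>A\<close> would have a nonzero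
  square, so \<open>\<alpha>\<close> is not a loop at \<open>b\<close> and the product vanishes.
\<close>

lemma ar_eps:
  assumes b: "b \<in> verts Q" and al: "\<alpha> \<in> arcs Q"
  shows "ar \<alpha> * eps b = 0"
proof (cases "solitary b")
  case True
  obtain X Y where "ar \<alpha> = Psi X Y"
    using Psi_surj by blast
  then have *: "ar \<alpha> * eps b = Y b *s eps b"
    using Psi_mult_eps[OF b, of X Y] True by simp
  have source: "ar \<alpha> * eps b = e (tail Q \<alpha>) * (ar \<alpha> * eps b)"
    by (simp add: e_ar[OF al] flip: mult.assoc)
  have target: "ar \<alpha> * eps b = ar \<alpha> * (e (head Q \<alpha>) * eps b)"
    by (simp add: ar_e[OF al] flip: mult.assoc)
  show ?thesis
  proof (cases "tail Q \<alpha> = b \<and> head Q \<alpha> = b")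
    case True
    then have "flow \<alpha> \<alpha>"
      using \<open>solitary b\<close> al by (auto simp: solitary_def)
    then show ?thesis
      using flow_irrefl by blast
  next
    case False
    then consider "tail Q \<alpha> \<noteq> b" | "head Q \<alpha> \<noteq> b"
      by blast
    then show ?thesis
    proof cases
      case 1
      then show ?thesis
        using source b al unfolding * by (simp add: mult_scale_right e_eps)
    next
      case 2
      then have "e (head Q \<alpha>) * eps b = 0"
        using b al by (simp add: e_eps)
      then show ?thesis
        using target by simp
    qed
  qed
qed (use eps_eq_0[OF b] in simp)

text \<open>
  A path \<open>p\<close> ending at \<open>b\<close> equals \<open>p e\<^sub>b\<close>, where \<open>e\<^sub>b\<close> is the sum of \<open>eps b\<close> and of the units \<open>E \<rho> j j\<close> at the
  passages through \<open>b\<close>. The product \<open>p E \<rho> j j\<close> is \<open>E \<rho> i j\<close> if \<open>p\<close> is the part of \<open>\<rho>\<close> from position \<open>i\<close>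
  to position \<open>j\<close>, and zero if there is no such \<open>i\<close>. These are the entries of \<open>\<eta>\<^sub>A(p)\<close>.
\<close>

lemma m_eq_Psi:
  assumes p: "p \<in> nonzero_paths"
  shows "m p = Psi (\<lambda>\<rho> i j. if i \<le> j \<and> p = (vert \<rho> i, drop i (take j \<rho>)) then 1 else 0)
    (\<lambda>a. if p = (a, []) then 1 else 0)"
proof -
  obtain a xs where px: "p = (a, xs)"
    by (cases p)
  define b where "b = endpt p"
  have b: "b \<in> verts Q"
    using p thread_tgt_in by (auto simp: b_def endpt_def px nonzero_paths_def split: if_splits)
  have ends: "m p = m p * e b"
    using m_e[OF p b] by (simp add: b_def)
  have xs_arcs: "set xs \<subseteq> arcs Q"
    using p by (auto simp: px nonzero_paths_def thread_def split: if_splits)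
  have m_E: "m p * E \<rho> j j = (\<Sum>i\<le>length \<rho>. if i \<le> j \<and> p = (vert \<rho> i, drop i (take j \<rho>)) then E \<rho> i j else 0)"
    if r: "maximal \<rho>" and j: "j \<le> length \<rho>" for \<rho> j
  proof (cases "xs = []")
    case True
    have cond: "i \<le> j \<and> p = (vert \<rho> i, drop i (take j \<rho>)) \<longleftrightarrow> i = j \<and> vert \<rho> j = a" for i
      using j by (auto simp: px True)
    have "m p * E \<rho> j j = (if vert \<rho> j = a then E \<rho> j j else 0)"
      using p j by (simp add: px True m_def nonzero_paths_def e_E[OF r])
    then show ?thesis
      unfolding cond using j by (cases "vert \<rho> j = a") simp_all
  next
    case False
    have src: "vert \<rho> i = a" if "i \<le> j" "xs = drop i (take j \<rho>)" for i
    proof -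
      have "i < j"
        using that False j by (cases "i = j") auto
      then have "hd xs = \<rho> ! i"
        using that j by (simp add: hd_drop_conv_nth)
      then show ?thesis
        using p False vert_tail[OF maximalD(2)[OF r], of i] \<open>i < j\<close> j
        by (simp add: px nonzero_paths_def src_def)
    qed
    have len: "i = j - length xs \<and> length xs \<le> j" if "i \<le> j" "xs = drop i (take j \<rho>)" for i
    proof -
      have "length xs = j - i"
        using that j by simp
      then show ?thesis
        using that by simp
    qed
    have cond: "i \<le> j \<and> p = (vert \<rho> i, drop i (take j \<rho>)) \<longleftrightarrow>
        i = j - length xs \<and> (length xs \<le> j \<and> xs = drop (j - length xs) (take j \<rho>))" for i
      using src[of i] len[of i] by (auto simp: px)
    have "m p * E \<rho> j j = (if length xs \<le> j \<and> xs = drop (j - length xs) (take j \<rho>)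
        then E \<rho> (j - length xs) j else 0)"
      using M_E[OF r j xs_arcs] False by (simp add: m_def px)
    also have "\<dots> = (\<Sum>i\<le>length \<rho>. if i = j - length xs
        then (if length xs \<le> j \<and> xs = drop (j - length xs) (take j \<rho>) then E \<rho> i j else 0) else 0)"
      using j by simp
    finally show ?thesis
      unfolding cond by (simp only: if_if_eq_conj)
  qed
  have m_eps: "m p * eps b = (if p = (b, []) then eps b else 0)"
  proof (cases "xs = []")
    case True
    then show ?thesis
      using p b by (simp add: px m_def nonzero_paths_def e_eps b_def endpt_def)
  next
    case False
    then obtain ys \<alpha> where "xs = ys @ [\<alpha>]"
      by (cases xs rule: rev_cases) auto
    then show ?thesis
      using xs_arcs ar_eps[OF b] by (simp add: px m_def M_append mult.assoc)
  qed
  have "m p = m p * (eps b + (\<Sum>(\<rho>, u)\<in>positions b. E \<rho> u u))"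
    using ends by (simp add: eps_def)
  also have "\<dots> = m p * eps b + (\<Sum>(\<rho>, u)\<in>positions b. m p * E \<rho> u u)"
    by (simp add: distrib_left sum_distrib_left case_prod_beta)
  also have "(\<Sum>(\<rho>, u)\<in>positions b. m p * E \<rho> u u) = (\<Sum>\<rho> | maximal \<rho>. \<Sum>u\<le>length \<rho>. m p * E \<rho> u u)"
  proof -
    have "(\<Sum>\<rho> | maximal \<rho>. \<Sum>u\<le>length \<rho>. m p * E \<rho> u u) =
        (\<Sum>(\<rho>, u)\<in>(SIGMA \<rho>:{\<rho>. maximal \<rho>}. {..length \<rho>}). m p * E \<rho> u u)"
      by (rule sum.Sigma) (auto simp: finite_maximal)
    also have "\<dots> = (\<Sum>(\<rho>, u)\<in>positions b. m p * E \<rho> u u)"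
    proof (rule sum.mono_neutral_right)
      show "finite (SIGMA \<rho>:{\<rho>. maximal \<rho>}. {..length \<rho>})"
        using finite_maximal by simp
      show "positions b \<subseteq> (SIGMA \<rho>:{\<rho>. maximal \<rho>}. {..length \<rho>})"
        by (auto simp: positions_def)
      show "\<forall>t\<in>(SIGMA \<rho>:{\<rho>. maximal \<rho>}. {..length \<rho>}) - positions b. (case t of (\<rho>, u) \<Rightarrow> m p * E \<rho> u u) = 0"
      proof
        fix t
        assume "t \<in> (SIGMA \<rho>:{\<rho>. maximal \<rho>}. {..length \<rho>}) - positions b"
        then obtain \<rho> u where t: "t = (\<rho>, u)" "maximal \<rho>" "u \<le> length \<rho>" "vert \<rho> u \<noteq> b"
          by (auto simp: positions_def)
        have "m p * E \<rho> u u = m p * (e b * E \<rho> u u)"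
          by (simp only: ends[symmetric] flip: mult.assoc)
        then show "(case t of (\<rho>, u) \<Rightarrow> m p * E \<rho> u u) = 0"
          using t by (simp add: e_E b)
      qed
    qed
    finally show ?thesis ..
  qed
  also have "\<dots> = (\<Sum>\<rho> | maximal \<rho>. \<Sum>i\<le>length \<rho>. \<Sum>j\<le>length \<rho>.
      (if i \<le> j \<and> p = (vert \<rho> i, drop i (take j \<rho>)) then 1 else 0) *s E \<rho> i j)"
  proof (rule sum.cong[OF refl])
    fix \<rho>
    assume "\<rho> \<in> {\<rho>. maximal \<rho>}"
    then have "(\<Sum>u\<le>length \<rho>. m p * E \<rho> u u) = (\<Sum>j\<le>length \<rho>. \<Sum>i\<le>length \<rho>.
        (if i \<le> j \<and> p = (vert \<rho> i, drop i (take j \<rho>)) then 1 else 0) *s E \<rho> i j)"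
      using m_E by (simp add: if_distrib[of "\<lambda>k. k *s _"] cong: if_cong)
    also have "\<dots> = (\<Sum>i\<le>length \<rho>. \<Sum>j\<le>length \<rho>.
        (if i \<le> j \<and> p = (vert \<rho> i, drop i (take j \<rho>)) then 1 else 0) *s E \<rho> i j)"
      by (rule sum.swap)
    finally show "(\<Sum>u\<le>length \<rho>. m p * E \<rho> u u) = (\<Sum>i\<le>length \<rho>. \<Sum>j\<le>length \<rho>.
        (if i \<le> j \<and> p = (vert \<rho> i, drop i (take j \<rho>)) then 1 else 0) *s E \<rho> i j)" .
  qed
  also have "m p * eps b = (\<Sum>a | solitary a. (if p = (a, []) then 1 else 0) *s eps a)"
  proof -
    have "(\<Sum>a | solitary a. (if p = (a, []) then 1 else 0) *s eps a) =
        (\<Sum>a | solitary a. if a = b then m p * eps b else 0)"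
    proof (rule sum.cong[OF refl])
      fix x
      show "(if p = (x, []) then 1 else 0) *s eps x = (if x = b then m p * eps b else 0)"
      proof (cases "p = (x, [])")
        case True
        then have "x = b"
          by (simp add: b_def endpt_def)
        then show ?thesis
          unfolding m_eps using True by simp
      next
        case False
        then show ?thesis
          unfolding m_eps by auto
      qed
    qed
    also have "\<dots> = m p * eps b"
      using finite_solitary eps_eq_0[OF b] by auto
    finally show ?thesis ..
  qed
  finally show ?thesis
    by (simp add: Psi_def add.commute)
qed

end

section \<open>The path algebra of a bound quiver\<close>

text \<open>
  The last vertex of the walk along \<open>xs\<close> from \<open>u\<close>, also for lists which are not walks.
\<close>

definition endv :: "('v, 'a) pre_digraph \<Rightarrow> 'v \<Rightarrow> 'a list \<Rightarrow> 'v" where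
  "endv Q u xs = (if xs = [] then u else head Q (last xs))"

lemma awlast_eq_endv: "pre_digraph.awlast Q u xs = endv Q u xs"
proof (induction xs arbitrary: u)
  case (Cons x xs)
  have "pre_digraph.awalk_verts Q v ys \<noteq> []" for v ys
    by (cases ys) (simp_all add: pre_digraph.awalk_verts.simps)
  then show ?case
    using Cons by (simp add: pre_digraph.awalk_verts.simps endv_def)
qed (simp add: pre_digraph.awalk_verts.simps endv_def)

lemma endv_append: "endv Q u (xs @ ys) = endv Q (endv Q u xs) ys"
  by (simp add: endv_def)

lemma endv_Nil [simp]: "endv Q u [] = u"
  by (simp add: endv_def)

lemma cas_iff:
  "pre_digraph.cas Q u xs (endv Q u xs) \<longleftrightarrow>
    successively (\<lambda>\<alpha> \<beta>. head Q \<alpha> = tail Q \<beta>) xs \<and> (xs \<noteq> [] \<longrightarrow> u = tail Q (hd xs))"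
proof (induction xs arbitrary: u)
  case (Cons x xs)
  have "endv Q u (x # xs) = endv Q (head Q x) xs"
    by (simp add: endv_def)
  then show ?case
    using Cons by (auto simp: pre_digraph.cas.simps successively_Cons)
qed (simp add: pre_digraph.cas.simps)

lemma paths_iff:
  "(u, xs) \<in> paths Q \<longleftrightarrow> u \<in> verts Q \<and> set xs \<subseteq> arcs Q \<and>
    successively (\<lambda>\<alpha> \<beta>. head Q \<alpha> = tail Q \<beta>) xs \<and> (xs \<noteq> [] \<longrightarrow> u = tail Q (hd xs))"
  by (simp add: paths_def psource_def ptarget_def pre_digraph.awalk_def awlast_eq_endv cas_iff)

lemma vertex_at_eq: "vertex_at Q (u, xs) i = endv Q u (take i xs)"
  by (simp add: vertex_at_def awlast_eq_endv)

lemma subpath_eq: "subpath Q (u, xs) i j = (endv Q u (take i xs), drop i (take j xs))"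
  by (simp add: subpath_def vertex_at_eq)

lemma ptarget_eq: "ptarget Q (u, xs) = endv Q u xs"
  by (simp add: ptarget_def awlast_eq_endv)

abbreviation conv ::
  "('v, 'a) pre_digraph \<Rightarrow> (('v, 'a) qpath \<Rightarrow> 'k::field) \<Rightarrow> (('v, 'a) qpath \<Rightarrow> 'k) \<Rightarrow> ('v, 'a) qpath \<Rightarrow> 'k"
  where "conv Q f g \<equiv> f \<otimes>\<^bsub>path_algebra Q\<^esub> g"

lemma conv_eq:
  "conv Q f g (u, xs) = (\<Sum>i\<le>length xs. f (u, take i xs) * g (endv Q u (take i xs), drop i xs))"
  by (simp add: path_algebra_def subpath_eq plength_def)

lemma carrier_path_algebra:
  "f \<in> carrier (path_algebra Q) \<longleftrightarrow> finite {p. f p \<noteq> 0} \<and> (\<forall>p. f p \<noteq> 0 \<longrightarrow> p \<in> paths Q)"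
  by (auto simp: path_algebra_def)

lemma path_algebra_simps:
  "\<one>\<^bsub>path_algebra Q\<^esub> = (\<lambda>p. if p \<in> paths Q \<and> plength p = 0 then 1 else 0)"
  "\<zero>\<^bsub>path_algebra Q\<^esub> = (\<lambda>p. 0)"
  "f \<oplus>\<^bsub>path_algebra Q\<^esub> g = (\<lambda>p. f p + g p)"
  "c \<odot>\<^bsub>path_algebra Q\<^esub> f = (\<lambda>p. c * f p)"
  by (simp_all add: path_algebra_def)

lemma conv_take:
  assumes "j \<le> length xs"
  shows "conv Q f g (u, take j xs) =
    (\<Sum>i=0..j. f (u, take i xs) * g (endv Q u (take i xs), take (j - i) (drop i xs)))"
  unfolding conv_eq atMost_atLeast0 using assms by (intro sum.cong) (auto simp: min_def take_drop)

lemma conv_drop: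
  assumes "j \<le> length xs"
  shows "conv Q g h (endv Q u (take j xs), drop j xs) =
    (\<Sum>i=0..length xs - j. g (endv Q u (take j xs), take i (drop j xs)) *
      h (endv Q u (take (j + i) xs), drop (j + i) xs))"
  unfolding conv_eq atMost_atLeast0
proof (rule sum.cong)
  fix i
  have "drop i (drop j xs) = drop (j + i) xs"
    by (simp add: add.commute)
  then show "g (endv Q u (take j xs), take i (drop j xs)) *
      h (endv Q (endv Q u (take j xs)) (take i (drop j xs)), drop i (drop j xs)) =
    g (endv Q u (take j xs), take i (drop j xs)) * h (endv Q u (take (j + i) xs), drop (j + i) xs)"
    by (simp only: take_add endv_append)
qed (use assms in simp)

text \<open>
  Both sides sum over the ways to cut a path into three parts, so the reindexing is that of the Cauchy
  product of power series.
\<close>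

lemma conv_assoc:
  fixes Q :: "('v, 'a) pre_digraph"
  shows "conv Q (conv Q f g) h = conv Q f (conv Q g h)"
proof
  fix p :: "('v, 'a) qpath"
  obtain u xs where p: "p = (u, xs)"
    by (cases p)
  define n where "n = length xs"
  define F where "F = (\<lambda>i k r. f (u, take i xs) * g (endv Q u (take i xs), take k (drop i xs)) *
    h (endv Q u (take (n - r) xs), drop (n - r) xs))"
  have "conv Q (conv Q f g) h p =
      (\<Sum>j=0..n. conv Q f g (u, take j xs) * h (endv Q u (take j xs), drop j xs))"
    by (simp add: p conv_eq[of Q "conv Q f g"] n_def atMost_atLeast0)
  also have "\<dots> = (\<Sum>j=0..n. \<Sum>i=0..j. F i (j - i) (n - j))"
    by (rule sum.cong[OF refl]) (simp add: conv_take n_def F_def sum_distrib_right)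
  also have "\<dots> = (\<Sum>j=0..n. \<Sum>i=0..n - j. F j i (n - j - i))"
    by (rule fps_mult_assoc_lemma)
  also have "\<dots> = (\<Sum>j=0..n. f (u, take j xs) * conv Q g h (endv Q u (take j xs), drop j xs))"
  proof (rule sum.cong[OF refl])
    fix j
    assume j: "j \<in> {0..n}"
    show "(\<Sum>i=0..n - j. F j i (n - j - i)) =
        f (u, take j xs) * conv Q g h (endv Q u (take j xs), drop j xs)"
    proof -
      have "(\<Sum>i=0..n - j. F j i (n - j - i)) =
          (\<Sum>i=0..n - j. f (u, take j xs) * (g (endv Q u (take j xs), take i (drop j xs)) *
            h (endv Q u (take (j + i) xs), drop (j + i) xs)))"
      proof (rule sum.cong[OF refl])
        fix i
        assume i: "i \<in> {0..n - j}"
        have "n - (n - j - i) = j + i"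
          using i j by simp
        then show "F j i (n - j - i) = f (u, take j xs) * (g (endv Q u (take j xs), take i (drop j xs)) *
            h (endv Q u (take (j + i) xs), drop (j + i) xs))"
          by (simp add: F_def mult.assoc)
      qed
      then show ?thesis
        using j by (simp add: conv_drop n_def sum_distrib_left)
    qed
  qed
  also have "\<dots> = conv Q f (conv Q g h) p"
    by (simp add: p conv_eq[of Q f] n_def atMost_atLeast0)
  finally show "conv Q (conv Q f g) h p = conv Q f (conv Q g h) p" .
qed

locale quiver = fin_digraph Q for Q :: "('v, 'a) pre_digraph"
begin

lemma endv_in: "(u, xs) \<in> paths Q \<Longrightarrow> endv Q u xs \<in> verts Q"
  by (auto simp: paths_iff endv_def dest: last_in_set)

lemma paths_append:
  "(u, xs @ ys) \<in> paths Q \<longleftrightarrow> (u, xs) \<in> paths Q \<and> (endv Q u xs, ys) \<in> paths Q"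
proof (cases "xs = []")
  case False
  then show ?thesis
    using endv_in[of u xs]
    by (cases "ys = []") (auto simp: paths_iff endv_def successively_append_iff)
qed (auto simp: paths_iff)

lemma conv_carrier:
  assumes f: "f \<in> carrier (path_algebra Q)" and g: "g \<in> carrier (path_algebra Q)"
  shows "conv Q f g \<in> carrier (path_algebra Q)"
proof -
  have *: "(u, xs) \<in> paths Q \<and> (\<exists>q r. f q \<noteq> 0 \<and> g r \<noteq> 0 \<and> (u, xs) = (fst q, snd q @ snd r))"
    if nz: "conv Q f g (u, xs) \<noteq> 0" for u xs
  proof -
    obtain i where i: "f (u, take i xs) \<noteq> 0" "g (endv Q u (take i xs), drop i xs) \<noteq> 0"
      using nz unfolding conv_eq by (metis (no_types, lifting) mult_zero_left mult_zero_right sum.neutral)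
    then have "(u, take i xs @ drop i xs) \<in> paths Q"
      using f g unfolding paths_append carrier_path_algebra by blast
    moreover have "(u, xs) = (fst (u, take i xs), snd (u, take i xs) @ snd (endv Q u (take i xs), drop i xs))"
      by simp
    ultimately show ?thesis
      using i by (metis append_take_drop_id)
  qed
  have "{p. conv Q f g p \<noteq> 0} \<subseteq> (\<lambda>(q, r). (fst q, snd q @ snd r)) ` ({q. f q \<noteq> 0} \<times> {r. g r \<noteq> 0})"
    using * by force
  moreover have "finite ({q. f q \<noteq> 0} \<times> {r. g r \<noteq> 0})"
    using f g by (simp add: carrier_path_algebra)
  ultimately have "finite {p. conv Q f g p \<noteq> 0}"
    by (meson finite_imageI finite_subset)
  then show ?thesis
    using * by (auto simp: carrier_path_algebra)
qed

lemma one_carrier: "\<one>\<^bsub>path_algebra Q\<^esub> \<in> carrier (path_algebra Q)"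
proof -
  have "{p. p \<in> paths Q \<and> plength p = 0} \<subseteq> (\<lambda>a. (a, [])) ` verts Q"
    by (auto simp: plength_def paths_iff)
  then have "finite {p. p \<in> paths Q \<and> plength p = 0}"
    by (rule finite_subset) simp
  then show ?thesis
    by (simp add: carrier_path_algebra path_algebra_simps)
qed

lemma one_conv:
  assumes f: "f \<in> carrier (path_algebra Q)"
  shows "conv Q \<one>\<^bsub>path_algebra Q\<^esub> f = f"
proof
  fix p :: "('v, 'a) qpath"
  obtain u xs where p: "p = (u, xs)"
    by (cases p)
  have "conv Q \<one>\<^bsub>path_algebra Q\<^esub> f p =
      (\<Sum>i\<le>length xs. if i = 0 then (if u \<in> verts Q then f (u, xs) else 0) else 0)"
    unfolding p conv_eq by (rule sum.cong) (auto simp: path_algebra_simps plength_def paths_iff)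
  also have "\<dots> = (if u \<in> verts Q then f (u, xs) else 0)"
    by simp
  also have "\<dots> = f p"
    using f by (auto simp: p carrier_path_algebra paths_iff)
  finally show "conv Q \<one>\<^bsub>path_algebra Q\<^esub> f p = f p" .
qed

lemma conv_one:
  assumes f: "f \<in> carrier (path_algebra Q)"
  shows "conv Q f \<one>\<^bsub>path_algebra Q\<^esub> = f"
proof
  fix p :: "('v, 'a) qpath"
  obtain u xs where p: "p = (u, xs)"
    by (cases p)
  have "conv Q f \<one>\<^bsub>path_algebra Q\<^esub> p =
      (\<Sum>i\<le>length xs. if i = length xs then (if endv Q u xs \<in> verts Q then f (u, xs) else 0) else 0)"
    unfolding p conv_eq by (rule sum.cong) (auto simp: path_algebra_simps plength_def paths_iff)
  also have "\<dots> = (if endv Q u xs \<in> verts Q then f (u, xs) else 0)"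
    by simp
  also have "\<dots> = f p"
    using f endv_in by (auto simp: p carrier_path_algebra)
  finally show "conv Q f \<one>\<^bsub>path_algebra Q\<^esub> p = f p" .
qed

lemma add_carrier:
  assumes "f \<in> carrier (path_algebra Q)" "g \<in> carrier (path_algebra Q)"
  shows "(\<lambda>p. f p + g p) \<in> carrier (path_algebra Q)"
proof -
  have "{p. f p + g p \<noteq> 0} \<subseteq> {p. f p \<noteq> 0} \<union> {p. g p \<noteq> 0}"
    by auto
  then have "finite {p. f p + g p \<noteq> 0}"
    by (rule finite_subset) (use assms in \<open>simp add: carrier_path_algebra\<close>)
  moreover have "p \<in> paths Q" if "f p + g p \<noteq> 0" for p
    using that assms
    by (cases "f p = 0") (auto simp: carrier_path_algebra simp del: split_paired_All)
  ultimately show ?thesis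
    by (simp add: carrier_path_algebra)
qed

lemma smult_carrier:
  assumes "f \<in> carrier (path_algebra Q)"
  shows "(\<lambda>p. c * f p) \<in> carrier (path_algebra Q)"
  using assms by (cases "c = 0") (simp_all add: carrier_path_algebra)

lemma ring_path_algebra: "ring (path_algebra Q :: ('k::field, ('v, 'a) qpath \<Rightarrow> 'k) module)"
proof (rule ringI)
  show "abelian_group (path_algebra Q :: ('k, ('v, 'a) qpath \<Rightarrow> 'k) module)"
  proof (rule abelian_groupI)
    fix f :: "('v, 'a) qpath \<Rightarrow> 'k"
    assume "f \<in> carrier (path_algebra Q)"
    then have "(\<lambda>p. - 1 * f p) \<in> carrier (path_algebra Q)"
      by (rule smult_carrier)
    then show "\<exists>g\<in>carrier (path_algebra Q). g \<oplus>\<^bsub>path_algebra Q\<^esub> f = \<zero>\<^bsub>path_algebra Q\<^esub>"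
      by (rule bexI[rotated]) (simp add: path_algebra_simps)
  qed (auto simp: path_algebra_simps add_carrier add.assoc add.commute, simp add: carrier_path_algebra)
  show "Group.monoid (path_algebra Q :: ('k, ('v, 'a) qpath \<Rightarrow> 'k) module)"
    by (rule monoidI) (simp_all add: conv_carrier one_carrier conv_assoc one_conv conv_one)
next
  fix f g h :: "('v, 'a) qpath \<Rightarrow> 'k"
  show "conv Q (f \<oplus>\<^bsub>path_algebra Q\<^esub> g) h = conv Q f h \<oplus>\<^bsub>path_algebra Q\<^esub> conv Q g h"
    unfolding path_algebra_simps(3) by (rule ext) (auto simp: conv_eq distrib_right sum.distrib)
  show "conv Q h (f \<oplus>\<^bsub>path_algebra Q\<^esub> g) = conv Q h f \<oplus>\<^bsub>path_algebra Q\<^esub> conv Q h g"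
    unfolding path_algebra_simps(3) by (rule ext) (auto simp: conv_eq distrib_left sum.distrib)
qed

lemma single_carrier: "p \<in> paths Q \<Longrightarrow> single p \<in> carrier (path_algebra Q)"
  by (auto simp: carrier_path_algebra single_def)

lemma conv_single_single:
  "conv Q (single (u, xs)) (single (v, ys)) =
    (if v = endv Q u xs then single (u, xs @ ys) else (\<lambda>p. 0 :: 'k::field))"
proof
  fix p :: "('v, 'a) qpath"
  obtain w zs where p: "p = (w, zs)"
    by (cases p)
  have "conv Q (single (u, xs)) (single (v, ys)) p =
      (\<Sum>i\<le>length zs. if i = length xs then
        (if w = u \<and> zs = xs @ ys \<and> v = endv Q u xs then 1 else 0 :: 'k) else 0)"
    unfolding p conv_eq
  proof (rule sum.cong[OF refl])
    fix i
    assume i: "i \<in> {..length zs}"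
    have cut: "take i zs = xs \<and> drop i zs = ys \<longleftrightarrow> i = length xs \<and> zs = xs @ ys"
    proof
      assume t: "take i zs = xs \<and> drop i zs = ys"
      then have "length xs = i"
        using i by auto
      moreover have "zs = xs @ ys"
        using t append_take_drop_id[of i zs] by simp
      ultimately show "i = length xs \<and> zs = xs @ ys"
        by simp
    qed simp
    have "single (u, xs) (w, take i zs) * single (v, ys) (endv Q w (take i zs), drop i zs) =
        (if w = u \<and> v = endv Q w (take i zs) \<and> take i zs = xs \<and> drop i zs = ys then 1 else 0 :: 'k)"
      by (auto simp: single_def)
    also have "(w = u \<and> v = endv Q w (take i zs) \<and> take i zs = xs \<and> drop i zs = ys) \<longleftrightarrow>
        i = length xs \<and> (w = u \<and> zs = xs @ ys \<and> v = endv Q u xs)"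
      using cut by auto
    finally show "single (u, xs) (w, take i zs) * single (v, ys) (endv Q w (take i zs), drop i zs) =
        (if i = length xs then (if w = u \<and> zs = xs @ ys \<and> v = endv Q u xs then 1 else 0 :: 'k) else 0)"
      by (simp only: if_if_eq_conj)
  qed
  also have "\<dots> = (if w = u \<and> zs = xs @ ys \<and> v = endv Q u xs then 1 else 0)"
    by simp
  also have "\<dots> = (if v = endv Q u xs then single (u, xs @ ys) else (\<lambda>p. 0 :: 'k)) p"
    by (auto simp: p single_def)
  finally show "conv Q (single (u, xs)) (single (v, ys)) p =
      (if v = endv Q u xs then single (u, xs @ ys) else (\<lambda>p. 0 :: 'k)) p" .
qed

end

locale bound_quiver = quiver Q
  for Q :: "('v, 'a) pre_digraph" +
  fixes I :: "(('v, 'a) qpath \<Rightarrow> 'k::field) set" and R :: "('v, 'a) qpath set"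
  assumes relations: "R \<subseteq> {p \<in> paths Q. plength p = 2}"
    and ideal_eq: "I = Idl\<^bsub>path_algebra Q\<^esub> (single ` R)"
begin

abbreviation PA :: "('k, ('v, 'a) qpath \<Rightarrow> 'k) module" where
  "PA \<equiv> path_algebra Q"

abbreviation A :: "('k, (('v, 'a) qpath \<Rightarrow> 'k) set) module" where
  "A \<equiv> quiver_algebra Q I"

definition flow :: "'a \<Rightarrow> 'a \<Rightarrow> bool" where
  "flow \<alpha> \<beta> \<longleftrightarrow> \<alpha> \<in> arcs Q \<and> \<beta> \<in> arcs Q \<and> head Q \<alpha> = tail Q \<beta> \<and> \<not> in_ideal Q I \<alpha> \<beta>"

definition zero_free :: "('v, 'a) qpath \<Rightarrow> bool" where
  "zero_free p \<longleftrightarrow> successively (\<lambda>\<alpha> \<beta>. (tail Q \<alpha>, [\<alpha>, \<beta>]) \<notin> R) (snd p)"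

interpretation PA: ring PA
  by (rule ring_path_algebra)

lemma relations_carrier: "single ` R \<subseteq> carrier PA"
  using relations single_carrier by auto

lemma ideal_I: "ideal I PA"
  unfolding ideal_eq by (rule PA.genideal_ideal[OF relations_carrier])

interpretation I: ideal I PA
  by (rule ideal_I)

lemma I_zero: "(\<lambda>p. 0) \<in> I"
  using I.zero_closed by (simp add: path_algebra_simps)

lemma I_add: "\<lbrakk>f \<in> I; g \<in> I\<rbrakk> \<Longrightarrow> (\<lambda>p. f p + g p) \<in> I"
  using I.a_closed[of f g] by (simp add: path_algebra_simps)

lemma I_smult:
  assumes f: "f \<in> I"
  shows "(\<lambda>p. c * f p) \<in> I"
proof -
  have "(\<lambda>p. c * \<one>\<^bsub>PA\<^esub> p) \<in> carrier PA"
    using one_carrier by (rule smult_carrier)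
  then have "conv Q (\<lambda>p. c * \<one>\<^bsub>PA\<^esub> p) f \<in> I"
    using f by (rule I.I_l_closed[rotated])
  also have "conv Q (\<lambda>p. c * \<one>\<^bsub>PA\<^esub> p) f = (\<lambda>p. c * conv Q \<one>\<^bsub>PA\<^esub> f p)"
    by (rule ext) (auto simp: conv_eq sum_distrib_left mult.assoc)
  also have "conv Q \<one>\<^bsub>PA\<^esub> f = f"
    using I.Icarr[OF f] by (rule one_conv)
  finally show ?thesis .
qed

text \<open>
  Parts of a path without zero relations are again such paths, so the product of a function vanishing
  on them with any function vanishes on them.
\<close>

lemma vanishing_ideal: "ideal {f \<in> carrier PA. \<forall>p\<in>paths Q. zero_free p \<longrightarrow> f p = 0} PA" (is "ideal ?J PA")
proof (rule idealI[OF ring_path_algebra])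
  have neg: "\<ominus>\<^bsub>PA\<^esub> f = (\<lambda>p. - f p)" if f: "f \<in> carrier PA" for f
  proof -
    have "(\<lambda>p. - f p) \<in> carrier PA"
      using smult_carrier[OF f, of "- 1"] by simp
    then show ?thesis
      using f by (intro PA.minus_equality) (simp_all add: path_algebra_simps)
  qed
  show "subgroup ?J (add_monoid PA)"
  proof (rule PA.add.subgroupI)
    show "?J \<noteq> {}"
      using PA.zero_closed by (auto simp: path_algebra_simps)
  next
    fix f
    assume "f \<in> ?J"
    then show "\<ominus>\<^bsub>PA\<^esub> f \<in> ?J"
      using PA.a_inv_closed[of f] by (simp add: neg)
  next
    fix f g
    assume "f \<in> ?J" "g \<in> ?J"
    then show "f \<oplus>\<^bsub>PA\<^esub> g \<in> ?J"
      by (simp add: path_algebra_simps add_carrier)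
  qed auto
next
  fix f x
  assume f: "f \<in> ?J" and x: "x \<in> carrier PA"
  have sub: "zero_free (u, take i xs)" "zero_free (v, drop i xs)"
    if "zero_free (u, xs)" for u v i and xs :: "'a list"
  proof -
    have "zero_free (u, take i xs @ drop i xs)"
      using that by simp
    then show "zero_free (u, take i xs)" "zero_free (v, drop i xs)"
      unfolding zero_free_def snd_conv successively_append_iff by blast+
  qed
  have split: "(u, take i xs) \<in> paths Q" "(endv Q u (take i xs), drop i xs) \<in> paths Q"
    if "(u, xs) \<in> paths Q" for u i and xs :: "'a list"
    using that paths_append[of u "take i xs" "drop i xs"] by simp_all
  have "conv Q x f p = 0" "conv Q f x p = 0" if p: "p \<in> paths Q" "zero_free p" for p :: "('v, 'a) qpath"
  proof -
    obtain u xs where "p = (u, xs)"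
      by (cases p)
    then show "conv Q x f p = 0" "conv Q f x p = 0"
      using f p sub[of u xs] split[of u xs] by (auto simp: conv_eq)
  qed
  then show "x \<otimes>\<^bsub>PA\<^esub> f \<in> ?J" "f \<otimes>\<^bsub>PA\<^esub> x \<in> ?J"
    using f x conv_carrier by auto
qed

lemma I_vanishes: "\<lbrakk>f \<in> I; p \<in> paths Q; zero_free p\<rbrakk> \<Longrightarrow> f p = 0"
proof -
  have "single ` R \<subseteq> {f \<in> carrier PA. \<forall>p\<in>paths Q. zero_free p \<longrightarrow> f p = 0}"
  proof (intro subsetI, elim imageE, simp, intro conjI ballI impI)
    fix r
    assume r: "r \<in> R"
    then have "r \<in> paths Q"
      using relations by blast
    then show "single r \<in> carrier PA"
      by (rule single_carrier)
    fix p
    assume p: "p \<in> paths Q" "zero_free p"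
    have "p \<noteq> r"
    proof
      assume "p = r"
      then obtain u \<alpha> \<beta> where "p = (u, [\<alpha>, \<beta>])"
        using r relations by (cases p) (auto simp: plength_def length_Suc_conv numeral_2_eq_2)
      then show False
        using p r \<open>p = r\<close> by (auto simp: paths_iff zero_free_def)
    qed
    then show "single r p = (0 :: 'k)"
      by (simp add: single_def)
  qed
  then have "I \<subseteq> {f \<in> carrier PA. \<forall>p\<in>paths Q. zero_free p \<longrightarrow> f p = 0}"
    unfolding ideal_eq by (rule PA.genideal_minimal[OF vanishing_ideal])
  then show "\<lbrakk>f \<in> I; p \<in> paths Q; zero_free p\<rbrakk> \<Longrightarrow> f p = 0"
    by auto
qed

lemma single_in_I:
  assumes p: "p \<in> paths Q" and z: "\<not> zero_free p"
  shows "single p \<in> I"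
proof -
  obtain u xs where px: "p = (u, xs)"
    by (cases p)
  have "\<exists>as \<alpha> \<beta> bs. xs = as @ [\<alpha>, \<beta>] @ bs \<and> (tail Q \<alpha>, [\<alpha>, \<beta>]) \<in> R"
    using z unfolding px zero_free_def snd_conv
  proof (induction xs rule: induct_list012)
    case (3 x y zs)
    show ?case
    proof (cases "(tail Q x, [x, y]) \<in> R")
      case True
      then show ?thesis
        by (intro exI[of _ "[]"]) auto
    next
      case False
      then obtain as \<alpha> \<beta> bs where "y # zs = as @ [\<alpha>, \<beta>] @ bs" "(tail Q \<alpha>, [\<alpha>, \<beta>]) \<in> R"
        using 3 by auto
      then have "x # y # zs = (x # as) @ [\<alpha>, \<beta>] @ bs \<and> (tail Q \<alpha>, [\<alpha>, \<beta>]) \<in> R"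
        by simp
      then show ?thesis
        by blast
    qed
  qed simp_all
  then obtain as \<alpha> \<beta> bs where xs: "xs = as @ [\<alpha>, \<beta>] @ bs" and r: "(tail Q \<alpha>, [\<alpha>, \<beta>]) \<in> R"
    by blast
  have "(u, as @ [\<alpha>, \<beta>] @ bs) \<in> paths Q"
    using p by (simp add: px xs)
  then have 1: "(u, as) \<in> paths Q" and 2: "(endv Q u as, [\<alpha>, \<beta>]) \<in> paths Q"
    and 3: "(endv Q (endv Q u as) [\<alpha>, \<beta>], bs) \<in> paths Q"
    unfolding paths_append[of _ as] paths_append[of _ "[\<alpha>, \<beta>]"] by auto
  have e: "endv Q u as = tail Q \<alpha>"
    using 2 by (simp add: paths_iff)
  have "single (tail Q \<alpha>, [\<alpha>, \<beta>]) \<in> I"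
    using PA.genideal_self[OF relations_carrier] r unfolding ideal_eq by blast
  then have "conv Q (conv Q (single (u, as)) (single (endv Q u as, [\<alpha>, \<beta>])))
      (single (endv Q (endv Q u as) [\<alpha>, \<beta>], bs)) \<in> I"
    unfolding e[symmetric] using 1 3 single_carrier I.I_l_closed I.I_r_closed by blast
  then show ?thesis
    by (simp add: conv_single_single px xs flip: endv_append)
qed

lemma apaths_zero_free: "p \<in> apaths Q I \<longleftrightarrow> p \<in> paths Q \<and> zero_free p"
proof -
  have "single p \<notin> I" if "p \<in> paths Q" "zero_free p"
    using I_vanishes[OF _ that, of "single p"] by (auto simp: single_def)
  then show ?thesis
    using single_in_I[of p] by (auto simp: apaths_def)
qed

text \<open>
  \<open>I\<close> is a monomial ideal: it is spanned by the paths which contain a relation, and \<open>vanishing_ideal\<close>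
  shows that it contains no other combination of paths.
\<close>

lemma I_iff: "f \<in> I \<longleftrightarrow> f \<in> carrier PA \<and> (\<forall>p\<in>apaths Q I. f p = 0)"
proof
  assume "f \<in> I"
  then show "f \<in> carrier PA \<and> (\<forall>p\<in>apaths Q I. f p = 0)"
    using I.Icarr I_vanishes by (simp add: apaths_zero_free)
next
  assume f: "f \<in> carrier PA \<and> (\<forall>p\<in>apaths Q I. f p = 0)"
  have part: "(\<lambda>q. if q \<in> S then f q else 0) \<in> I" if "finite S" "S \<subseteq> {p. f p \<noteq> 0}" for S
    using that
  proof (induction S rule: finite_induct)
    case empty
    then show ?case
      using I_zero by simp
  next
    case (insert p S)
    then have "p \<in> paths Q" "p \<notin> apaths Q I"
      using f by (auto simp: carrier_path_algebra simp del: split_paired_All)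
    then have "single p \<in> I"
      by (auto simp: apaths_def)
    then have "(\<lambda>q. (if q \<in> S then f q else 0) + f p * single p q) \<in> I"
      using insert by (intro I_add I_smult) auto
    also have "(\<lambda>q. (if q \<in> S then f q else 0) + f p * single p q) =
        (\<lambda>q. if q \<in> insert p S then f q else 0)"
      using insert.hyps by (auto simp: single_def fun_eq_iff)
    finally show ?case .
  qed
  have "(\<lambda>q. if q \<in> {p. f p \<noteq> 0} then f q else 0) = f"
    by auto
  then show "f \<in> I"
    using part[of "{p. f p \<noteq> 0}"] f by (simp add: carrier_path_algebra)
qed

text \<open>
  For consecutive arrows, \<open>\<alpha>\<beta> \<in> I\<close> iff the path \<open>\<alpha>\<beta>\<close> is one of the generators. Hence a path is nonzero in
  \<open>A\<close> iff all its subpaths of length 2 are.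
\<close>

lemma apaths_iff:
  "(u, xs) \<in> apaths Q I \<longleftrightarrow> u \<in> verts Q \<and> set xs \<subseteq> arcs Q \<and> successively flow xs \<and>
    (xs \<noteq> [] \<longrightarrow> u = tail Q (hd xs))"
proof -
  have in_I: "in_ideal Q I \<alpha> \<beta> \<longleftrightarrow> (tail Q \<alpha>, [\<alpha>, \<beta>]) \<in> R"
    if "\<alpha> \<in> arcs Q" "\<beta> \<in> arcs Q" "head Q \<alpha> = tail Q \<beta>" for \<alpha> \<beta>
  proof -
    have "(tail Q \<alpha>, [\<alpha>, \<beta>]) \<in> paths Q"
      using that by (simp add: paths_iff)
    then show ?thesis
      using apaths_zero_free[of "(tail Q \<alpha>, [\<alpha>, \<beta>])"]
      by (simp add: apaths_def zero_free_def in_ideal_def)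
  qed
  have "successively (\<lambda>\<alpha> \<beta>. head Q \<alpha> = tail Q \<beta>) xs \<and>
      successively (\<lambda>\<alpha> \<beta>. (tail Q \<alpha>, [\<alpha>, \<beta>]) \<notin> R) xs \<longleftrightarrow> successively flow xs"
    if "set xs \<subseteq> arcs Q"
    using that
  proof (induction xs rule: induct_list012)
    case (3 x y zs)
    then show ?case
      using in_I[of x y] by (auto simp: flow_def)
  qed simp_all
  then show ?thesis
    by (auto simp: apaths_zero_free paths_iff zero_free_def)
qed

end

section \<open>The algebra \<open>A = KQ / I\<close> and the dual basis\<close>

context bound_quiver
begin

interpretation PA: ring PA
  by (rule ring_path_algebra)

interpretation I: ideal I PA
  by (rule ideal_I)

abbreviation cl :: "(('v, 'a) qpath \<Rightarrow> 'k) \<Rightarrow> (('v, 'a) qpath \<Rightarrow> 'k) set" where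
  "cl f \<equiv> I +>\<^bsub>PA\<^esub> f"

lemma cls_eq: "cls Q I p = cl (single p)"
  by (simp add: cls_def)

lemma A_simps:
  "carrier A = carrier (PA Quot I)" "X \<otimes>\<^bsub>A\<^esub> Y = X \<otimes>\<^bsub>PA Quot I\<^esub> Y" "\<one>\<^bsub>A\<^esub> = \<one>\<^bsub>PA Quot I\<^esub>"
  "\<zero>\<^bsub>A\<^esub> = \<zero>\<^bsub>PA Quot I\<^esub>" "X \<oplus>\<^bsub>A\<^esub> Y = X \<oplus>\<^bsub>PA Quot I\<^esub> Y"
  "c \<odot>\<^bsub>A\<^esub> X = (\<Union>f\<in>X. I +>\<^bsub>PA\<^esub> (c \<odot>\<^bsub>PA\<^esub> f))"
  by (simp_all add: quiver_algebra_def ring.defs module.defs)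

lemma A_carrier: "X \<in> carrier A \<longleftrightarrow> (\<exists>f\<in>carrier PA. X = cl f)"
  by (auto simp: A_simps FactRing_def A_RCOSETS_def')

lemma cl_carrier: "f \<in> carrier PA \<Longrightarrow> cl f \<in> carrier A"
  by (auto simp: A_carrier)

lemma cl_add: "\<lbrakk>f \<in> carrier PA; g \<in> carrier PA\<rbrakk> \<Longrightarrow> cl f \<oplus>\<^bsub>A\<^esub> cl g = cl (\<lambda>p. f p + g p)"
  by (simp add: A_simps FactRing_def I.a_rcos_sum) (simp add: path_algebra_simps)

lemma cl_mult: "\<lbrakk>f \<in> carrier PA; g \<in> carrier PA\<rbrakk> \<Longrightarrow> cl f \<otimes>\<^bsub>A\<^esub> cl g = cl (conv Q f g)"
  by (simp add: A_simps FactRing_def I.rcoset_mult_add)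

lemma path_algebra_minus: "\<lbrakk>f \<in> carrier PA; g \<in> carrier PA\<rbrakk> \<Longrightarrow> f \<ominus>\<^bsub>PA\<^esub> g = (\<lambda>p. f p - g p)"
proof -
  assume f: "f \<in> carrier PA" and g: "g \<in> carrier PA"
  have neg: "(\<lambda>p. - g p) \<in> carrier PA"
    using smult_carrier[OF g, of "- 1"] by simp
  then have "\<ominus>\<^bsub>PA\<^esub> g = (\<lambda>p. - g p)"
    using g by (intro PA.minus_equality) (simp_all add: path_algebra_simps)
  then show "f \<ominus>\<^bsub>PA\<^esub> g = (\<lambda>p. f p - g p)"
    by (simp add: a_minus_def path_algebra_simps)
qed

lemma cl_eq_iff:
  assumes f: "f \<in> carrier PA" and g: "g \<in> carrier PA"
  shows "cl f = cl g \<longleftrightarrow> (\<forall>p\<in>apaths Q I. f p = g p)"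
proof -
  have "f \<ominus>\<^bsub>PA\<^esub> g \<in> carrier PA"
    using f g by (rule PA.minus_closed)
  then show ?thesis
    unfolding PA.quotient_eq_iff_same_a_r_cos[OF ideal_I f g, symmetric] I_iff
    by (simp add: path_algebra_minus[OF f g])
qed

lemma zero_carrier: "(\<lambda>p. 0) \<in> carrier PA"
  using PA.zero_closed by (simp add: path_algebra_simps)

lemma cl_zero: "\<zero>\<^bsub>A\<^esub> = cl (\<lambda>p. 0)"
  using I.a_rcos_const[OF I_zero] by (simp add: A_simps FactRing_def)

lemma cl_smult:
  assumes f: "f \<in> carrier PA"
  shows "c \<odot>\<^bsub>A\<^esub> cl f = cl (\<lambda>p. c * f p)"
proof -
  have "cl (c \<odot>\<^bsub>PA\<^esub> g) = cl (\<lambda>p. c * f p)" if g: "g \<in> cl f" for g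
  proof -
    have "g \<in> carrier PA"
      using f g by (rule I.a_elemrcos_carrier)
    moreover have "cl g = cl f"
      using PA.a_repr_independence[OF g f I.a_subgroup] by (rule sym)
    ultimately show ?thesis
      using f cl_eq_iff[of g f] cl_eq_iff[of "\<lambda>p. c * g p" "\<lambda>p. c * f p"]
      by (simp add: path_algebra_simps smult_carrier)
  qed
  moreover have "f \<in> cl f"
    using f by (rule I.a_rcos_self)
  ultimately show ?thesis
    unfolding A_simps by blast
qed

text \<open>
  An arbitrary representative of a coset. Only its values at the paths in \<open>A\<close> are meaningful: there
  all representatives agree, and they are the coordinates in the basis of paths.
\<close>

definition coef :: "(('v, 'a) qpath \<Rightarrow> 'k) set \<Rightarrow> ('v, 'a) qpath \<Rightarrow> 'k" where
  "coef X = (SOME f. f \<in> carrier PA \<and> X = cl f)"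

lemma coef_carrier:
  assumes "X \<in> carrier A"
  shows "coef X \<in> carrier PA \<and> X = cl (coef X)"
proof -
  have "\<exists>f. f \<in> carrier PA \<and> X = cl f"
    using assms by (auto simp: A_carrier)
  from someI_ex[OF this] show ?thesis
    unfolding coef_def .
qed

lemma coef_cl:
  assumes f: "f \<in> carrier PA" and p: "p \<in> apaths Q I"
  shows "coef (cl f) p = f p"
  using coef_carrier[OF cl_carrier[OF f]] cl_eq_iff[OF f, of "coef (cl f)"] p by simp

lemma coef_add:
  "\<lbrakk>X \<in> carrier A; Y \<in> carrier A; p \<in> apaths Q I\<rbrakk> \<Longrightarrow> coef (X \<oplus>\<^bsub>A\<^esub> Y) p = coef X p + coef Y p"
  by (auto simp: A_carrier cl_add coef_cl add_carrier)

lemma coef_smult: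
  "\<lbrakk>X \<in> carrier A; p \<in> apaths Q I\<rbrakk> \<Longrightarrow> coef (c \<odot>\<^bsub>A\<^esub> X) p = c * coef X p"
  by (auto simp: A_carrier cl_smult coef_cl smult_carrier)

lemma A_closed:
  "\<lbrakk>X \<in> carrier A; Y \<in> carrier A\<rbrakk> \<Longrightarrow> X \<oplus>\<^bsub>A\<^esub> Y \<in> carrier A"
  "X \<in> carrier A \<Longrightarrow> c \<odot>\<^bsub>A\<^esub> X \<in> carrier A"
  "\<lbrakk>X \<in> carrier A; Y \<in> carrier A\<rbrakk> \<Longrightarrow> X \<otimes>\<^bsub>A\<^esub> Y \<in> carrier A"
  by (auto simp: A_carrier cl_add cl_smult cl_mult intro!: add_carrier smult_carrier conv_carrier bexI)

lemma abelian_monoid_A: "abelian_monoid A"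
proof (rule abelian_monoidI)
  show "\<zero>\<^bsub>A\<^esub> \<in> carrier A"
    by (simp add: cl_zero cl_carrier zero_carrier)
qed (auto simp: A_closed, auto simp: A_carrier cl_zero cl_add zero_carrier add_carrier ac_simps)

lemma apaths_in_paths: "p \<in> apaths Q I \<Longrightarrow> p \<in> paths Q"
  by (simp add: apaths_def)

lemma cls_carrier: "p \<in> apaths Q I \<Longrightarrow> cls Q I p \<in> carrier A"
  by (simp add: cls_eq cl_carrier single_carrier apaths_in_paths)

text \<open>
  The finitely many generators involve finitely many paths, and a path outside all of them would have
  coordinate zero in every combination of the generators.
\<close>

lemma finite_apaths:
  assumes "fin_dim A"
  shows "finite (apaths Q I)"
proof -
  obtain B where B: "B \<subseteq> carrier A" "finite B"
    and gen: "\<And>x. x \<in> carrier A \<Longrightarrow> \<exists>c. x = (\<Oplus>\<^bsub>A\<^esub>b\<in>B. c b \<odot>\<^bsub>A\<^esub> b)"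
    using assms unfolding fin_dim_def by blast
  interpret abelian_monoid A
    by (rule abelian_monoid_A)
  have zero_sum: "finsum A g S \<in> carrier A \<and> coef (finsum A g S) p = 0"
    if "finite S" "\<And>b. b \<in> S \<Longrightarrow> g b \<in> carrier A \<and> coef (g b) p = 0" "p \<in> apaths Q I" for g p
      and S :: "(('v, 'a) qpath \<Rightarrow> 'k) set set"
    using that
  proof (induction S rule: finite_induct)
    case empty
    then show ?case
      by (simp add: cl_zero coef_cl zero_carrier cl_carrier)
  next
    case (insert b S)
    then have "finsum A g (insert b S) = g b \<oplus>\<^bsub>A\<^esub> finsum A g S"
      by (intro finsum_insert) auto
    then show ?case
      using insert by (simp add: A_closed coef_add)
  qed
  have "apaths Q I \<subseteq> (\<Union>b\<in>B. {p. coef b p \<noteq> 0})"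
  proof
    fix p
    assume p: "p \<in> apaths Q I"
    show "p \<in> (\<Union>b\<in>B. {p. coef b p \<noteq> 0})"
    proof (rule ccontr)
      assume np: "p \<notin> (\<Union>b\<in>B. {p. coef b p \<noteq> 0})"
      obtain c where c: "cls Q I p = (\<Oplus>\<^bsub>A\<^esub>b\<in>B. c b \<odot>\<^bsub>A\<^esub> b)"
        using gen[OF cls_carrier[OF p]] by blast
      have "c b \<odot>\<^bsub>A\<^esub> b \<in> carrier A \<and> coef (c b \<odot>\<^bsub>A\<^esub> b) p = 0" if "b \<in> B" for b
      proof -
        have "b \<in> carrier A" "coef b p = 0"
          using that B(1) np by auto
        then show ?thesis
          using p by (simp add: A_closed coef_smult)
      qed
      then have "coef (cls Q I p) p = 0"
        unfolding c using zero_sum[OF B(2) _ p, of "\<lambda>b. c b \<odot>\<^bsub>A\<^esub> b"] by simp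
      then show False
        using p by (simp add: cls_eq coef_cl single_carrier apaths_in_paths) (simp add: single_def)
    qed
  qed
  moreover have "finite (\<Union>b\<in>B. {p. coef b p \<noteq> 0})"
    using B coef_carrier by (intro finite_UN_I) (auto simp: carrier_path_algebra)
  ultimately show ?thesis
    by (rule finite_subset)
qed

lemma linear_expansion:
  assumes "vector_space scale" and fin: "finite (apaths Q I)"
    and add: "\<And>X Y. \<lbrakk>X \<in> carrier A; Y \<in> carrier A\<rbrakk> \<Longrightarrow> g (X \<oplus>\<^bsub>A\<^esub> Y) = g X + g Y"
    and smult: "\<And>c X. X \<in> carrier A \<Longrightarrow> g (c \<odot>\<^bsub>A\<^esub> X) = scale c (g X)"
    and f: "f \<in> carrier PA"
  shows "g (cl f) = (\<Sum>p\<in>apaths Q I. scale (f p) (g (cls Q I p)))"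
proof -
  interpret vector_space scale
    by fact
  have part: "(\<lambda>q. if q \<in> S then f q else 0) \<in> carrier PA \<and>
      g (cl (\<lambda>q. if q \<in> S then f q else 0)) = (\<Sum>p\<in>S. scale (f p) (g (cls Q I p)))"
    if "finite S" "S \<subseteq> apaths Q I" for S
    using that
  proof (induction S rule: finite_induct)
    case empty
    have "0 \<odot>\<^bsub>A\<^esub> \<zero>\<^bsub>A\<^esub> = cl (\<lambda>p. 0 * 0)"
      unfolding cl_zero by (rule cl_smult[OF zero_carrier])
    then have "g (cl (\<lambda>p. 0)) = 0"
      using smult[of "\<zero>\<^bsub>A\<^esub>" 0] by (simp add: cl_zero cl_carrier zero_carrier)
    then show ?case
      by (simp add: zero_carrier)
  next
    case (insert p S)
    define h where "h = (\<lambda>q. if q \<in> S then f q else 0)"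
    have h: "h \<in> carrier PA" "g (cl h) = (\<Sum>p\<in>S. scale (f p) (g (cls Q I p)))"
      using insert by (simp_all add: h_def)
    have p: "p \<in> apaths Q I"
      using insert by simp
    then have s: "single p \<in> carrier PA"
      by (simp add: single_carrier apaths_in_paths)
    have eq: "(\<lambda>q. if q \<in> insert p S then f q else 0) = (\<lambda>q. h q + f p * single p q)"
      using insert.hyps by (auto simp: h_def single_def fun_eq_iff)
    have "cl (\<lambda>q. h q + f p * single p q) = cl h \<oplus>\<^bsub>A\<^esub> f p \<odot>\<^bsub>A\<^esub> cls Q I p"
      by (simp add: cls_eq cl_smult s cl_add h smult_carrier)
    then have "g (cl (\<lambda>q. h q + f p * single p q)) = g (cl h) + scale (f p) (g (cls Q I p))"
      by (simp add: add smult h cl_carrier cls_carrier p A_closed)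
    then show ?case
      unfolding eq using insert.hyps h s by (simp add: add_carrier smult_carrier add.commute)
  qed
  have "cl f = cl (\<lambda>q. if q \<in> apaths Q I then f q else 0)"
    using part[OF fin] cl_eq_iff[OF f] by simp
  then show ?thesis
    using part[OF fin] by simp
qed

lemma vector_space_mult: "vector_space ((*) :: 'k \<Rightarrow> 'k \<Rightarrow> 'k)"
  by unfold_locales (simp_all add: algebra_simps)

lemma dual_path_eq:
  assumes fin: "finite (apaths Q I)" and xi: "\<xi> \<in> apaths Q I"
  shows "dual_path Q I \<xi> = (\<lambda>X\<in>carrier A. coef X \<xi>)"
  unfolding dual_path_def
proof (rule the_equality)
  show "(\<lambda>X\<in>carrier A. coef X \<xi>) \<in> dual_space A \<and>
      (\<forall>\<omega>\<in>apaths Q I. (\<lambda>X\<in>carrier A. coef X \<xi>) (cls Q I \<omega>) = (if \<omega> = \<xi> then 1 else 0))"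
  proof (intro conjI ballI)
    show "(\<lambda>X\<in>carrier A. coef X \<xi>) \<in> dual_space A"
      using xi by (auto simp: dual_space_def A_closed coef_add coef_smult)
    fix \<omega>
    assume w: "\<omega> \<in> apaths Q I"
    have "coef (cls Q I \<omega>) \<xi> = single \<omega> \<xi>"
      unfolding cls_eq using w xi by (intro coef_cl single_carrier apaths_in_paths)
    then show "(\<lambda>X\<in>carrier A. coef X \<xi>) (cls Q I \<omega>) = (if \<omega> = \<xi> then 1 else 0)"
      using w by (simp add: cls_carrier) (simp add: single_def)
  qed
next
  fix g
  assume g: "g \<in> dual_space A \<and> (\<forall>\<omega>\<in>apaths Q I. g (cls Q I \<omega>) = (if \<omega> = \<xi> then 1 else 0))"
  show "g = (\<lambda>X\<in>carrier A. coef X \<xi>)"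
  proof (rule extensionalityI)
    show "g \<in> extensional (carrier A)"
      using g by (simp add: dual_space_def)
    fix X
    assume "X \<in> carrier A"
    then obtain f where f: "f \<in> carrier PA" "X = cl f"
      by (auto simp: A_carrier)
    have "g X = (\<Sum>p\<in>apaths Q I. f p * g (cls Q I p))"
      unfolding f(2) using g
      by (intro linear_expansion[OF vector_space_mult fin _ _ f(1)]) (auto simp: dual_space_def)
    also have "\<dots> = f \<xi>"
      using g fin xi by (simp add: if_distrib[of "(*) _"] cong: if_cong)
    finally show "g X = (\<lambda>X\<in>carrier A. coef X \<xi>) X"
      using f xi by (simp add: cl_carrier coef_cl)
  qed simp
qed

text \<open>
  The value of \<open>\<theta>\<xi>\<^sup>\<bullet>\<close> at \<open>x\<close> is the coordinate of \<open>x\<theta>\<close> at \<open>\<xi>\<close>, which is nonzero only if \<open>\<xi>\<close> ends with \<open>\<theta>\<close>.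
\<close>

lemma dual_lact_eq_zero:
  assumes fin: "finite (apaths Q I)" and xi: "\<xi> \<in> apaths Q I" and th: "\<theta> \<in> apaths Q I"
    and ne: "\<And>i. drop i (snd \<xi>) \<noteq> snd \<theta>"
  shows "dual_lact A (cls Q I \<theta>) (dual_path Q I \<xi>) = dual_zero A"
proof -
  obtain u xs where x: "\<xi> = (u, xs)"
    by (cases \<xi>)
  have "dual_path Q I \<xi> (X \<otimes>\<^bsub>A\<^esub> cls Q I \<theta>) = 0" if X: "X \<in> carrier A" for X
  proof -
    obtain f where f: "f \<in> carrier PA" "X = cl f"
      using X by (auto simp: A_carrier)
    have s: "single \<theta> \<in> carrier PA"
      using th by (simp add: single_carrier apaths_in_paths)
    have "conv Q f (single \<theta>) \<xi> = 0"
      unfolding x conv_eq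
    proof (rule sum.neutral, rule ballI)
      fix i
      have "(endv Q u (take i xs), drop i xs) \<noteq> \<theta>"
        using ne[of i] x by auto
      then show "f (u, take i xs) * single \<theta> (endv Q u (take i xs), drop i xs) = 0"
        by (simp add: single_def)
    qed
    then show ?thesis
      using f s xi by (simp add: dual_path_eq[OF fin xi] cls_eq cl_mult cl_carrier conv_carrier coef_cl)
  qed
  then show ?thesis
    by (auto simp: dual_lact_def dual_zero_def)
qed

lemma dual_ract_eq_zero:
  assumes fin: "finite (apaths Q I)" and xi: "\<xi> \<in> apaths Q I" and th: "\<theta> \<in> apaths Q I"
    and ne: "\<And>i. take i (snd \<xi>) \<noteq> snd \<theta>"
  shows "dual_ract A (dual_path Q I \<xi>) (cls Q I \<theta>) = dual_zero A"
proof -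
  obtain u xs where x: "\<xi> = (u, xs)"
    by (cases \<xi>)
  have "dual_path Q I \<xi> (cls Q I \<theta> \<otimes>\<^bsub>A\<^esub> X) = 0" if X: "X \<in> carrier A" for X
  proof -
    obtain f where f: "f \<in> carrier PA" "X = cl f"
      using X by (auto simp: A_carrier)
    have s: "single \<theta> \<in> carrier PA"
      using th by (simp add: single_carrier apaths_in_paths)
    have "conv Q (single \<theta>) f \<xi> = 0"
      unfolding x conv_eq
    proof (rule sum.neutral, rule ballI)
      fix i
      have "(u, take i xs) \<noteq> \<theta>"
        using ne[of i] x by auto
      then show "single \<theta> (u, take i xs) * f (endv Q u (take i xs), drop i xs) = 0"
        by (simp add: single_def)
    qed
    then show ?thesis
      using f s xi by (simp add: dual_path_eq[OF fin xi] cls_eq cl_mult cl_carrier conv_carrier coef_cl)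
  qed
  then show ?thesis
    by (auto simp: dual_ract_def dual_zero_def)
qed

lemma dual_ract_self:
  assumes fin: "finite (apaths Q I)" and xi: "(u, xs) \<in> apaths Q I"
  shows "dual_ract A (dual_path Q I (u, xs)) (cls Q I (u, xs)) = dual_path Q I (endv Q u xs, [])"
proof -
  have e: "(endv Q u xs, []) \<in> apaths Q I"
    using xi endv_in[OF apaths_in_paths[OF xi]] by (simp add: apaths_iff)
  have "dual_path Q I (u, xs) (cls Q I (u, xs) \<otimes>\<^bsub>A\<^esub> X) = coef X (endv Q u xs, [])"
    if X: "X \<in> carrier A" for X
  proof -
    obtain f where f: "f \<in> carrier PA" "X = cl f"
      using X by (auto simp: A_carrier)
    have s: "single (u, xs) \<in> carrier PA"
      using xi by (simp add: single_carrier apaths_in_paths)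
    have "conv Q (single (u, xs)) f (u, xs) =
        (\<Sum>i\<le>length xs. if i = length xs then f (endv Q u xs, []) else 0)"
      unfolding conv_eq by (rule sum.cong) (auto simp: single_def)
    then have "conv Q (single (u, xs)) f (u, xs) = f (endv Q u xs, [])"
      by simp
    then show ?thesis
      using f s xi e
      by (simp add: dual_path_eq[OF fin xi] cls_eq cl_mult cl_carrier conv_carrier coef_cl)
  qed
  then show ?thesis
    unfolding dual_path_eq[OF fin e] by (auto simp: dual_ract_def)
qed

end

section \<open>The short exact sequence\<close>

text \<open>
  Suppose \<open>x V x = 0\<close> with \<open>x \<noteq> 0\<close>. Some component \<open>c\<close> of \<open>1\<close> in a simple summand \<open>L\<close> has \<open>x c \<noteq> 0\<close>, so
  \<open>V x c = L\<close> by simplicity. Then \<open>c = v x c\<close> for some \<open>v\<close>, and \<open>x c = x v x c = 0\<close>.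
\<close>

lemma semisimple_ring_semiprime:
  fixes x :: "'w::ring_1"
  assumes ss: "semisimple_ring TYPE('w)" and x: "x \<noteq> 0"
  shows "\<exists>y. x * y * x \<noteq> 0"
proof (rule ccontr)
  assume "\<not> (\<exists>y. x * y * x \<noteq> 0)"
  then have nil: "x * y * x = 0" for y
    by blast
  obtain n and L :: "nat \<Rightarrow> 'w set" where simple: "\<And>i. i < n \<Longrightarrow> simple_left_ideal (L i)"
    and dec: "\<And>v. \<exists>!x. x \<in> (\<Pi>\<^sub>E i\<in>{..<n}. L i) \<and> v = (\<Sum>i<n. x i)"
    using ss unfolding semisimple_ring_def by blast
  obtain c where c: "c \<in> (\<Pi>\<^sub>E i\<in>{..<n}. L i)" "1 = (\<Sum>i<n. c i)"
    using dec[of 1] by blast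
  have "x = (\<Sum>i<n. x * c i)"
    using c(2) by (simp flip: sum_distrib_left)
  then obtain i where i: "i < n" "x * c i \<noteq> 0"
    using x by (metis (no_types, lifting) lessThan_iff sum.neutral)
  have ci: "c i \<in> L i"
    using c(1) i(1) by auto
  have L: "left_ideal (L i)" and min: "\<And>N. left_ideal N \<Longrightarrow> N \<subseteq> L i \<Longrightarrow> N = {0} \<or> N = L i"
    using simple[OF i(1)] by (auto simp: simple_left_ideal_def)
  define N where "N = range (\<lambda>v. v * x * c i)"
  have "left_ideal N"
    unfolding left_ideal_def
  proof (intro conjI ballI allI)
    show "0 \<in> N"
      by (auto simp: N_def intro: image_eqI[of _ _ 0])
  next
    fix a b
    assume "a \<in> N" "b \<in> N"
    then obtain v v' where "a = v * x * c i" "b = v' * x * c i"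
      by (auto simp: N_def)
    then have "a + b = (v + v') * x * c i"
      by (simp add: distrib_right)
    then show "a + b \<in> N"
      by (auto simp: N_def)
  next
    fix r a
    assume "a \<in> N"
    then obtain v where "a = v * x * c i"
      by (auto simp: N_def)
    then have "r * a = (r * v) * x * c i"
      by (simp add: mult.assoc)
    then show "r * a \<in> N"
      by (auto simp: N_def)
  qed
  moreover have "N \<subseteq> L i"
    using L ci by (auto simp: N_def left_ideal_def)
  moreover have "1 * x * c i \<in> N"
    unfolding N_def by (rule rangeI)
  then have "N \<noteq> {0}"
    using i(2) by auto
  ultimately have "N = L i"
    using min by blast
  then obtain v where "c i = v * x * c i"
    using ci by (auto simp: N_def)
  then have "x * c i = x * v * x * c i"
    by (metis mult.assoc)
  then show False
    using nil[of v] i(2) by simp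
qed

locale dual_sequence = bound_quiver Q I R
  for Q :: "('v, 'a) pre_digraph" and I :: "(('v, 'a) qpath \<Rightarrow> 'k::field) set"
    and R :: "('v, 'a) qpath set" +
  fixes scaleV :: "'k \<Rightarrow> 'w::ring_1 \<Rightarrow> 'w"
    and scaleE :: "'k \<Rightarrow> 'e::ab_group_add \<Rightarrow> 'e"
    and lact :: "(('v, 'a) qpath \<Rightarrow> 'k) set \<Rightarrow> 'e \<Rightarrow> 'e"
    and ract :: "'e \<Rightarrow> (('v, 'a) qpath \<Rightarrow> 'k) set \<Rightarrow> 'e"
    and \<eta> :: "(('v, 'a) qpath \<Rightarrow> 'k) set \<Rightarrow> 'w"
    and \<pi> :: "'w \<Rightarrow> 'e"
  assumes connected: "Digraph_Component.connected Q"
    and arrows: "arcs Q \<noteq> {}"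
    and gentle: "gentle Q I"
    and no_parallel_arrow: "\<forall>\<rho> \<in> max_paths Q I. \<not> (\<exists>\<alpha> \<in> arcs Q.
          tail Q \<alpha> = psource \<rho> \<and> head Q \<alpha> = ptarget Q \<rho> \<and> (tail Q \<alpha>, [\<alpha>]) \<noteq> \<rho>)"
    and V_algebra: "k_algebra scaleV"
    and E_bimodule: "bimodule (quiver_algebra Q I) scaleE lact ract"
    and exact: "short_exact (quiver_algebra Q I) scaleV scaleE lact ract \<eta> \<pi>"
    and V_semisimple: "semisimple_ring TYPE('w)"
    and E_dual: "almost_standard_dual Q I scaleE lact ract"
begin

lemma fin_apaths: "finite (apaths Q I)"
  using finite_apaths gentle by (simp add: gentle_def)

text \<open>
  A vertex is joined to the source of some arrow by a walk in the underlying graph. The first step of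
  this walk, or that arrow itself, is incident with the vertex.
\<close>

lemma vertex_incident:
  assumes a: "a \<in> verts Q"
  shows "\<exists>\<alpha> \<in> arcs Q. tail Q \<alpha> = a \<or> head Q \<alpha> = a"
proof -
  obtain \<beta> where b: "\<beta> \<in> arcs Q"
    using arrows by blast
  have "a \<rightarrow>\<^sup>*\<^bsub>with_proj (mk_symmetric Q)\<^esub> tail Q \<beta>"
    using connected a b by (auto simp: connected_def strongly_connected_def)
  then have "(a, tail Q \<beta>) \<in> rtrancl_on (verts Q) (parcs (mk_symmetric Q))"
    by (simp add: reachable_def)
  then show ?thesis
  proof (cases rule: converse_rtrancl_on_cases)
    case base
    then show ?thesis
      using b by auto
  next
    case (step y)
    then show ?thesis
      by (auto simp: parcs_mk_symmetric)
  qed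
qed

lemma gentle_quiver_flow: "gentle_quiver Q flow"
proof unfold_locales
  fix \<alpha> \<beta> \<beta>'
  show "flow \<alpha> \<beta> \<Longrightarrow> \<alpha> \<in> arcs Q \<and> \<beta> \<in> arcs Q \<and> head Q \<alpha> = tail Q \<beta>"
    by (simp add: flow_def)
  have lg: "\<alpha> \<in> arcs Q \<Longrightarrow> (\<exists>\<^sub>\<le>\<^sub>1 \<beta>. \<beta> \<in> arcs Q \<and> head Q \<beta> = tail Q \<alpha> \<and> \<not> in_ideal Q I \<beta> \<alpha>)"
    "\<alpha> \<in> arcs Q \<Longrightarrow> (\<exists>\<^sub>\<le>\<^sub>1 \<beta>. \<beta> \<in> arcs Q \<and> tail Q \<beta> = head Q \<alpha> \<and> \<not> in_ideal Q I \<alpha> \<beta>)"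
    using gentle by (simp_all add: gentle_def locally_gentle_def)
  show "\<beta> = \<beta>'" if "flow \<alpha> \<beta>" "flow \<alpha> \<beta>'"
    using that by (intro Uniq_D[OF lg(2)]) (simp_all add: flow_def)
  show "\<beta> = \<beta>'" if "flow \<beta> \<alpha>" "flow \<beta>' \<alpha>"
    using that by (intro Uniq_D[OF lg(1)]) (simp_all add: flow_def)
next
  have "{xs. set xs \<subseteq> arcs Q \<and> successively flow xs} \<subseteq> insert [] (snd ` apaths Q I)"
  proof
    fix xs
    assume xs: "xs \<in> {xs. set xs \<subseteq> arcs Q \<and> successively flow xs}"
    show "xs \<in> insert [] (snd ` apaths Q I)"
    proof (cases "xs = []")
      case False
      then have "hd xs \<in> arcs Q"
        using xs by auto
      then have "(tail Q (hd xs), xs) \<in> apaths Q I"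
        using xs by (simp add: apaths_iff)
      then show ?thesis
        by force
    qed simp
  qed
  then show "finite {xs. set xs \<subseteq> arcs Q \<and> successively flow xs}"
    using fin_apaths finite_subset by blast
next
  fix a
  assume "a \<in> verts Q"
  then show "\<exists>\<alpha>\<in>arcs Q. tail Q \<alpha> = a \<or> head Q \<alpha> = a"
    by (rule vertex_incident)
qed

end

sublocale dual_sequence \<subseteq> gentle_quiver Q flow
  by (rule gentle_quiver_flow)

context dual_sequence
begin

lemma nonzero_paths_eq: "nonzero_paths = apaths Q I"
proof (rule Set.set_eqI)
  fix p :: "('v, 'a) qpath"
  obtain u xs where p: "p = (u, xs)"
    by (cases p)
  show "p \<in> nonzero_paths \<longleftrightarrow> p \<in> apaths Q I"
    using thread_src_in[of xs] by (auto simp: p nonzero_paths_def apaths_iff thread_def src_def)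
qed

lemma max_paths_eq: "max_paths Q I = (\<lambda>xs. (src xs, xs)) ` {xs. maximal xs}"
proof (rule Set.set_eqI)
  fix p :: "('v, 'a) qpath"
  obtain u xs where p: "p = (u, xs)"
    by (cases p)
  show "p \<in> max_paths Q I \<longleftrightarrow> p \<in> (\<lambda>xs. (src xs, xs)) ` {xs. maximal xs}"
  proof (cases "xs \<noteq> [] \<and> thread xs \<and> u = src xs")
    case True
    then have xs: "xs \<noteq> []" "thread xs" "u = src xs"
      by simp_all
    have ap: "p \<in> apaths Q I"
      using xs thread_src_in by (simp add: p apaths_iff thread_def src_def)
    have left: "head Q \<alpha> = psource p \<and> (tail Q \<alpha>, \<alpha> # snd p) \<in> apaths Q I \<longleftrightarrow> thread (\<alpha> # xs)"
      if "\<alpha> \<in> arcs Q" for \<alpha>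
      using that xs flowD[of \<alpha> "hd xs"]
      by (auto simp: p apaths_iff psource_def thread_def successively_Cons src_def)
    have right: "tail Q \<alpha> = ptarget Q p \<and> (psource p, snd p @ [\<alpha>]) \<in> apaths Q I \<longleftrightarrow> thread (xs @ [\<alpha>])"
      if "\<alpha> \<in> arcs Q" for \<alpha>
      using that xs flowD[of "last xs" \<alpha>] thread_src_in[of xs]
      by (auto simp: p apaths_iff psource_def ptarget_eq endv_def thread_def successively_append_iff src_def)
    show ?thesis
      using xs ap left right by (auto simp: max_paths_def maximal_def plength_def p)
  next
    case False
    then show ?thesis
      by (auto simp: max_paths_def maximal_def plength_def p apaths_iff thread_def src_def)
  qed
qed

lemma triv_vertices_eq: "triv_vertices Q I = {a. solitary a}"
proof -
  have 1: "in_degree Q a \<le> 1 \<longleftrightarrow>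
      (\<forall>\<beta> \<in> arcs Q. \<forall>\<beta>' \<in> arcs Q. head Q \<beta> = a \<and> head Q \<beta>' = a \<longrightarrow> \<beta> = \<beta>')" for a
    unfolding in_degree_def One_nat_def using card_le_Suc0_iff_eq[OF finite_in_arcs]
    by (auto simp: in_arcs_def)
  have 2: "out_degree Q a \<le> 1 \<longleftrightarrow>
      (\<forall>\<gamma> \<in> arcs Q. \<forall>\<gamma>' \<in> arcs Q. tail Q \<gamma> = a \<and> tail Q \<gamma>' = a \<longrightarrow> \<gamma> = \<gamma>')" for a
    unfolding out_degree_def One_nat_def using card_le_Suc0_iff_eq[OF finite_out_arcs]
    by (auto simp: out_arcs_def)
  have 3: "(\<forall>\<beta> \<in> arcs Q. \<forall>\<gamma> \<in> arcs Q. head Q \<beta> = a \<and> tail Q \<gamma> = a \<longrightarrow> \<not> in_ideal Q I \<beta> \<gamma>) \<longleftrightarrow>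
      (\<forall>\<beta> \<in> arcs Q. \<forall>\<gamma> \<in> arcs Q. head Q \<beta> = a \<and> tail Q \<gamma> = a \<longrightarrow> flow \<beta> \<gamma>)" for a
    by (auto simp: flow_def)
  show ?thesis
    unfolding triv_vertices_def solitary_def 1 2 3 by blast
qed

definition ep :: "'v \<Rightarrow> 'w" where
  "ep a = \<eta> (cls Q I (a, []))"

definition arr :: "'a \<Rightarrow> 'w" where
  "arr \<alpha> = \<eta> (cls Q I (tail Q \<alpha>, [\<alpha>]))"

lemma eta_add: "\<lbrakk>X \<in> carrier A; Y \<in> carrier A\<rbrakk> \<Longrightarrow> \<eta> (X \<oplus>\<^bsub>A\<^esub> Y) = \<eta> X + \<eta> Y"
  and eta_smult: "X \<in> carrier A \<Longrightarrow> \<eta> (c \<odot>\<^bsub>A\<^esub> X) = scaleV c (\<eta> X)"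
  and eta_mult: "\<lbrakk>X \<in> carrier A; Y \<in> carrier A\<rbrakk> \<Longrightarrow> \<eta> (X \<otimes>\<^bsub>A\<^esub> Y) = \<eta> X * \<eta> Y"
  and pi_linear: "Vector_Spaces.linear scaleV scaleE \<pi>"
  and pi_left: "X \<in> carrier A \<Longrightarrow> \<pi> (\<eta> X * v) = lact X (\<pi> v)"
  and pi_right: "X \<in> carrier A \<Longrightarrow> \<pi> (v * \<eta> X) = ract (\<pi> v) X"
  and eta_inj: "inj_on \<eta> (carrier A)"
  and eta_range: "\<eta> ` carrier A = {v. \<pi> v = 0}"
  and pi_surj: "surj \<pi>"
  using exact by (simp_all add: short_exact_def)

interpretation V: k_algebra scaleV
  by (rule V_algebra)

lemma eta_cl: "f \<in> carrier PA \<Longrightarrow> \<eta> (cl f) = (\<Sum>p\<in>apaths Q I. scaleV (f p) (\<eta> (cls Q I p)))"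
  by (rule linear_expansion[OF V.vector_space_axioms fin_apaths])
    (simp_all add: eta_add eta_smult)

lemma eta_cl_zero: "\<eta> (cl (\<lambda>p. 0)) = 0"
  using eta_cl[OF zero_carrier] by simp

lemma eta_cls_mult:
  assumes p: "(u, xs) \<in> apaths Q I" and q: "(v, ys) \<in> apaths Q I"
  shows "\<eta> (cls Q I (u, xs)) * \<eta> (cls Q I (v, ys)) =
    (if v = endv Q u xs \<and> (u, xs @ ys) \<in> apaths Q I then \<eta> (cls Q I (u, xs @ ys)) else 0)"
proof -
  have s: "single (u, xs) \<in> carrier PA" "single (v, ys) \<in> carrier PA"
    using p q by (simp_all add: single_carrier apaths_in_paths)
  have "\<eta> (cls Q I (u, xs)) * \<eta> (cls Q I (v, ys)) = \<eta> (cl (conv Q (single (u, xs)) (single (v, ys))))"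
    using s by (simp add: cls_eq cl_mult cl_carrier flip: eta_mult)
  also have "\<dots> = (if v = endv Q u xs \<and> (u, xs @ ys) \<in> apaths Q I then \<eta> (cls Q I (u, xs @ ys)) else 0)"
  proof (cases "v = endv Q u xs")
    case True
    then have path: "(u, xs @ ys) \<in> paths Q"
      using p q by (simp add: paths_append apaths_in_paths)
    have "cl (single (u, xs @ ys)) = cl (\<lambda>p. 0)" if "(u, xs @ ys) \<notin> apaths Q I"
      using that single_carrier[OF path]
      by (subst cl_eq_iff) (auto simp: zero_carrier single_def)
    then show ?thesis
      using True by (auto simp: conv_single_single cls_eq eta_cl_zero)
  next
    case False
    then show ?thesis
      by (simp add: conv_single_single eta_cl_zero)
  qed
  finally show ?thesis .
qed

lemma trivial_in_apaths: "(a, []) \<in> apaths Q I \<longleftrightarrow> a \<in> verts Q"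
  by (simp add: apaths_iff)

lemma arrow_in_apaths: "\<alpha> \<in> arcs Q \<Longrightarrow> (tail Q \<alpha>, [\<alpha>]) \<in> apaths Q I"
  by (simp add: apaths_iff)

lemma eta_cls:
  assumes "p \<in> apaths Q I"
  shows "\<eta> (cls Q I p) = (if snd p = [] then ep (fst p) else prod_list (map arr (snd p)))"
proof -
  have "\<eta> (cls Q I (src xs, xs)) = prod_list (map arr xs)" if "thread xs" "xs \<noteq> []" for xs
    using that
  proof (induction xs)
    case (Cons x xs)
    have x: "x \<in> arcs Q"
      using Cons.prems by (simp add: thread_Cons)
    show ?case
    proof (cases "xs = []")
      case True
      then show ?thesis
        by (simp add: arr_def)
    next
      case False
      then have t: "thread xs" "flow x (hd xs)"
        using Cons.prems by (simp_all add: thread_Cons)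
      have "(src xs, xs) \<in> apaths Q I" "(tail Q x, x # xs) \<in> apaths Q I"
        using Cons.prems t False thread_src_in[OF t(1) False] thread_src_in[OF Cons.prems]
        by (simp_all add: nonzero_paths_def src_def flip: nonzero_paths_eq)
      then have "arr x * \<eta> (cls Q I (src xs, xs)) = \<eta> (cls Q I (tail Q x, x # xs))"
        unfolding arr_def using arrow_in_apaths[OF x] flowD[OF t(2)]
        by (subst eta_cls_mult) (auto simp: endv_def src_def)
      then show ?thesis
        using Cons.IH t False by simp
    qed
  qed simp
  then show ?thesis
    using assms unfolding nonzero_paths_eq[symmetric] by (cases p) (auto simp: ep_def nonzero_paths_def split: if_splits)
qed

lemma gentle_subalgebra_V: "gentle_subalgebra Q flow scaleV ep arr"
proof unfold_locales
  fix a b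
  assume "a \<in> verts Q" "b \<in> verts Q"
  then show "ep a * ep b = (if a = b then ep a else 0)"
    unfolding ep_def by (subst eta_cls_mult) (auto simp: trivial_in_apaths)
next
  fix \<alpha>
  assume a: "\<alpha> \<in> arcs Q"
  then show "ep (tail Q \<alpha>) * arr \<alpha> = arr \<alpha>" "arr \<alpha> * ep (head Q \<alpha>) = arr \<alpha>"
    unfolding ep_def arr_def
    by (subst eta_cls_mult; auto simp: trivial_in_apaths arrow_in_apaths endv_def)+
next
  fix \<alpha> \<beta>
  assume "\<alpha> \<in> arcs Q" "\<beta> \<in> arcs Q" "\<not> flow \<alpha> \<beta>"
  then show "arr \<alpha> * arr \<beta> = 0"
    unfolding arr_def by (subst eta_cls_mult) (auto simp: arrow_in_apaths apaths_iff)
next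
  fix c :: "('v, 'a) qpath \<Rightarrow> 'k" and p
  assume z: "(\<Sum>p\<in>nonzero_paths. scaleV (c p) (if snd p = [] then ep (fst p) else prod_list (map arr (snd p)))) = 0"
    and p: "p \<in> nonzero_paths"
  define f where "f = (\<lambda>q. if q \<in> apaths Q I then c q else 0)"
  have "finite {q. f q \<noteq> 0}"
    by (rule finite_subset[OF _ fin_apaths]) (auto simp: f_def)
  then have f: "f \<in> carrier PA"
    by (auto simp: carrier_path_algebra f_def apaths_in_paths)
  have "\<eta> (cl f) = (\<Sum>p\<in>apaths Q I. scaleV (c p) (if snd p = [] then ep (fst p) else prod_list (map arr (snd p))))"
    unfolding eta_cl[OF f] by (rule sum.cong) (simp_all add: f_def eta_cls)
  also have "\<dots> = \<eta> (cl (\<lambda>p. 0))"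
    using z by (simp add: nonzero_paths_eq eta_cl_zero)
  finally have "cl f = cl (\<lambda>p. 0)"
    using eta_inj f zero_carrier by (auto simp: inj_on_def cl_carrier)
  then show "c p = 0"
    using cl_eq_iff[OF f zero_carrier] p by (auto simp: nonzero_paths_eq f_def)
qed

end

sublocale dual_sequence \<subseteq> gentle_subalgebra Q flow scaleV ep arr
  by (rule gentle_subalgebra_V)

context dual_sequence
begin

interpretation B: bimodule A scaleE lact ract
  by (rule E_bimodule)

text \<open>
  The consequences for \<open>E\<close> of the comparison with \<open>DA\<close> on which the proof rests: products which vanish, and
  \<open>\<rho>\<^sup>\<dagger>\<rho>\<close> for paths \<open>\<rho>\<close> of positive length.
\<close>

definition dagger_basis :: "(('v, 'a) qpath \<Rightarrow> 'e) \<Rightarrow> bool" where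
  "dagger_basis b \<longleftrightarrow> \<not> module.dependent scaleE (b ` apaths Q I) \<and>
     module.span scaleE (b ` apaths Q I) = UNIV \<and>
     (\<forall>(u, xs)\<in>apaths Q I. lact (cls Q I (endv Q u xs, [])) (b (u, xs)) = b (u, xs) \<and>
        ract (b (u, xs)) (cls Q I (u, [])) = b (u, xs)) \<and>
     (\<forall>\<theta>\<in>apaths Q I. \<forall>\<xi>\<in>apaths Q I. snd \<theta> \<noteq> [] \<longrightarrow>
        ((\<forall>i. drop i (snd \<xi>) \<noteq> snd \<theta>) \<longrightarrow> lact (cls Q I \<theta>) (b \<xi>) = 0) \<and>
        ((\<forall>i. take i (snd \<xi>) \<noteq> snd \<theta>) \<longrightarrow> ract (b \<xi>) (cls Q I \<theta>) = 0)) \<and>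
     (\<forall>(u, xs)\<in>apaths Q I. xs \<noteq> [] \<longrightarrow>
        (\<exists>C. ract (b (u, xs)) (cls Q I (u, xs)) = scaleE C (b (endv Q u xs, []))))"

lemma cls_idem:
  assumes "a \<in> verts Q"
  shows "cls Q I (a, []) \<otimes>\<^bsub>A\<^esub> cls Q I (a, []) = cls Q I (a, [])"
proof -
  have "single (a, []) \<in> carrier PA"
    using assms by (simp add: single_carrier paths_iff)
  then show ?thesis
    by (simp add: cls_eq cl_mult conv_single_single)
qed

lemma ex_dagger_basis: "\<exists>b. dagger_basis b"
proof -
  let ?P = "apaths Q I"
  obtain b where basis: "\<not> module.dependent scaleE (b ` ?P)" "module.span scaleE (b ` ?P) = UNIV"
    and ends: "\<forall>\<xi> \<in> ?P. \<exists>m. b \<xi> = ract (lact (cls Q I (ptarget Q \<xi>, [])) m) (cls Q I (psource \<xi>, []))"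
    and act: "\<forall>\<theta> \<in> ?P. \<forall>\<xi> \<in> ?P. plength \<theta> > 0 \<longrightarrow>
      (lact (cls Q I \<theta>) (b \<xi>) = 0 \<longleftrightarrow> dual_lact A (cls Q I \<theta>) (dual_path Q I \<xi>) = dual_zero A) \<and>
      (ract (b \<xi>) (cls Q I \<theta>) = 0 \<longleftrightarrow> dual_ract A (dual_path Q I \<xi>) (cls Q I \<theta>) = dual_zero A) \<and>
      (plength \<theta> = plength \<xi> \<longrightarrow> (\<forall>a \<in> verts Q.
        (\<exists>C. C \<noteq> 0 \<and> ract (b \<xi>) (cls Q I \<theta>) = scaleE C (b (a, []))) \<longleftrightarrow>
        dual_ract A (dual_path Q I \<xi>) (cls Q I \<theta>) = dual_path Q I (a, [])))"
    using E_dual unfolding almost_standard_dual_def Let_def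
    by (elim conjE exE) (rule that, assumption, assumption, assumption, intro ballI impI,
      drule bspec, assumption, drule bspec, assumption, drule mp, assumption, elim conjE,
      intro conjI; assumption)
  have "dagger_basis b"
    unfolding dagger_basis_def
  proof (intro conjI ballI impI; (elim case_prodE)?)
    show "\<not> module.dependent scaleE (b ` ?P)" "module.span scaleE (b ` ?P) = UNIV"
      by (rule basis)+
  next
    fix p
    assume p: "p \<in> ?P"
    obtain u xs where px: "p = (u, xs)"
      by (cases p)
    have v: "endv Q u xs \<in> verts Q" "u \<in> verts Q"
      using p endv_in apaths_in_paths by (auto simp: px paths_iff)
    then have c: "cls Q I (endv Q u xs, []) \<in> carrier A" "cls Q I (u, []) \<in> carrier A"
      by (simp_all add: cls_carrier trivial_in_apaths)
    obtain m where m: "b p = ract (lact (cls Q I (endv Q u xs, [])) m) (cls Q I (u, []))"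
      using ends p by (auto simp: px ptarget_eq psource_def)
    have "lact (cls Q I (endv Q u xs, [])) (b p) = b p"
      unfolding m B.lact_ract[OF c, symmetric]
      using c cls_idem[OF v(1)] by (simp add: B.lact_ract flip: B.lact_mult)
    moreover have "ract (b p) (cls Q I (u, [])) = b p"
      unfolding m using c cls_idem[OF v(2)] by (simp flip: B.ract_mult)
    ultimately show "case p of (u, xs) \<Rightarrow> lact (cls Q I (endv Q u xs, [])) (b (u, xs)) = b (u, xs) \<and>
        ract (b (u, xs)) (cls Q I (u, [])) = b (u, xs)"
      by (simp add: px)
    show "case p of (u, xs) \<Rightarrow> xs \<noteq> [] \<longrightarrow>
        (\<exists>C. ract (b (u, xs)) (cls Q I (u, xs)) = scaleE C (b (endv Q u xs, [])))"
      using act[rule_format, OF p p] dual_ract_self[OF fin_apaths, of u xs] p v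
      by (auto simp: px plength_def)
  next
    fix \<theta> \<xi>
    assume t: "\<theta> \<in> ?P" "\<xi> \<in> ?P" "snd \<theta> \<noteq> []"
    then show "\<forall>i. drop i (snd \<xi>) \<noteq> snd \<theta> \<Longrightarrow> lact (cls Q I \<theta>) (b \<xi>) = 0"
      using act[rule_format, OF t(1,2)] dual_lact_eq_zero[OF fin_apaths] by (simp add: plength_def)
    show "\<forall>i. take i (snd \<xi>) \<noteq> snd \<theta> \<Longrightarrow> ract (b \<xi>) (cls Q I \<theta>) = 0"
      using t act[rule_format, OF t(1,2)] dual_ract_eq_zero[OF fin_apaths] by (simp add: plength_def)
  qed
  then show ?thesis
    by blast
qed

definition dagger :: "('v, 'a) qpath \<Rightarrow> 'e" where
  "dagger = (SOME b. dagger_basis b)"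

lemma dagger_basis: "dagger_basis dagger"
  unfolding dagger_def by (rule someI_ex[OF ex_dagger_basis])

lemma dagger_ends:
  assumes "(u, xs) \<in> apaths Q I"
  shows "lact (cls Q I (endv Q u xs, [])) (dagger (u, xs)) = dagger (u, xs)"
    "ract (dagger (u, xs)) (cls Q I (u, [])) = dagger (u, xs)"
  using dagger_basis assms unfolding dagger_basis_def by blast+

lemma lact_dagger:
  assumes "\<theta> \<in> apaths Q I" "\<xi> \<in> apaths Q I" "snd \<theta> \<noteq> []" "\<And>i. drop i (snd \<xi>) \<noteq> snd \<theta>"
  shows "lact (cls Q I \<theta>) (dagger \<xi>) = 0"
  using dagger_basis assms unfolding dagger_basis_def by blast

lemma ract_dagger:
  assumes "\<theta> \<in> apaths Q I" "\<xi> \<in> apaths Q I" "snd \<theta> \<noteq> []" "\<And>i. take i (snd \<xi>) \<noteq> snd \<theta>"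
  shows "ract (dagger \<xi>) (cls Q I \<theta>) = 0"
  using dagger_basis assms unfolding dagger_basis_def by blast

lemma ract_dagger_self:
  assumes "(u, xs) \<in> apaths Q I" "xs \<noteq> []"
  shows "\<exists>C. ract (dagger (u, xs)) (cls Q I (u, xs)) = scaleE C (dagger (endv Q u xs, []))"
  using dagger_basis assms unfolding dagger_basis_def by blast

lemma dagger_span: "B.span (dagger ` apaths Q I) = UNIV"
  and dagger_neq_0: "\<xi> \<in> apaths Q I \<Longrightarrow> dagger \<xi> \<noteq> 0"
  using dagger_basis B.dependent_zero[of "dagger ` apaths Q I"] unfolding dagger_basis_def
  by (auto simp: image_iff)

text \<open>
  The idempotents on both sides put the lift of \<open>\<xi>\<^sup>\<dagger>\<close> in \<open>e\<^bsub>t(\<xi>)\<^esub> V e\<^bsub>s(\<xi>)\<^esub>\<close> without changing its image in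
  \<open>E\<close>.
\<close>

definition lift :: "('v, 'a) qpath \<Rightarrow> 'w" where
  "lift \<xi> = ep (endv Q (fst \<xi>) (snd \<xi>)) * (SOME v. \<pi> v = dagger \<xi>) * ep (fst \<xi>)"

lemma apaths_ends: "\<xi> \<in> apaths Q I \<Longrightarrow> fst \<xi> \<in> verts Q \<and> endv Q (fst \<xi>) (snd \<xi>) \<in> verts Q"
  using endv_in[of "fst \<xi>" "snd \<xi>"] apaths_in_paths[of \<xi>] by (cases \<xi>) (auto simp: paths_iff)

lemma pi_ep: "a \<in> verts Q \<Longrightarrow> \<pi> (ep a * v) = lact (cls Q I (a, [])) (\<pi> v)"
  "a \<in> verts Q \<Longrightarrow> \<pi> (v * ep a) = ract (\<pi> v) (cls Q I (a, []))"
  by (simp_all add: ep_def pi_left pi_right cls_carrier trivial_in_apaths)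

lemma pi_arr: "\<alpha> \<in> arcs Q \<Longrightarrow> \<pi> (arr \<alpha> * v) = lact (cls Q I (tail Q \<alpha>, [\<alpha>])) (\<pi> v)"
  "\<alpha> \<in> arcs Q \<Longrightarrow> \<pi> (v * arr \<alpha>) = ract (\<pi> v) (cls Q I (tail Q \<alpha>, [\<alpha>]))"
  by (simp_all add: arr_def pi_left pi_right cls_carrier arrow_in_apaths)

lemma pi_lift:
  assumes x: "\<xi> \<in> apaths Q I"
  shows "\<pi> (lift \<xi>) = dagger \<xi>"
proof -
  have "\<exists>v. \<pi> v = dagger \<xi>"
    using pi_surj by (metis surjD)
  from someI_ex[OF this] show ?thesis
    using apaths_ends[OF x] dagger_ends[of "fst \<xi>" "snd \<xi>"] x
    by (simp add: lift_def pi_ep)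
qed

lemma range_H_eq: "range H = {v. \<pi> v = 0}"
proof -
  have "H c \<in> \<eta> ` carrier A" for c
  proof -
    define f where "f = (\<lambda>q. if q \<in> apaths Q I then c q else 0)"
    have "finite {q. f q \<noteq> 0}"
      by (rule finite_subset[OF _ fin_apaths]) (auto simp: f_def)
    then have f: "f \<in> carrier PA"
      by (auto simp: carrier_path_algebra f_def apaths_in_paths)
    have "\<eta> (cl f) = H c"
      unfolding eta_cl[OF f] H_def nonzero_paths_eq
      by (rule sum.cong) (simp_all add: f_def eta_cls m_def M_def)
    then show ?thesis
      using cl_carrier[OF f] by (metis image_eqI)
  qed
  moreover have "\<eta> X \<in> range H" if "X \<in> carrier A" for X
  proof -
    obtain f where f: "f \<in> carrier PA" "X = cl f"
      using \<open>X \<in> carrier A\<close> by (auto simp: A_carrier)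
    have "\<eta> X = H f"
      unfolding f(2) eta_cl[OF f(1)] H_def nonzero_paths_eq
      by (rule sum.cong) (simp_all add: eta_cls m_def M_def)
    then show ?thesis
      by simp
  qed
  ultimately have "range H = \<eta> ` carrier A"
    by blast
  then show ?thesis
    using eta_range by simp
qed

interpretation pi: Vector_Spaces.linear scaleV scaleE \<pi>
  by (rule pi_linear)

lemma maximal_apath: "maximal \<rho> \<Longrightarrow> (src \<rho>, \<rho>) \<in> apaths Q I \<and> endv Q (src \<rho>) \<rho> = tgt \<rho>"
  using maximalD(1,2)[of \<rho>] by (simp add: nonzero_paths_def endv_def tgt_def flip: nonzero_paths_eq)

lemma eta_maximal: "maximal \<rho> \<Longrightarrow> \<eta> (cls Q I (src \<rho>, \<rho>)) = M \<rho>"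
  using maximal_apath[of \<rho>] maximalD(1)[of \<rho>] by (simp add: eta_cls M_def)

lemma pi_mult_maximal: "maximal \<rho> \<Longrightarrow> \<pi> (v * M \<rho>) = ract (\<pi> v) (cls Q I (src \<rho>, \<rho>))"
  using maximal_apath[of \<rho>] by (simp add: pi_right cls_carrier flip: eta_maximal)

text \<open>
  Each assumption about the lifts translates a product in \<open>E\<close>, by exactness. For \<open>mod_l\<close>, expand \<open>\<pi> v\<close> in the
  basis: if \<open>\<omega>\<^sup>\<dagger>\<rho> \<noteq> 0\<close>, then \<open>\<omega>\<close> starts with \<open>\<rho>\<close>, so \<open>\<omega> = \<rho>\<close> by maximality. The bound on the dimension of \<open>V\<close>
  comes from the paths together with the lifts of the basis of \<open>E\<close>.
\<close>

lemma dual_extension_V: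
  "dual_extension Q flow scaleV ep arr (\<lambda>a. lift (a, [])) (\<lambda>\<rho>. lift (src \<rho>, \<rho>))"
proof unfold_locales
  fix \<rho> \<alpha>
  assume "maximal \<rho>" "\<alpha> \<in> arcs Q" "tail Q \<alpha> = src \<rho>" "head Q \<alpha> = tgt \<rho>"
  then show "\<rho> = [\<alpha>]"
    using no_parallel_arrow maximal_apath[of \<rho>]
    by (fastforce simp: max_paths_eq psource_def ptarget_eq)
next
  fix a
  assume a: "a \<in> verts Q"
  then show "ep a * lift (a, []) = lift (a, [])" "lift (a, []) * ep a = lift (a, [])"
    using e_mult[OF a a] by (simp_all add: lift_def mult.assoc) (simp flip: mult.assoc)
  show "lift (a, []) \<notin> range H"
    using a dagger_neq_0[of "(a, [])"] by (simp add: range_H_eq pi_lift trivial_in_apaths)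
  fix \<alpha>
  assume al: "\<alpha> \<in> arcs Q"
  show "arr \<alpha> * lift (a, []) \<in> range H" "lift (a, []) * arr \<alpha> \<in> range H"
    using a al by (simp_all add: range_H_eq pi_lift trivial_in_apaths pi_arr lact_dagger ract_dagger arrow_in_apaths)
next
  fix \<rho>
  assume r: "maximal \<rho>"
  note ap = maximal_apath[OF r] and d = maximalD[OF r]
  have v: "src \<rho> \<in> verts Q" "tgt \<rho> \<in> verts Q"
    using thread_src_in thread_tgt_in d by blast+
  show "ep (tgt \<rho>) * lift (src \<rho>, \<rho>) = lift (src \<rho>, \<rho>)"
    using ap e_mult[OF v(2) v(2)] by (simp add: lift_def flip: mult.assoc)
  show "lift (src \<rho>, \<rho>) * ep (src \<rho>) = lift (src \<rho>, \<rho>)"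
    using ap e_mult[OF v(1) v(1)] by (simp add: lift_def mult.assoc)
  show "arr \<alpha> * lift (src \<rho>, \<rho>) \<in> range H" if "\<alpha> \<in> arcs Q" "\<alpha> \<noteq> last \<rho>" for \<alpha>
  proof -
    have "drop i \<rho> \<noteq> [\<alpha>]" for i
      using that(2) by (metis last_ConsL last_drop drop_eq_Nil list.distinct(1) not_less)
    then show ?thesis
      using ap that by (simp add: range_H_eq pi_lift pi_arr lact_dagger arrow_in_apaths)
  qed
  show "lift (src \<rho>, \<rho>) * arr \<alpha> \<in> range H" if "\<alpha> \<in> arcs Q" "\<alpha> \<noteq> hd \<rho>" for \<alpha>
  proof -
    have "take i \<rho> \<noteq> [\<alpha>]" for i
      using that(2) by (cases \<rho>; cases i) auto
    then show ?thesis
      using ap that by (simp add: range_H_eq pi_lift pi_arr ract_dagger arrow_in_apaths)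
  qed
  show "\<exists>C. lift (src \<rho>, \<rho>) * M \<rho> - scaleV C (lift (tgt \<rho>, [])) \<in> range H"
  proof -
    obtain C where "ract (dagger (src \<rho>, \<rho>)) (cls Q I (src \<rho>, \<rho>)) = scaleE C (dagger (tgt \<rho>, []))"
      using ract_dagger_self[of "src \<rho>" \<rho>] ap d(1) by auto
    then have "\<pi> (lift (src \<rho>, \<rho>) * M \<rho> - scaleV C (lift (tgt \<rho>, []))) = 0"
      using ap v by (simp add: pi.diff pi.scale pi_mult_maximal r pi_lift trivial_in_apaths)
    then show ?thesis
      unfolding range_H_eq by blast
  qed
  show "\<exists>k. (v - scaleV k (lift (src \<rho>, \<rho>))) * M \<rho> \<in> range H" for v
  proof -
    have kill: "ract (dagger p) (cls Q I (src \<rho>, \<rho>)) = 0" if "p \<in> apaths Q I" "p \<noteq> (src \<rho>, \<rho>)" for p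
    proof (rule ract_dagger)
      fix i
      show "take i (snd p) \<noteq> snd (src \<rho>, \<rho>)"
      proof
        assume t: "take i (snd p) = snd (src \<rho>, \<rho>)"
        have ne: "snd p \<noteq> []"
          using t d(1) by auto
        then have p: "p = (src (snd p), snd p)" "thread (snd p)"
          using that(1) unfolding nonzero_paths_eq[symmetric] by (cases p; auto simp: nonzero_paths_def)+
        have e: "snd p = \<rho> @ drop i (snd p)"
          using t by (metis append_take_drop_id snd_conv)
        then have "thread (\<rho> @ drop i (snd p))"
          using p(2) by simp
        then have "drop i (snd p) = []"
          using d by (auto simp: thread_append)
        then have "snd p = \<rho>"
          using e by simp
        then show False
          using p(1) that(2) by simp
      qed
    qed (use that ap d in auto)
    have "\<pi> v \<in> B.span (dagger ` apaths Q I)"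
      by (simp add: dagger_span)
    then have "\<exists>k. ract (\<pi> v - scaleE k (dagger (src \<rho>, \<rho>))) (cls Q I (src \<rho>, \<rho>)) = 0"
    proof (induction rule: B.span_induct_alt)
      case base
      show ?case
        using kill B.ract_scale[of "cls Q I (src \<rho>, \<rho>)" 0 0] ap
        by (intro exI[of _ 0]) (simp add: cls_carrier)
    next
      case (step c x y)
      then obtain k p where k: "ract (y - scaleE k (dagger (src \<rho>, \<rho>))) (cls Q I (src \<rho>, \<rho>)) = 0"
        and p: "p \<in> apaths Q I" "x = dagger p"
        by blast
      define k' where "k' = (if p = (src \<rho>, \<rho>) then k + c else k)"
      have c: "cls Q I (src \<rho>, \<rho>) \<in> carrier A"
        using ap by (simp add: cls_carrier)
      have "ract (scaleE c x + y - scaleE k' (dagger (src \<rho>, \<rho>))) (cls Q I (src \<rho>, \<rho>)) = 0"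
      proof (cases "p = (src \<rho>, \<rho>)")
        case True
        then have "scaleE c x + y - scaleE k' (dagger (src \<rho>, \<rho>)) = y - scaleE k (dagger (src \<rho>, \<rho>))"
          by (simp add: k'_def p B.scale_left_distrib)
        then show ?thesis
          by (simp only: k)
      next
        case False
        have eq: "scaleE c x + y - scaleE k' (dagger (src \<rho>, \<rho>)) =
            scaleE c x + (y - scaleE k (dagger (src \<rho>, \<rho>)))"
          using False by (simp add: k'_def)
        show ?thesis
          unfolding eq B.ract_add[OF c] k using kill[OF p(1) False] c by (simp add: B.ract_scale p)
      qed
      then show ?case
        by blast
    qed
    then obtain k where k: "ract (\<pi> v - scaleE k (dagger (src \<rho>, \<rho>))) (cls Q I (src \<rho>, \<rho>)) = 0"
      by blast
    have "\<pi> ((v - scaleV k (lift (src \<rho>, \<rho>))) * M \<rho>) = 0"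
      using k ap by (simp add: pi_mult_maximal r pi.diff pi.scale pi_lift)
    then show ?thesis
      unfolding range_H_eq by blast
  qed
next
  show "\<exists>S. finite S \<and> card S \<le> 2 * card nonzero_paths \<and> span S = UNIV"
  proof (intro exI[of _ "m ` nonzero_paths \<union> lift ` nonzero_paths"] conjI)
    show "finite (m ` nonzero_paths \<union> lift ` nonzero_paths)"
      using finite_nonzero_paths by simp
    show "card (m ` nonzero_paths \<union> lift ` nonzero_paths) \<le> 2 * card nonzero_paths"
      using card_Un_le[of "m ` nonzero_paths" "lift ` nonzero_paths"] card_image_le[OF finite_nonzero_paths, of m]
        card_image_le[OF finite_nonzero_paths, of lift] by simp
    let ?S = "m ` nonzero_paths \<union> lift ` nonzero_paths"
    have H_span: "H c \<in> span ?S" for c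
      unfolding H_def by (intro span_sum span_scale span_base) simp
    have "\<exists>u\<in>span ?S. \<pi> u = x" if "x \<in> B.span (dagger ` apaths Q I)" for x
      using that
    proof (induction rule: B.span_induct_alt)
      case base
      show ?case
        by (intro bexI[of _ 0]) (simp_all add: pi.zero span_zero)
    next
      case (step c x y)
      then obtain u p where u: "u \<in> span ?S" "\<pi> u = y" and p: "p \<in> apaths Q I" "x = dagger p"
        by blast
      have "lift p \<in> span ?S"
        using p by (intro span_base) (simp add: nonzero_paths_eq)
      then have "scaleV c (lift p) + u \<in> span ?S"
        using u(1) by (intro span_add span_scale)
      moreover have "\<pi> (scaleV c (lift p) + u) = scaleE c x + y"
        using u p by (simp add: pi.add pi.scale pi_lift)
      ultimately show ?case
        by blast
    qed
    then have ex: "\<exists>u\<in>span ?S. \<pi> u = \<pi> v" for v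
      by (simp add: dagger_span)
    have "v \<in> span ?S" for v
    proof -
      obtain u where u: "u \<in> span ?S" "\<pi> u = \<pi> v"
        using ex by blast
      then have "v - u \<in> range H"
        unfolding range_H_eq by (simp add: pi.diff)
      then obtain c where "v - u = H c"
        by (rule rangeE)
      then have "v - u \<in> span ?S"
        by (simp only: H_span)
      then have "v - u + u \<in> span ?S"
        using u(1) by (rule span_add)
      then show ?thesis
        by simp
    qed
    then show "span ?S = UNIV"
      by blast
  qed
next
  fix x :: 'w
  assume "x \<noteq> 0"
  then show "\<exists>y. x * y * x \<noteq> 0"
    by (rule semisimple_ring_semiprime[OF V_semisimple])
qed

end

sublocale dual_sequence \<subseteq> dual_extension Q flow scaleV ep arr "\<lambda>a. lift (a, [])" "\<lambda>\<rho>. lift (src \<rho>, \<rho>)"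
  by (rule dual_extension_V)

section \<open>The isomorphism with \<open>V(A)\<close>\<close>

lemma inverse_alg_iso:
  fixes \<psi> :: "'x \<Rightarrow> 'w::ring_1" and scale :: "'k::field \<Rightarrow> 'w \<Rightarrow> 'w"
  assumes bij: "bij_betw \<psi> (carrier B) UNIV"
    and closed: "\<And>x y. \<lbrakk>x \<in> carrier B; y \<in> carrier B\<rbrakk> \<Longrightarrow> x \<otimes>\<^bsub>B\<^esub> y \<in> carrier B \<and> x \<oplus>\<^bsub>B\<^esub> y \<in> carrier B"
      "\<one>\<^bsub>B\<^esub> \<in> carrier B" "\<And>c x. x \<in> carrier B \<Longrightarrow> c \<odot>\<^bsub>B\<^esub> x \<in> carrier B"
    and hom: "\<And>x y. \<lbrakk>x \<in> carrier B; y \<in> carrier B\<rbrakk> \<Longrightarrow> \<psi> (x \<otimes>\<^bsub>B\<^esub> y) = \<psi> x * \<psi> y"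
      "\<And>x y. \<lbrakk>x \<in> carrier B; y \<in> carrier B\<rbrakk> \<Longrightarrow> \<psi> (x \<oplus>\<^bsub>B\<^esub> y) = \<psi> x + \<psi> y"
      "\<psi> \<one>\<^bsub>B\<^esub> = 1" "\<And>c x. x \<in> carrier B \<Longrightarrow> \<psi> (c \<odot>\<^bsub>B\<^esub> x) = scale c (\<psi> x)"
  shows "inv_into (carrier B) \<psi> \<in> alg_iso (alg_of scale) B"
proof -
  let ?\<phi> = "inv_into (carrier B) \<psi>"
  have phi: "?\<phi> v \<in> carrier B" "\<psi> (?\<phi> v) = v" for v
    using bij by (auto simp: bij_betw_def intro: inv_into_into f_inv_into_f)
  have eq: "?\<phi> v = x" if "x \<in> carrier B" "\<psi> x = v" for v x
    using that bij by (auto simp: bij_betw_def)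
  have "?\<phi> \<in> Ring.ring_hom (alg_of scale) B"
    by (rule Ring.ring_hom_memI) (simp_all add: alg_of_def eq phi closed hom)
  moreover have "?\<phi> (scale c v) = c \<odot>\<^bsub>B\<^esub> ?\<phi> v" for c v
    by (simp add: eq phi closed hom)
  moreover have "bij_betw ?\<phi> UNIV (carrier B)"
    using bij by (rule bij_betw_inv_into)
  ultimately show ?thesis
    by (simp add: alg_iso_def alg_hom_def alg_of_def)
qed

context dual_sequence
begin

text \<open>
  The inverse of the isomorphism \<open>\<phi>\<close> to be constructed.
\<close>

definition realize :: "(('v, 'a) qpath \<Rightarrow> 'k mat) \<times> ('v \<Rightarrow> 'k) \<Rightarrow> 'w" where
  "realize = (\<lambda>(X, Y). Psi (\<lambda>xs i j. X (src xs, xs) $$ (i, j)) Y)"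

abbreviation W :: "('k, (('v, 'a) qpath \<Rightarrow> 'k mat) \<times> ('v \<Rightarrow> 'k)) module" where
  "W \<equiv> VA Q I"

lemma carrier_VA:
  "(X, Y) \<in> carrier W \<longleftrightarrow>
    X \<in> extensional (max_paths Q I) \<and> Y \<in> extensional {a. solitary a} \<and>
    (\<forall>xs. maximal xs \<longrightarrow> X (src xs, xs) \<in> carrier_mat (length xs + 1) (length xs + 1))"
  by (auto simp: VA_def Let_def triv_vertices_eq max_paths_eq PiE_def Pi_def plength_def)

lemma maximal_in_max_paths: "maximal xs \<Longrightarrow> (src xs, xs) \<in> max_paths Q I"
  by (auto simp: max_paths_eq)

lemma realize_mult:
  assumes x: "x \<in> carrier W" and y: "y \<in> carrier W"
  shows "x \<otimes>\<^bsub>W\<^esub> y \<in> carrier W \<and> realize (x \<otimes>\<^bsub>W\<^esub> y) = realize x * realize y"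
proof -
  obtain X Y X' Y' where e: "x = (X, Y)" "y = (X', Y')"
    by (cases x; cases y)
  note dims = x[unfolded e carrier_VA] y[unfolded e carrier_VA]
  have prod: "x \<otimes>\<^bsub>W\<^esub> y = (\<lambda>\<rho>\<in>max_paths Q I. X \<rho> * X' \<rho>, \<lambda>a\<in>{a. solitary a}. Y a * Y' a)"
    by (simp add: e VA_def Let_def triv_vertices_eq)
  have "x \<otimes>\<^bsub>W\<^esub> y \<in> carrier W"
    unfolding prod carrier_VA using dims by (auto simp: maximal_in_max_paths intro!: mult_carrier_mat)
  moreover have "realize (x \<otimes>\<^bsub>W\<^esub> y) = realize x * realize y"
    unfolding prod unfolding e realize_def prod.case Psi_mult
  proof (rule Psi_cong)
    fix xs i j
    assume xs: "maximal xs" "i \<le> length xs" "j \<le> length xs"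
    then have "X (src xs, xs) \<in> carrier_mat (length xs + 1) (length xs + 1)"
      "X' (src xs, xs) \<in> carrier_mat (length xs + 1) (length xs + 1)"
      using dims by auto
    then have "(X (src xs, xs) * X' (src xs, xs)) $$ (i, j) =
        (\<Sum>k\<in>{0..<length xs + 1}. X (src xs, xs) $$ (i, k) * X' (src xs, xs) $$ (k, j))"
      using xs by (auto simp: scalar_prod_def)
    then show "(\<lambda>\<rho>\<in>max_paths Q I. X \<rho> * X' \<rho>) (src xs, xs) $$ (i, j) =
        (\<Sum>k\<le>length xs. X (src xs, xs) $$ (i, k) * X' (src xs, xs) $$ (k, j))"
      using xs by (simp add: maximal_in_max_paths atLeast0LessThan lessThan_Suc_atMost)
  qed simp
  ultimately show ?thesis ..
qed

lemma realize_add: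
  assumes x: "x \<in> carrier W" and y: "y \<in> carrier W"
  shows "x \<oplus>\<^bsub>W\<^esub> y \<in> carrier W \<and> realize (x \<oplus>\<^bsub>W\<^esub> y) = realize x + realize y"
proof -
  obtain X Y X' Y' where e: "x = (X, Y)" "y = (X', Y')"
    by (cases x; cases y)
  note dims = x[unfolded e carrier_VA] y[unfolded e carrier_VA]
  have sum: "x \<oplus>\<^bsub>W\<^esub> y = (\<lambda>\<rho>\<in>max_paths Q I. X \<rho> + X' \<rho>, \<lambda>a\<in>{a. solitary a}. Y a + Y' a)"
    by (simp add: e VA_def Let_def triv_vertices_eq)
  have "x \<oplus>\<^bsub>W\<^esub> y \<in> carrier W"
    unfolding sum carrier_VA using dims by (auto simp: maximal_in_max_paths intro!: add_carrier_mat)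
  moreover have "realize (x \<oplus>\<^bsub>W\<^esub> y) = realize x + realize y"
    unfolding sum unfolding e realize_def prod.case Psi_add
  proof (rule Psi_cong)
    fix xs i j
    assume xs: "maximal xs" "i \<le> length xs" "j \<le> length xs"
    then have "X' (src xs, xs) \<in> carrier_mat (length xs + 1) (length xs + 1)"
      using dims by auto
    then show "(\<lambda>\<rho>\<in>max_paths Q I. X \<rho> + X' \<rho>) (src xs, xs) $$ (i, j) =
        X (src xs, xs) $$ (i, j) + X' (src xs, xs) $$ (i, j)"
      using xs by (simp add: maximal_in_max_paths)
  qed simp
  ultimately show ?thesis ..
qed

lemma realize_smult:
  assumes x: "x \<in> carrier W"
  shows "c \<odot>\<^bsub>W\<^esub> x \<in> carrier W \<and> realize (c \<odot>\<^bsub>W\<^esub> x) = scaleV c (realize x)"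
proof -
  obtain X Y where e: "x = (X, Y)"
    by (cases x)
  note dims = x[unfolded e carrier_VA]
  have smult: "c \<odot>\<^bsub>W\<^esub> x = (\<lambda>\<rho>\<in>max_paths Q I. c \<cdot>\<^sub>m X \<rho>, \<lambda>a\<in>{a. solitary a}. c * Y a)"
    by (simp add: e VA_def Let_def triv_vertices_eq)
  have "c \<odot>\<^bsub>W\<^esub> x \<in> carrier W"
    unfolding smult carrier_VA using dims by (auto simp: maximal_in_max_paths)
  moreover have "realize (c \<odot>\<^bsub>W\<^esub> x) = scaleV c (realize x)"
    unfolding smult unfolding e realize_def prod.case Psi_scale
  proof (rule Psi_cong)
    fix xs i j
    assume xs: "maximal xs" "i \<le> length xs" "j \<le> length xs"
    then have "X (src xs, xs) \<in> carrier_mat (length xs + 1) (length xs + 1)"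
      using dims by auto
    then show "(\<lambda>\<rho>\<in>max_paths Q I. c \<cdot>\<^sub>m X \<rho>) (src xs, xs) $$ (i, j) = c * X (src xs, xs) $$ (i, j)"
      using xs by (simp add: maximal_in_max_paths)
  qed simp
  ultimately show ?thesis ..
qed

lemma one_in_VA: "\<one>\<^bsub>W\<^esub> \<in> carrier W"
proof -
  have "\<one>\<^bsub>W\<^esub> = (\<lambda>\<rho>\<in>max_paths Q I. 1\<^sub>m (plength \<rho> + 1), \<lambda>a\<in>{a. solitary a}. 1)"
    by (simp add: VA_def Let_def triv_vertices_eq)
  then show ?thesis
    by (simp add: carrier_VA maximal_in_max_paths plength_def)
qed

lemma one_mult_VA:
  assumes x: "x \<in> carrier W"
  shows "\<one>\<^bsub>W\<^esub> \<otimes>\<^bsub>W\<^esub> x = x"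
proof -
  obtain X Y where e: "x = (X, Y)"
    by (cases x)
  note dims = x[unfolded e carrier_VA]
  have "\<one>\<^bsub>W\<^esub> \<otimes>\<^bsub>W\<^esub> x = (\<lambda>\<rho>\<in>max_paths Q I. 1\<^sub>m (plength \<rho> + 1) * X \<rho>, \<lambda>a\<in>{a. solitary a}. Y a)"
    by (auto simp: e VA_def Let_def triv_vertices_eq)
  moreover have "(\<lambda>\<rho>\<in>max_paths Q I. 1\<^sub>m (plength \<rho> + 1) * X \<rho>) = X"
  proof (rule extensionalityI)
    fix \<rho>
    assume "\<rho> \<in> max_paths Q I"
    moreover from this have "X \<rho> \<in> carrier_mat (plength \<rho> + 1) (plength \<rho> + 1)"
      using dims by (auto simp: max_paths_eq plength_def)
    ultimately show "(\<lambda>\<rho>\<in>max_paths Q I. 1\<^sub>m (plength \<rho> + 1) * X \<rho>) \<rho> = X \<rho>"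
      by simp
  qed (use dims in auto)
  moreover have "(\<lambda>a\<in>{a. solitary a}. Y a) = Y"
    using dims by (intro extensional_restrict) simp
  ultimately show ?thesis
    by (simp add: e)
qed

lemma realize_bij: "bij_betw realize (carrier W) UNIV"
  unfolding bij_betw_def
proof
  show "inj_on realize (carrier W)"
  proof (rule inj_onI)
    fix x y
    assume x: "x \<in> carrier W" and y: "y \<in> carrier W" and eq: "realize x = realize y"
    obtain X Y X' Y' where e: "x = (X, Y)" "y = (X', Y')"
      by (cases x; cases y)
    note dims = x[unfolded e carrier_VA] y[unfolded e carrier_VA]
    have z: "Psi (\<lambda>xs i j. X (src xs, xs) $$ (i, j) - X' (src xs, xs) $$ (i, j)) (\<lambda>a. Y a - Y' a) = 0"
      using eq by (simp add: e realize_def flip: Psi_diff)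
    have "X = X'"
    proof (rule extensionalityI)
      fix \<rho>
      assume "\<rho> \<in> max_paths Q I"
      then obtain xs where xs: "maximal xs" "\<rho> = (src xs, xs)"
        by (auto simp: max_paths_eq)
      have d: "X \<rho> \<in> carrier_mat (length xs + 1) (length xs + 1)"
        "X' \<rho> \<in> carrier_mat (length xs + 1) (length xs + 1)"
        using dims xs by auto
      show "X \<rho> = X' \<rho>"
      proof (rule eq_matI)
        fix i j
        assume "i < dim_row (X' \<rho>)" "j < dim_col (X' \<rho>)"
        then show "X \<rho> $$ (i, j) = X' \<rho> $$ (i, j)"
          using Psi_eq_0(1)[OF z xs(1), of i j] d xs(2) by simp
      qed (use d in auto)
    qed (use dims in auto)
    moreover have "Y = Y'"
    proof (rule extensionalityI)
      fix a
      assume "a \<in> {a. solitary a}"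
      then show "Y a = Y' a"
        using Psi_eq_0(2)[OF z, of a] by simp
    qed (use dims in auto)
    ultimately show "x = y"
      by (simp add: e)
  qed
  show "realize ` carrier W = UNIV"
  proof (rule UNIV_eq_I[symmetric])
    fix v
    obtain X Y where v: "v = Psi X Y"
      using Psi_surj by blast
    define x where "x = (\<lambda>\<rho>\<in>max_paths Q I. mat (plength \<rho> + 1) (plength \<rho> + 1) (\<lambda>(i, j). X (snd \<rho>) i j),
      \<lambda>a\<in>{a. solitary a}. Y a)"
    have "x \<in> carrier W"
      by (simp add: x_def carrier_VA maximal_in_max_paths plength_def)
    moreover have "realize x = v"
      unfolding x_def realize_def prod.case v
      by (rule Psi_cong) (simp_all add: maximal_in_max_paths plength_def)
    ultimately show "v \<in> realize ` carrier W"
      by blast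
  qed
qed

text \<open>
  A surjective multiplicative map preserves the identity.
\<close>

lemma realize_one: "realize \<one>\<^bsub>W\<^esub> = 1"
proof -
  have "1 \<in> realize ` carrier W"
    using realize_bij by (simp add: bij_betw_def)
  then obtain x where x: "x \<in> carrier W" "realize x = 1"
    by (elim imageE) simp
  then show ?thesis
    using realize_mult[OF one_in_VA x(1)] one_mult_VA[OF x(1)] by simp
qed

lemma Psi_sum:
  "finite S \<Longrightarrow> Psi (\<lambda>\<rho> i j. \<Sum>\<theta>\<in>S. c \<theta> * X \<theta> \<rho> i j) (\<lambda>a. \<Sum>\<theta>\<in>S. c \<theta> * Y \<theta> a) =
    (\<Sum>\<theta>\<in>S. scaleV (c \<theta>) (Psi (X \<theta>) (Y \<theta>)))"
proof (induction S rule: finite_induct)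
  case empty
  then show ?case
    by (simp add: Psi_def)
next
  case (insert \<theta> S)
  have "Psi (\<lambda>\<rho> i j. \<Sum>\<theta>\<in>insert \<theta> S. c \<theta> * X \<theta> \<rho> i j) (\<lambda>a. \<Sum>\<theta>\<in>insert \<theta> S. c \<theta> * Y \<theta> a) =
      scaleV (c \<theta>) (Psi (X \<theta>) (Y \<theta>)) +
      Psi (\<lambda>\<rho> i j. \<Sum>\<theta>\<in>S. c \<theta> * X \<theta> \<rho> i j) (\<lambda>a. \<Sum>\<theta>\<in>S. c \<theta> * Y \<theta> a)"
    using insert.hyps by (simp add: Psi_scale Psi_add)
  then show ?case
    using insert by simp
qed

text \<open>
  Both sides are linear in \<open>X\<close>, and on a path in \<open>A\<close> the claim is the expansion of that path in matrix
  units.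
\<close>

lemma realize_eta:
  assumes X: "X \<in> carrier A"
  shows "eta Q I X \<in> carrier W \<and> realize (eta Q I X) = \<eta> X"
proof -
  obtain f where f: "f \<in> carrier PA" "X = cl f"
    using X by (auto simp: A_carrier)
  have coord: "dual_path Q I \<theta> X = f \<theta>" if "\<theta> \<in> apaths Q I" for \<theta>
    using X that f by (simp add: dual_path_eq[OF fin_apaths] coef_cl)
  have "eta Q I X \<in> carrier W"
    by (simp add: eta_def carrier_VA maximal_in_max_paths triv_vertices_eq eta_max_def plength_def)
  moreover have "realize (eta Q I X) = \<eta> X"
  proof -
    have "realize (eta Q I X) =
        Psi (\<lambda>xs i j. \<Sum>\<theta>\<in>apaths Q I. f \<theta> * (if i \<le> j \<and> \<theta> = (vert xs i, drop i (take j xs)) then 1 else 0))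
          (\<lambda>a. \<Sum>\<theta>\<in>apaths Q I. f \<theta> * (if \<theta> = (a, []) then 1 else 0))"
      unfolding realize_def eta_def prod.case
    proof (rule Psi_cong)
      fix xs i j
      assume xs: "maximal xs" "i \<le> length xs" "j \<le> length xs"
      have "subpath Q (src xs, xs) i j = (vert xs i, drop i (take j xs))"
        using xs(2) maximalD(1)[OF xs(1)]
        by (cases i) (auto simp: subpath_eq endv_def vert_def last_conv_nth)
      then show "(\<lambda>\<rho>\<in>max_paths Q I. eta_max Q I \<rho> X) (src xs, xs) $$ (i, j) =
          (\<Sum>\<theta>\<in>apaths Q I. f \<theta> * (if i \<le> j \<and> \<theta> = (vert xs i, drop i (take j xs)) then 1 else 0))"
        using xs by (simp add: maximal_in_max_paths eta_max_def eta_path_def plength_def coord)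
    next
      fix a
      assume "solitary a"
      then show "(\<lambda>a\<in>triv_vertices Q I. eta_vertex Q I a X) a =
          (\<Sum>\<theta>\<in>apaths Q I. f \<theta> * (if \<theta> = (a, []) then 1 else 0))"
        by (simp add: triv_vertices_eq eta_vertex_def coord)
    qed
    also have "\<dots> = (\<Sum>\<theta>\<in>apaths Q I. scaleV (f \<theta>)
        (Psi (\<lambda>xs i j. if i \<le> j \<and> \<theta> = (vert xs i, drop i (take j xs)) then 1 else 0)
          (\<lambda>a. if \<theta> = (a, []) then 1 else 0)))"
      by (rule Psi_sum[OF fin_apaths])
    also have "\<dots> = (\<Sum>\<theta>\<in>apaths Q I. scaleV (f \<theta>) (\<eta> (cls Q I \<theta>)))"
      by (rule sum.cong[OF refl]) (simp add: nonzero_paths_eq eta_cls flip: m_eq_Psi, simp add: m_def M_def)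
    also have "\<dots> = \<eta> X"
      unfolding f(2) eta_cl[OF f(1)] ..
    finally show ?thesis .
  qed
  ultimately show ?thesis
    by blast
qed

lemma ex_alg_iso:
  "\<exists>\<phi> \<in> alg_iso (alg_of scaleV) W. \<forall>X \<in> carrier A. \<phi> (\<eta> X) = eta Q I X"
proof
  show "inv_into (carrier W) realize \<in> alg_iso (alg_of scaleV) W"
    by (rule inverse_alg_iso)
      (simp_all add: realize_bij realize_mult realize_add realize_smult realize_one one_in_VA)
  show "\<forall>X\<in>carrier A. inv_into (carrier W) realize (\<eta> X) = eta Q I X"
  proof
    fix X
    assume "X \<in> carrier A"
    then have "eta Q I X \<in> carrier W" "realize (eta Q I X) = \<eta> X"
      using realize_eta by simp_all
    then show "inv_into (carrier W) realize (\<eta> X) = eta Q I X"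
      using inv_into_f_f[OF bij_betw_imp_inj_on[OF realize_bij]] by fastforce
  qed
qed

end

theorem theorem8p2:
  fixes Q :: "('v, 'a) pre_digraph"
    and I :: "(('v, 'a) qpath \<Rightarrow> 'k::alg_closed_field) set"
    and scaleV :: "'k \<Rightarrow> 'w::ring_1 \<Rightarrow> 'w"
    and scaleE :: "'k \<Rightarrow> 'e::ab_group_add \<Rightarrow> 'e"
    and lact :: "(('v, 'a) qpath \<Rightarrow> 'k) set \<Rightarrow> 'e \<Rightarrow> 'e"
    and ract :: "'e \<Rightarrow> (('v, 'a) qpath \<Rightarrow> 'k) set \<Rightarrow> 'e"
    and \<eta>' :: "(('v, 'a) qpath \<Rightarrow> 'k) set \<Rightarrow> 'w"
    and \<pi> :: "'w \<Rightarrow> 'e"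
  assumes char: "CHAR('k) \<noteq> 2"
    and connected: "Digraph_Component.connected Q"
    and arrows: "arcs Q \<noteq> {}"
    and gentle: "gentle Q I"
    and no_parallel: "\<forall>\<rho> \<in> max_paths Q I. \<not> (\<exists>\<alpha> \<in> arcs Q.
          tail Q \<alpha> = psource \<rho> \<and> head Q \<alpha> = ptarget Q \<rho> \<and> (tail Q \<alpha>, [\<alpha>]) \<noteq> \<rho>)"
    and V_algebra: "k_algebra scaleV"
    and E_bimodule: "bimodule (quiver_algebra Q I) scaleE lact ract"
    and exact: "short_exact (quiver_algebra Q I) scaleV scaleE lact ract \<eta>' \<pi>"
    and v1: "semisimple_ring TYPE('w)"
    and v2: "\<eta>' \<in> alg_hom (quiver_algebra Q I) (alg_of scaleV)"
    and v3: "almost_standard_dual Q I scaleE lact ract"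
  shows "\<exists>\<phi> \<in> alg_iso (alg_of scaleV) (VA Q I).
           \<forall>x \<in> carrier (quiver_algebra Q I). \<phi> (\<eta>' x) = eta Q I x"
proof -
  obtain R where "fin_digraph Q" "R \<subseteq> {p \<in> paths Q. plength p = 2}"
    and "I = Idl\<^bsub>path_algebra Q\<^esub> (single ` R)"
    using gentle unfolding gentle_def locally_gentle_def by blast
  then interpret dual_sequence Q I R scaleV scaleE lact ract \<eta>' \<pi>
    using connected arrows gentle no_parallel V_algebra E_bimodule exact v1 v3
    by (intro dual_sequence.intro bound_quiver.intro quiver.intro bound_quiver_axioms.intro
        dual_sequence_axioms.intro)
  show ?thesis
    by (rule ex_alg_iso)
qed

end
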